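(* Let $\pmb k$ be an algebraically closed field of characteristic zero and let $B,d,n,g_1,\dots,g_n,\Psi,\mathcal C,\varphi$ be as in the context. Let $p_1,\dots,p_z$ be the singularities of $\mathcal C$. For each singular point $p_j$, let $m_j$ be the multiplicity of $\mathcal C$ at $p_j$ and $s_j$ be the number of branches of $\mathcal C$ at $p_j$. For each index $j$, with $1\le j\le z$, let $\gcd I_1(p_j\varphi)=\prod_{u=1}^{s_j}\ell_{u,j}^{e_{u,j}}$, where the $\ell_{u,j}$ are pairwise non-associated linear factors and the exponents $e_{u,j}$ are positive. Let $$N=\begin{bmatrix}\frac{\partial g_1}{\partial x}&\cdots&\frac{\partial g_n}{\partial x}\\[3pt]\frac{\partial g_1}{\partial y}&\cdots&\frac{\partial g_n}{\partial y}\end{bmatrix}$$ be the $2\times n$ Jacobian matrix of the parametrization. Then (1) $\gcd I_2(N)=\prod_{j=1}^z\prod_{u=1}^{s_j}\ell_{u,j}^{e_{u,j}-1}$, and (2) the degree of $\gcd I_2(N)$ is equal to $\sum_{j=1}^z(m_j-s_j)$.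
   Context: Setting: $B=\pmb k[x,y]$ is the standard graded polynomial ring, $g_1,\dots,g_n$ are homogeneous forms of degree $d$ in $B$, $I=(g_1,\dots,g_n)B$, $\Psi:\mathbb P^1\to\mathbb P^{n-1}$ is the morphism $[g_1:\dots:g_n]$, and $\mathcal C$ is the image of $\Psi$. Assume: $I$ is minimally generated by $g_1,\dots,g_n$; $I$ has height two; and $\Psi:\mathbb P^1\to\mathcal C$ is a birational morphism. Let $\varphi$ be a homogeneous Hilbert-Burch matrix for $[g_1,\dots,g_n]$: an $n\times(n-1)$ matrix such that $0\to\bigoplus_{i=1}^{n-1}B(-d_i-d)\xrightarrow{\varphi}B(-d)^n\xrightarrow{[g_1,\dots,g_n]}I\to0$ is a homogeneous resolution of $I$. A point $p\in\mathbb P^{n-1}$ is also viewed as a row vector (up to non-zero scalar). $I_r(M)$ is the ideal generated by the $r\times r$ minors of $M$; the $\gcd$ of an ideal is the greatest common divisor of a generating set (defined up to unit). The multiplicity of $\mathcal C$ at $p$ is the multiplicity of $\mathcal O_{\mathcal C,p}$, and the number of branches of $\mathcal C$ at $p$ is the number of minimal primes of the completion $\widehat{\mathcal O_{\mathcal C,p}}$. *)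

theory Defs
  imports
    "HOL-Library.Poly_Mapping"
    "HOL-Library.Extended_Nat"
    "HOL-Computational_Algebra.Fraction_Field"
    "HOL-Algebra.Algebraic_Closure_Type"
    "HOL-Algebra.QuotRing"
    "HOL-Algebra.Ideal_Product"
    "Jordan_Normal_Form.Determinant"
    "Jordan_Normal_Form.DL_Submatrix"
begin

section \<open>Commutative algebra\<close>

definition prime_chain :: "('a, 'b) ring_scheme \<Rightarrow> nat \<Rightarrow> (nat \<Rightarrow> 'a set) \<Rightarrow> bool" where
  "prime_chain R l P \<longleftrightarrow> (\<forall>i\<le>l. primeideal (P i) R) \<and> (\<forall>i<l. P i \<subset> P (Suc i))"

definition krull_dim :: "('a, 'b) ring_scheme \<Rightarrow> enat" where
  "krull_dim R = (SUP l \<in> {l. \<exists>P. prime_chain R l P}. enat l)"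

definition prime_height :: "('a, 'b) ring_scheme \<Rightarrow> 'a set \<Rightarrow> enat" where
  "prime_height R Q = (SUP l \<in> {l. \<exists>P. prime_chain R l P \<and> P l = Q}. enat l)"

text \<open>The unit ideal has height \<open>\<infinity>\<close>, the infimum of the empty set.\<close>

definition ideal_height :: "('a, 'b) ring_scheme \<Rightarrow> 'a set \<Rightarrow> enat" where
  "ideal_height R I = (INF Q \<in> {Q. primeideal Q R \<and> I \<subseteq> Q}. prime_height R Q)"

definition minimal_primes :: "('a, 'b) ring_scheme \<Rightarrow> 'a set set" where
  "minimal_primes R = {P. primeideal P R \<and> (\<forall>Q. primeideal Q R \<and> Q \<subseteq> P \<longrightarrow> Q = P)}"

text \<open>Length of \<open>R\<close> as a module over itself: its submodules are its ideals.\<close>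

definition ring_length :: "('a, 'b) ring_scheme \<Rightarrow> enat" where
  "ring_length R = (SUP l \<in> {l. \<exists>J :: nat \<Rightarrow> 'a set.
     (\<forall>i\<le>l. ideal (J i) R) \<and> (\<forall>i<l. J i \<subset> J (Suc i))}. enat l)"

text \<open>The following notions are meant for a Noetherian local ring \<open>R\<close>.\<close>

definition max_ideal :: "('a, 'b) ring_scheme \<Rightarrow> 'a set" where
  "max_ideal R = (THE m. maximalideal m R)"

definition max_ideal_pow :: "('a, 'b) ring_scheme \<Rightarrow> nat \<Rightarrow> 'a set" where
  "max_ideal_pow R t = max_ideal R [^]\<^bsub>ideals_set R\<^esub> t"

definition regular_local_ring :: "('a, 'b) ring_scheme \<Rightarrow> bool" where
  "regular_local_ring R \<longleftrightarrow>
     (\<exists>S \<subseteq> carrier R. finite S \<and> enat (card S) = krull_dim R \<and> Idl\<^bsub>R\<^esub> S = max_ideal R)"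

text \<open>Hilbert-Samuel multiplicity:
  \<open>e(R) = lim D! \<lambda>(R/m\<^sup>t) / t\<^sup>D\<close> as \<open>t \<rightarrow> \<infinity>\<close>, where \<open>D = dim R\<close>.\<close>

definition samuel_multiplicity :: "('a, 'b) ring_scheme \<Rightarrow> nat" where
  "samuel_multiplicity R = (THE e. let D = the_enat (krull_dim R) in
     (\<lambda>t. fact D * real (the_enat (ring_length (R Quot max_ideal_pow R t))) / real t ^ D)
       \<longlonglongrightarrow> real e)"

text \<open>The inverse limit of the rings \<open>R/m\<^sup>t\<close>. Its elements are coherent sequences of cosets; the
  canonical map \<open>R/m\<^sup>t\<^sup>+\<^sup>1 \<rightarrow> R/m\<^sup>t\<close> sends a coset \<open>c\<close> to the unique coset of \<open>m\<^sup>t\<close> containing \<open>c\<close>.\<close>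

definition completion :: "('a, 'b) ring_scheme \<Rightarrow> (nat \<Rightarrow> 'a set) ring" where
  "completion R = \<lparr>
     carrier = {f. (\<forall>t. f t \<in> carrier (R Quot max_ideal_pow R t)) \<and> (\<forall>t. f (Suc t) \<subseteq> f t)},
     monoid.mult = (\<lambda>f h t. f t \<otimes>\<^bsub>R Quot max_ideal_pow R t\<^esub> h t),
     one = (\<lambda>t. \<one>\<^bsub>R Quot max_ideal_pow R t\<^esub>),
     ring.zero = (\<lambda>t. \<zero>\<^bsub>R Quot max_ideal_pow R t\<^esub>),
     add = (\<lambda>f h t. f t \<oplus>\<^bsub>R Quot max_ideal_pow R t\<^esub> h t)\<rparr>"

definition branch_number :: "('a, 'b) ring_scheme \<Rightarrow> nat" where
  "branch_number R = card (minimal_primes (completion R))"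

section \<open>Divisibility and determinantal ideals\<close>

text \<open>Greatest common divisors are only determined up to units. The gcd of an ideal \<open>J\<close> is
  \<open>is_gcd J\<close>: the common divisors of \<open>J\<close> and of any generating set of \<open>J\<close> are the same.\<close>

definition is_gcd :: "'a :: comm_ring_1 set \<Rightarrow> 'a \<Rightarrow> bool" where
  "is_gcd S h \<longleftrightarrow> (\<forall>s\<in>S. h dvd s) \<and> (\<forall>c. (\<forall>s\<in>S. c dvd s) \<longrightarrow> c dvd h)"

definition associates :: "'a :: comm_ring_1 \<Rightarrow> 'a \<Rightarrow> bool" where
  "associates a b \<longleftrightarrow> a dvd b \<and> b dvd a"

definition gen_ideal :: "'a :: comm_ring_1 set \<Rightarrow> 'a set" where
  "gen_ideal S = Idl\<^bsub>ring_of_type_algebra\<^esub> S"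

definition minors_ideal :: "nat \<Rightarrow> 'a :: comm_ring_1 mat \<Rightarrow> 'a set" where
  "minors_ideal r M = gen_ideal {det (submatrix M I J) | I J.
     I \<subseteq> {..<dim_row M} \<and> J \<subseteq> {..<dim_col M} \<and> card I = r \<and> card J = r}"

section \<open>Binary forms\<close>

text \<open>\<open>k[x,y]\<close> is \<open>'k poly poly\<close>; the inner variable is \<open>x\<close> and the outer one is \<open>y\<close>.\<close>

definition bihomogeneous :: "nat \<Rightarrow> 'k :: zero poly poly \<Rightarrow> bool" where
  "bihomogeneous d f \<longleftrightarrow>
     (\<forall>i j. Polynomial.coeff (Polynomial.coeff f j) i \<noteq> 0 \<longrightarrow> i + j = d)"

definition total_degree :: "'k :: zero poly poly \<Rightarrow> nat" where
  "total_degree f = Sup {i + j | i j. Polynomial.coeff (Polynomial.coeff f j) i \<noteq> 0}"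

definition eval2 :: "'k :: comm_ring_1 poly poly \<Rightarrow> 'k \<Rightarrow> 'k \<Rightarrow> 'k" where
  "eval2 f a b = poly (poly f [:b:]) a"

definition deriv_x :: "'k :: field_char_0 poly poly \<Rightarrow> 'k poly poly" where
  "deriv_x f = map_poly pderiv f"

definition deriv_y :: "'k :: field_char_0 poly poly \<Rightarrow> 'k poly poly" where
  "deriv_y f = pderiv f"

definition jacobian_matrix :: "'k :: field_char_0 poly poly vec \<Rightarrow> 'k poly poly mat" where
  "jacobian_matrix g =
     mat 2 (dim_vec g) (\<lambda>(i, j). if i = 0 then deriv_x (g $ j) else deriv_y (g $ j))"

definition linear_form :: "'k :: zero poly poly \<Rightarrow> bool" where
  "linear_form l \<longleftrightarrow> l \<noteq> 0 \<and> bihomogeneous 1 l"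

definition minimally_generated :: "'a :: comm_ring_1 vec \<Rightarrow> bool" where
  "minimally_generated g \<longleftrightarrow> (\<forall>i<dim_vec g.
     gen_ideal {g $ j | j. j < dim_vec g \<and> j \<noteq> i} \<noteq> gen_ideal {g $ j | j. j < dim_vec g})"

text \<open>\<open>0 \<rightarrow> \<Oplus>\<^sub>j B(-D\<^sub>j-d) \<rightarrow> B(-d)\<^sup>n \<rightarrow> I \<rightarrow> 0\<close> is exact, with maps \<open>\<phi>\<close> and \<open>g\<close>. Homogeneity of \<open>\<phi>\<close> means that
  the entries of its \<open>j\<close>-th column are forms of degree \<open>D\<^sub>j\<close>; the twists are non-negative because
  an injective \<open>\<phi>\<close> has no zero column. Surjectivity of \<open>g\<close> onto \<open>I\<close> holds by definition of \<open>I\<close>.\<close>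

definition hilbert_burch_matrix :: "'k :: field poly poly vec \<Rightarrow> 'k poly poly mat \<Rightarrow> bool" where
  "hilbert_burch_matrix g \<phi> \<longleftrightarrow> (let n = dim_vec g in
     \<phi> \<in> carrier_mat n (n - 1) \<and>
     (\<exists>D. \<forall>i<n. \<forall>j<n - 1. bihomogeneous (D j) (\<phi> $$ (i, j))) \<and>
     (\<forall>w \<in> carrier_vec (n - 1). \<phi> *\<^sub>v w = 0\<^sub>v n \<longrightarrow> w = 0\<^sub>v (n - 1)) \<and>
     (\<forall>v \<in> carrier_vec n. g \<bullet> v = 0 \<longleftrightarrow> (\<exists>w \<in> carrier_vec (n - 1). v = \<phi> *\<^sub>v w)))"

text \<open>The row vector \<open>p\<phi>\<close>, as a matrix with one row.\<close>

definition row_times :: "'k :: field vec \<Rightarrow> 'k poly poly mat \<Rightarrow> 'k poly poly mat" where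
  "row_times p \<phi> = mat_of_row (map_vec (\<lambda>c. [:[:c:]:]) p) * \<phi>"

section \<open>Rational curves in projective space\<close>

text \<open>Points of \<open>\<P>\<^sup>n\<^sup>-\<^sup>1\<close> are represented by non-zero vectors of length \<open>n\<close>, points of \<open>\<P>\<^sup>1\<close> by pairs
  \<open>(a, b) \<noteq> (0, 0)\<close>.\<close>

definition proj_eq :: "'k :: field vec \<Rightarrow> 'k vec \<Rightarrow> bool" where
  "proj_eq p q \<longleftrightarrow> (\<exists>c. c \<noteq> 0 \<and> q = c \<cdot>\<^sub>v p)"

definition param :: "'k :: field poly poly vec \<Rightarrow> 'k \<Rightarrow> 'k \<Rightarrow> 'k vec" where
  "param g a b = map_vec (\<lambda>f. eval2 f a b) g"

text \<open>All vectors representing a point of the image of \<open>\<Psi>\<close>, i.e. the punctured affine cone over it.\<close>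

definition curve :: "'k :: field poly poly vec \<Rightarrow> 'k vec set" where
  "curve g = {p. \<exists>a b. (a, b) \<noteq> (0, 0) \<and> proj_eq (param g a b) p}"

text \<open>Polynomials in the variables \<open>T\<^sub>0, T\<^sub>1, \<dots>\<close>; a monomial maps each index to its exponent.\<close>

type_synonym 'k mpol = "(nat \<Rightarrow>\<^sub>0 nat) \<Rightarrow>\<^sub>0 'k"

definition form_in :: "nat \<Rightarrow> nat \<Rightarrow> 'k :: zero mpol \<Rightarrow> bool" where
  "form_in n e F \<longleftrightarrow> (\<forall>m \<in> Poly_Mapping.keys F.
     Poly_Mapping.keys m \<subseteq> {..<n} \<and> (\<Sum>i\<in>Poly_Mapping.keys m. Poly_Mapping.lookup m i) = e)"

definition eval_form :: "'k :: field mpol \<Rightarrow> 'k vec \<Rightarrow> 'k" where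
  "eval_form F p = (\<Sum>m\<in>Poly_Mapping.keys F.
     Poly_Mapping.lookup F m * (\<Prod>i\<in>Poly_Mapping.keys m. (p $ i) ^ Poly_Mapping.lookup m i))"

text \<open>\<open>\<O>\<close> of \<open>\<P>\<^sup>n\<^sup>-\<^sup>1\<close> at \<open>p\<close>, with \<open>n = dim_vec p\<close>, as a subring of the field \<open>k(T\<^sub>0, T\<^sub>1, \<dots>)\<close>.\<close>

definition proj_local_ring :: "'k :: field vec \<Rightarrow> 'k mpol fract ring" where
  "proj_local_ring p = ring_of_type_algebra\<lparr>carrier :=
     {Fract F G | F G e. form_in (dim_vec p) e F \<and> form_in (dim_vec p) e G \<and> eval_form G p \<noteq> 0}\<rparr>"

definition curve_ideal_at :: "'k :: field poly poly vec \<Rightarrow> 'k vec \<Rightarrow> 'k mpol fract set" where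
  "curve_ideal_at g p =
     {Fract F G | F G e. form_in (dim_vec p) e F \<and> form_in (dim_vec p) e G \<and> eval_form G p \<noteq> 0 \<and>
        (\<forall>q \<in> curve g. eval_form F q = 0)}"

definition curve_local_ring :: "'k :: field poly poly vec \<Rightarrow> 'k vec \<Rightarrow> 'k mpol fract set ring" where
  "curve_local_ring g p = proj_local_ring p Quot curve_ideal_at g p"

definition singular_points :: "'k :: field poly poly vec \<Rightarrow> 'k vec set" where
  "singular_points g = {p \<in> curve g. \<not> regular_local_ring (curve_local_ring g p)}"

text \<open>\<open>\<Psi>\<close> is birational onto its image \<open>\<C>\<close>: there is a rational map \<open>\<Theta> = [F : G]\<close> from \<open>\<C>\<close> to \<open>\<P>\<^sup>1\<close> such that
  \<open>\<Theta> \<circ> \<Psi>\<close> and \<open>\<Psi> \<circ> \<Theta>\<close> are the identity as rational maps. As \<open>\<C>\<close> is irreducible, \<open>F\<close> and \<open>G\<close> define a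
  rational map as soon as they do not both vanish identically on \<open>\<C>\<close>.\<close>

definition birational_onto_image :: "'k :: field poly poly vec \<Rightarrow> bool" where
  "birational_onto_image g \<longleftrightarrow> (\<exists>e F G.
     form_in (dim_vec g) e F \<and> form_in (dim_vec g) e G \<and>
     (\<exists>p \<in> curve g. (eval_form F p, eval_form G p) \<noteq> (0, 0)) \<and>
     (\<forall>a b. (a, b) \<noteq> (0, 0) \<longrightarrow>
        (let p = param g a b in (eval_form F p, eval_form G p) \<noteq> (0, 0) \<longrightarrow>
           (\<exists>c. c \<noteq> 0 \<and> eval_form F p = c * a \<and> eval_form G p = c * b))) \<and>
     (\<forall>p \<in> curve g. (eval_form F p, eval_form G p) \<noteq> (0, 0) \<longrightarrow>
        proj_eq p (param g (eval_form F p) (eval_form G p))))"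

text \<open>\<open>gcd I\<^sub>1(p\<phi>) = \<Prod>\<^sub>u\<^sub><\<^sub>s \<ell>\<^sub>u ^ e\<^sub>u\<close> with pairwise non-associated linear forms and positive exponents.\<close>

definition gcd_factorization ::
  "'k :: field poly poly mat \<Rightarrow> 'k vec \<Rightarrow> nat \<Rightarrow> (nat \<Rightarrow> 'k poly poly) \<Rightarrow> (nat \<Rightarrow> nat) \<Rightarrow> bool" where
  "gcd_factorization \<phi> p s l e \<longleftrightarrow>
     (\<forall>u<s. linear_form (l u) \<and> e u > 0) \<and>
     (\<forall>u<s. \<forall>v<s. u \<noteq> v \<longrightarrow> \<not> associates (l u) (l v)) \<and>
     is_gcd (minors_ideal 1 (row_times p \<phi>)) (\<Prod>u<s. l u ^ e u)"

end

theory Submission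
  imports Defs "HOL-Computational_Algebra.Formal_Power_Series"
begin

text \<open>Let \<open>p\<close> be a point of the curve. The points \<open>q\<^sub>1, \<dots>, q\<^sub>s\<close> of the projective line above \<open>p\<close> are the branches of the curve at
  \<open>p\<close>, and the ramification order \<open>e\<^sub>u\<close> of \<open>q\<^sub>u\<close> is the least order at \<open>q\<^sub>u\<close> of the pullbacks
  \<open>\<delta>\<^sub>j = p\<^sub>i g\<^sub>j - p\<^sub>j g\<^sub>i\<close> of the linear forms through \<open>p\<close>, where \<open>p\<^sub>i \<noteq> 0\<close>. Everything in the theorem is expressed by these
  numbers, and the products of linear forms are compared order by order at each point of the projective line.

  The multiplicity is the sum of the \<open>e\<^sub>u\<close> and the number of branches is \<open>s\<close> (\<open>local_invariants\<close>). Expansion at the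
  \<open>q\<^sub>u\<close> maps the local ring of the curve into \<open>s\<close> copies of \<open>k[[t]]\<close>. Since the parametrisation is birational, there is
  a conductor (\<open>conductor\<close>, \<open>local_conductor\<close>): all functions that vanish to a high order \<open>N\<close> at every \<open>q\<^sub>u\<close> come from the local
  ring. So the powers of the maximal ideal agree up to a bounded error with the ideals of functions of order at
  least \<open>t e\<^sub>u\<close> at \<open>q\<^sub>u\<close> for all \<open>u\<close>. The length of the quotient by the latter is counted through leading coefficients and
  is \<open>t \<Sum> e\<^sub>u\<close> up to a bounded error, which gives the multiplicity (\<open>samuel_multiplicity_eq\<close>). The completion embeds into the
  product of the \<open>k[[t]]\<close>, and the kernels of the \<open>s\<close> projections are its minimal primes (\<open>branch_number_eq\<close>).
  If the local ring is regular, all orders along a branch are multiples of \<open>e\<^sub>u\<close>, while all large orders occur, so \<open>e\<^sub>u = 1\<close>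
  (\<open>regular_imp_unramified\<close>).

  The greatest common divisor of the entries of \<open>p\<phi>\<close> is \<open>\<Prod> \<ell>\<^sub>u ^ e\<^sub>u\<close>, where the linear form \<open>\<ell>\<^sub>u\<close> vanishes at \<open>q\<^sub>u\<close>. The columns
  of \<open>\<phi>\<close> generate the syzygies of \<open>g\<close>, and among these are the Koszul syzygies, whose products with \<open>p\<close> are the \<open>\<delta>\<^sub>j\<close>;
  conversely the entries of \<open>p\<phi>\<close> are locally in the ideal of the \<open>\<delta>\<^sub>j\<close> since the \<open>g\<^sub>i\<close> have no common zero
  (\<open>hilbert_burch_gcd_iff\<close>, \<open>fibre_product_is_gcd\<close>).

  By Euler's formula the minors of the Jacobian matrix are, locally at \<open>q\<^sub>u\<close>, the Wronskians of the \<open>g\<^sub>j\<close>, up to non-zero constants. The \<open>g\<^sub>j\<close> are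
  proportional to the constants \<open>p\<^sub>j\<close> up to terms of order \<open>e\<^sub>u\<close>, so the least order of a Wronskian is \<open>e\<^sub>u - 1\<close> in
  characteristic zero (\<open>wronskian_order\<close>, \<open>jminor_order\<close>). At points above regular points of the curve this order is zero. Hence the greatest
  common divisor of the minors is the product of the \<open>\<ell>\<^sub>u ^ (e\<^sub>u - 1)\<close> over the singular points, and its degree is the sum of the
  \<open>\<Sum> e\<^sub>u - s = m - s\<close>.\<close>

unbundle no fps_syntax

section \<open>Orders of power series\<close>

lemma fps_X_power_dvd_iff: "fps_X ^ n dvd f \<longleftrightarrow> (\<forall>i<n. fps_nth f i = 0)"
  for f :: "'a :: comm_ring_1 fps"
proof
  assume "fps_X ^ n dvd f"
  then obtain h where "f = fps_X ^ n * h" by (elim dvdE)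
  then show "\<forall>i<n. fps_nth f i = 0" by (simp add: fps_X_power_mult_nth)
next
  assume *: "\<forall>i<n. fps_nth f i = 0"
  have "f = fps_X ^ n * Abs_fps (\<lambda>i. fps_nth f (i + n))"
    by (rule fps_ext) (use * in \<open>auto simp: fps_X_power_mult_nth\<close>)
  then show "fps_X ^ n dvd f" by (rule dvdI)
qed

text \<open>Unlike \<open>subdegree\<close>, this determines the order also for the zero series, which has none.\<close>

definition has_order :: "nat \<Rightarrow> 'a :: comm_ring_1 fps \<Rightarrow> bool" where
  "has_order n f \<longleftrightarrow> fps_X ^ n dvd f \<and> fps_nth f n \<noteq> 0"

lemma fps_X_power_dvd_Suc_iff:
  "fps_X ^ Suc n dvd f \<longleftrightarrow> fps_X ^ n dvd f \<and> fps_nth f n = 0"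
  for f :: "'a :: comm_ring_1 fps"
  unfolding fps_X_power_dvd_iff by (auto simp: less_Suc_eq)

lemma has_order_imp_nonzero: "has_order n f \<Longrightarrow> f \<noteq> 0"
  by (auto simp: has_order_def)

lemma has_order_subdegree: "f \<noteq> 0 \<Longrightarrow> has_order (subdegree f) f"
  by (auto simp: has_order_def fps_X_power_dvd_iff)

lemma has_order_unique: "has_order n f \<Longrightarrow> has_order m f \<Longrightarrow> n = m"
  by (auto simp: has_order_def fps_X_power_dvd_iff) (metis linorder_neqE_nat)

lemma has_order_mult: "has_order n f \<Longrightarrow> has_order m h \<Longrightarrow> has_order (n + m) (f * h)"
  for f h :: "'a :: idom fps"
proof -
  assume f: "has_order n f" and h: "has_order m h"
  then obtain f' h' where "f = fps_X ^ n * f'" "h = fps_X ^ m * h'"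
    unfolding has_order_def by (meson dvdE)
  with f h have "f * h = fps_X ^ (n + m) * (f' * h')" "fps_nth f' 0 \<noteq> 0" "fps_nth h' 0 \<noteq> 0"
    by (simp_all add: power_add has_order_def fps_X_power_mult_nth mult.assoc mult.left_commute)
  then show ?thesis by (simp add: has_order_def fps_X_power_mult_nth)
qed

lemma has_order_power: "has_order n f \<Longrightarrow> has_order (k * n) (f ^ k)"
  for f :: "'a :: idom fps"
proof (induction k)
  case 0
  then show ?case by (simp add: has_order_def)
next
  case (Suc k)
  then show ?case using has_order_mult[of n f "k * n" "f ^ k"] by simp
qed

lemma has_order_0_iff: "has_order 0 f \<longleftrightarrow> fps_nth f 0 \<noteq> 0"
  by (simp add: has_order_def)

lemma has_order_factor:
  assumes "has_order n (f :: 'a :: field fps)"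
  obtains h where "f = fps_X ^ n * h" "is_unit h"
proof -
  obtain h where h: "f = fps_X ^ n * h" using assms by (auto simp: has_order_def)
  with assms have "fps_nth h 0 \<noteq> 0" by (simp add: has_order_def fps_X_power_mult_nth)
  then show thesis using h that by (simp add: fps_is_unit_iff)
qed

lemma has_order_dvd_iff: "has_order n f \<Longrightarrow> f dvd h \<longleftrightarrow> fps_X ^ n dvd h"
  for f h :: "'a :: field fps"
  by (erule has_order_factor) (simp add: mult_unit_dvd_iff)

lemma has_order_dvd: "has_order n f \<Longrightarrow> f dvd h \<Longrightarrow> has_order m h \<Longrightarrow> n \<le> m"
  for f h :: "'a :: field fps"
  by (simp add: has_order_dvd_iff fps_X_power_dvd_iff) (metis has_order_def not_le)

lemma fps_X_power_dvd_le: "fps_X ^ n dvd f \<Longrightarrow> m \<le> n \<Longrightarrow> fps_X ^ m dvd f"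
  for f :: "'a :: comm_ring_1 fps"
  by (simp add: fps_X_power_dvd_iff)

section \<open>One-dimensional local rings with smooth branches\<close>

text \<open>An axiomatic form of the local ring of an integral curve whose normalisation is smooth with \<open>s\<close> points above
  the given one. The homomorphisms \<open>eps u\<close> expand an element along the \<open>u\<close>-th branch; \<open>e u\<close> is the least order
  along that branch of an element of the maximal ideal, and \<open>f0\<close> is a generic element, which attains all these
  orders at once. The number \<open>N\<close> measures a conductor: whatever vanishes to order \<open>N\<close> on every branch of the
  normalisation comes from the ring, so that all tuples of orders from \<open>N\<close> on occur (\<open>attain\<close>) and divisibility
  on the branches with a margin of \<open>N\<close> implies divisibility in the ring (\<open>divide\<close>). Dimension, multiplicity and
  the number of branches can be computed from these axioms alone, without any finiteness theorem.\<close>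

locale curve_germ = cring R for R :: "('a, 'b) ring_scheme" (structure) +
  fixes eps :: "nat \<Rightarrow> 'a \<Rightarrow> 'k :: field fps"
    and s :: nat and e :: "nat \<Rightarrow> nat" and N :: nat and f0 :: 'a and const :: "'k \<Rightarrow> 'a"
  assumes s_pos: "0 < s"
    and eps_one: "u < s \<Longrightarrow> eps u \<one> = 1"
    and eps_add: "u < s \<Longrightarrow> a \<in> carrier R \<Longrightarrow> b \<in> carrier R \<Longrightarrow> eps u (a \<oplus> b) = eps u a + eps u b"
    and eps_mult: "u < s \<Longrightarrow> a \<in> carrier R \<Longrightarrow> b \<in> carrier R \<Longrightarrow> eps u (a \<otimes> b) = eps u a * eps u b"
    and eps_inj: "u < s \<Longrightarrow> a \<in> carrier R \<Longrightarrow> eps u a = 0 \<Longrightarrow> a = \<zero>"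
    and const_closed: "const c \<in> carrier R"
    and eps_const: "u < s \<Longrightarrow> eps u (const c) = fps_const c"
    and unit: "a \<in> carrier R \<Longrightarrow> u < s \<Longrightarrow> fps_nth (eps u a) 0 \<noteq> 0 \<Longrightarrow> a \<in> Units R"
    and e_pos: "u < s \<Longrightarrow> 0 < e u"
    and vanish: "a \<in> carrier R \<Longrightarrow> u < s \<Longrightarrow> v < s \<Longrightarrow> fps_nth (eps u a) 0 = 0 \<Longrightarrow>
      fps_X ^ e v dvd eps v a"
    and f0_closed: "f0 \<in> carrier R"
    and f0_order: "u < s \<Longrightarrow> has_order (e u) (eps u f0)"
    and attain: "(\<And>u. u < s \<Longrightarrow> N \<le> w u) \<Longrightarrow> \<exists>a\<in>carrier R. \<forall>u<s. has_order (w u) (eps u a)"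
    and divide: "a \<in> carrier R \<Longrightarrow> b \<in> carrier R \<Longrightarrow> a \<noteq> \<zero> \<Longrightarrow>
      (\<And>u. u < s \<Longrightarrow> fps_X ^ N * eps u a dvd eps u b) \<Longrightarrow> \<exists>c\<in>carrier R. b = a \<otimes> c"
begin

lemma eps_zero: "u < s \<Longrightarrow> eps u \<zero> = 0"
  using eps_add[of u \<zero> \<zero>] by (simp only: zero_closed l_zero) (metis add_cancel_right_right)

lemma eps_a_inv: "u < s \<Longrightarrow> a \<in> carrier R \<Longrightarrow> eps u (\<ominus> a) = - eps u a"
  using eps_add[of u a "\<ominus> a"] eps_zero[of u] by (simp add: r_neg eq_neg_iff_add_eq_0 add.commute)

lemma eps_minus: "u < s \<Longrightarrow> a \<in> carrier R \<Longrightarrow> b \<in> carrier R \<Longrightarrow> eps u (a \<ominus> b) = eps u a - eps u b"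
  by (simp add: a_minus_def eps_add eps_a_inv)

lemma eps_pow: "u < s \<Longrightarrow> a \<in> carrier R \<Longrightarrow> eps u (a [^] (n :: nat)) = eps u a ^ n"
  by (induction n) (simp_all add: eps_one eps_mult mult.commute)

lemma eps_nonzero: "u < s \<Longrightarrow> a \<in> carrier R \<Longrightarrow> a \<noteq> \<zero> \<Longrightarrow> eps u a \<noteq> 0"
  using eps_inj by blast

lemma one_not_zero: "\<one> \<noteq> \<zero>"
  using eps_one[OF s_pos] eps_zero[OF s_pos] by auto

lemma domain_R: "domain R"
proof (intro domain.intro domain_axioms.intro is_cring)
  show "\<one> \<noteq> \<zero>" by (rule one_not_zero)
  fix a b assume "a \<otimes> b = \<zero>" "a \<in> carrier R" "b \<in> carrier R"
  then show "a = \<zero> \<or> b = \<zero>"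
    using eps_mult[OF s_pos, of a b] eps_zero[OF s_pos] eps_inj[OF s_pos] by auto
qed

text \<open>The valuation ideals are squeezed between the powers of the maximal ideal, and unlike these they are given
  by explicit conditions.\<close>

definition filt :: "(nat \<Rightarrow> nat) \<Rightarrow> 'a set" where
  "filt w = {a \<in> carrier R. \<forall>u<s. fps_X ^ w u dvd eps u a}"

lemma filt_ideal: "ideal (filt w) R"
proof (rule idealI[OF ring_axioms])
  show "subgroup (filt w) (add_monoid R)"
  proof (rule group.subgroupI[OF a_group])
    show "filt w \<subseteq> carrier (add_monoid R)" by (auto simp: filt_def)
    have "\<zero> \<in> filt w" by (simp add: filt_def eps_zero)
    then show "filt w \<noteq> {}" by blast
    show "inv\<^bsub>add_monoid R\<^esub> a \<in> filt w" if "a \<in> filt w" for a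
      unfolding a_inv_def[symmetric] using that by (simp add: filt_def eps_a_inv)
    show "a \<otimes>\<^bsub>add_monoid R\<^esub> b \<in> filt w" if "a \<in> filt w" "b \<in> filt w" for a b
      using that by (simp add: filt_def eps_add)
  qed
qed (auto simp: filt_def eps_mult)

lemma filt_antimono: "(\<And>u. u < s \<Longrightarrow> w u \<le> w' u) \<Longrightarrow> filt w' \<subseteq> filt w"
  by (auto simp: filt_def intro: fps_X_power_dvd_le)

lemma not_unit_iff: "a \<in> carrier R \<Longrightarrow> a \<notin> Units R \<longleftrightarrow> a \<in> filt e"
proof -
  assume a: "a \<in> carrier R"
  show ?thesis
  proof
    assume "a \<notin> Units R"
    then show "a \<in> filt e" using a unit[OF a s_pos] vanish[OF a s_pos] by (auto simp: filt_def)
  next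
    assume *: "a \<in> filt e"
    show "a \<notin> Units R"
    proof
      assume "a \<in> Units R"
      then obtain b where b: "b \<in> carrier R" "a \<otimes> b = \<one>" using a by (auto simp: Units_def)
      then have "eps 0 a * eps 0 b = 1" using eps_mult[OF s_pos a b(1)] eps_one[OF s_pos] by simp
      then have "fps_nth (eps 0 a * eps 0 b) 0 = 1" by simp
      moreover have "fps_nth (eps 0 a) 0 = 0"
        using * s_pos e_pos[OF s_pos] by (simp add: filt_def fps_X_power_dvd_iff)
      ultimately show False by simp
    qed
  qed
qed

lemma one_not_in_filt_e: "\<one> \<notin> filt e"
  using not_unit_iff[of \<one>] by simp

lemma ideal_with_unit: "ideal I R \<Longrightarrow> a \<in> I \<Longrightarrow> a \<in> Units R \<Longrightarrow> I = carrier R"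
proof -
  assume I: "ideal I R" "a \<in> I" "a \<in> Units R"
  then have "a \<otimes> inv a \<in> I" by (intro ideal.I_r_closed) auto
  then show ?thesis using I ideal.one_imp_carrier by (metis Units_r_inv)
qed

lemma proper_ideal_subset: "ideal I R \<Longrightarrow> I \<noteq> carrier R \<Longrightarrow> I \<subseteq> filt e"
proof
  fix a assume I: "ideal I R" "I \<noteq> carrier R" and a: "a \<in> I"
  have "a \<in> carrier R" by (rule ideal.Icarr[OF I(1) a])
  then show "a \<in> filt e" using ideal_with_unit[OF I(1) a] I(2) not_unit_iff by auto
qed

lemma filt_e_neq_carrier: "filt e \<noteq> carrier R"
  using one_not_in_filt_e one_closed by blast

lemma filt_e_maximal: "maximalideal (filt e) R"
proof (rule maximalidealI[OF filt_ideal])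
  show "carrier R \<noteq> filt e" using filt_e_neq_carrier by simp
  show "J = filt e \<or> J = carrier R" if "ideal J R" "filt e \<subseteq> J" "J \<subseteq> carrier R" for J
  proof (cases "J = carrier R")
    case False
    with that show ?thesis using proper_ideal_subset[OF that(1)] by (simp add: subset_antisym)
  qed simp
qed

lemma max_ideal_eq: "max_ideal R = filt e"
  unfolding max_ideal_def
proof (rule the_equality)
  show "maximalideal (filt e) R" by (rule filt_e_maximal)
  fix m assume m: "maximalideal m R"
  have "m \<subseteq> filt e"
    by (rule proper_ideal_subset[OF maximalideal.axioms(1)[OF m] maximalideal.I_notcarr[OF m, symmetric]])
  moreover have "filt e \<subseteq> carrier R" by (simp add: filt_def Collect_restrict)
  ultimately have "filt e = m \<or> filt e = carrier R"
    by (rule maximalideal.I_maximal[OF m filt_ideal])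
  then show "m = filt e" using filt_e_neq_carrier by simp
qed

lemma f0_in: "f0 \<in> filt e"
  using f0_closed f0_order by (auto simp: filt_def has_order_def)

lemma f0_nonzero: "f0 \<noteq> \<zero>"
  using f0_order[OF s_pos] eps_zero[OF s_pos] by (auto simp: has_order_def)

subsection \<open>Dimension\<close>

lemma prime_pow_mem: "primeideal Q R \<Longrightarrow> a \<in> carrier R \<Longrightarrow> a [^] (n :: nat) \<in> Q \<Longrightarrow> a \<in> Q"
proof (induction n)
  case 0
  then have "Q = carrier R" using ideal.one_imp_carrier[of Q R] primeideal.axioms(1)[of Q R] by simp
  then show ?case using 0 by simp
next
  case (Suc n)
  then show ?case using primeideal.I_prime[of Q R "a [^] n" a] by auto
qed

text \<open>A high power of any non-unit is divisible by a given non-zero element \<open>a\<close>, because its orders on all branches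
  exceed those of \<open>a\<close> by \<open>N\<close>. So a prime that contains \<open>a\<close> contains every non-unit.\<close>

lemma nonzero_prime_eq:
  assumes Q: "primeideal Q R" and "a \<in> Q" "a \<noteq> \<zero>"
  shows "Q = filt e"
proof -
  interpret Q: primeideal Q R by (rule Q)
  have a: "a \<in> carrier R" using assms Q.Icarr by blast
  define K where "K = N + (\<Sum>u<s. subdegree (eps u a))"
  have "filt e \<subseteq> Q"
  proof
    fix f assume f: "f \<in> filt e"
    then have fc: "f \<in> carrier R" by (simp add: filt_def)
    have "\<exists>c\<in>carrier R. f [^] K = a \<otimes> c"
    proof (rule divide)
      fix u assume u: "u < s"
      have "has_order (subdegree (eps u a)) (eps u a)"
        using has_order_subdegree eps_nonzero[OF u a] assms(3) by blast
      moreover have "has_order N (fps_X ^ N :: 'k fps)" by (simp add: has_order_def)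
      ultimately have o: "has_order (N + subdegree (eps u a)) (fps_X ^ N * eps u a)"
        by (rule has_order_mult[rotated])
      have "fps_X ^ 1 dvd eps u f"
        using f u e_pos[OF u] fps_X_power_dvd_le[of "e u" "eps u f" 1] by (auto simp: filt_def)
      then have "fps_X ^ K dvd eps u (f [^] K)"
        using dvd_power_same[of fps_X "eps u f" K] fc u by (simp add: eps_pow)
      moreover have "subdegree (eps u a) \<le> (\<Sum>u<s. subdegree (eps u a))"
        using u by (intro member_le_sum) auto
      ultimately show "fps_X ^ N * eps u a dvd eps u (f [^] K)"
        unfolding has_order_dvd_iff[OF o] K_def by (elim fps_X_power_dvd_le) simp
    qed (use a fc assms in auto)
    then have "f [^] K \<in> Q" using assms(2) Q.I_r_closed by auto
    then show "f \<in> Q" using prime_pow_mem[OF Q fc] by blast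
  qed
  moreover have "Q \<subseteq> filt e"
    by (rule proper_ideal_subset[OF Q.is_ideal Q.I_notcarr[symmetric]])
  ultimately show ?thesis by (rule subset_antisym[rotated])
qed

lemma krull_dim_eq_1: "krull_dim R = 1"
proof (rule antisym)
  interpret domain R by (rule domain_R)
  define P where "P = (\<lambda>i :: nat. if i = 0 then {\<zero>} else filt e)"
  have "primeideal {\<zero>} R" by (rule zeroprimeideal)
  moreover have "primeideal (filt e) R" by (rule maximalideal_prime[OF filt_e_maximal])
  moreover have "{\<zero>} \<subset> filt e"
    using f0_in f0_nonzero additive_subgroup.zero_closed[OF ideal.axioms(1)[OF filt_ideal]] by blast
  ultimately have "prime_chain R 1 P" by (simp add: prime_chain_def P_def)
  then have "enat 1 \<le> krull_dim R" unfolding krull_dim_def by (intro SUP_upper) auto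
  then show "1 \<le> krull_dim R" by (simp add: one_enat_def)
  show "krull_dim R \<le> 1"
    unfolding krull_dim_def
  proof (rule SUP_least)
    fix l assume "l \<in> {l. \<exists>P. prime_chain R l P}"
    then obtain P where P: "prime_chain R l P" by blast
    have "\<not> 2 \<le> l"
    proof
      assume l: "2 \<le> l"
      have chain: "P 0 \<subset> P 1" "P 1 \<subset> P 2" "primeideal (P 0) R" "primeideal (P 1) R" "primeideal (P 2) R"
        using P l by (auto simp: prime_chain_def numeral_2_eq_2)
      have "\<zero> \<in> P 0"
        by (rule additive_subgroup.zero_closed[OF ideal.axioms(1)[OF primeideal.axioms(1)[OF chain(3)]]])
      then obtain a where "a \<in> P 1" "a \<noteq> \<zero>" using chain by blast
      then have "P 1 = filt e" "P 2 = filt e" using chain nonzero_prime_eq by blast+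
      then show False using chain by blast
    qed
    then show "enat l \<le> 1" by (simp add: one_enat_def)
  qed
qed

subsection \<open>Powers of the maximal ideal\<close>

lemma max_ideal_pow_0: "max_ideal_pow R 0 = carrier R"
  by (simp add: max_ideal_pow_def nat_pow_def ideals_set_def)

lemma max_ideal_pow_Suc: "max_ideal_pow R (Suc t) = max_ideal_pow R t \<cdot> filt e"
  by (simp add: max_ideal_pow_def nat_pow_def ideals_set_def max_ideal_eq)

lemma max_ideal_pow_ideal: "ideal (max_ideal_pow R t) R"
  by (induction t) (simp_all add: max_ideal_pow_0 max_ideal_pow_Suc oneideal ideal_prod_is_ideal filt_ideal)

lemma max_ideal_pow_antimono: "t \<le> t' \<Longrightarrow> max_ideal_pow R t' \<subseteq> max_ideal_pow R t"
  by (rule lift_Suc_antimono_le)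
    (use ideal_prod_inter[OF max_ideal_pow_ideal filt_ideal] in \<open>auto simp: max_ideal_pow_Suc\<close>)

lemma max_ideal_pow_subset: "max_ideal_pow R t \<subseteq> filt (\<lambda>u. t * e u)"
proof (induction t)
  case 0
  then show ?case by (auto simp: max_ideal_pow_0 filt_def)
next
  case (Suc t)
  show ?case
  proof
    fix x assume "x \<in> max_ideal_pow R (Suc t)"
    then have "x \<in> max_ideal_pow R t \<cdot> filt e" by (simp add: max_ideal_pow_Suc)
    then show "x \<in> filt (\<lambda>u. Suc t * e u)"
    proof (induction rule: ideal_prod.induct)
      case (prod i j)
      have i: "i \<in> carrier R" "\<forall>u<s. fps_X ^ (t * e u) dvd eps u i"
        using subsetD[OF Suc prod(1)] by (simp_all add: filt_def)
      have j: "j \<in> carrier R" "\<forall>u<s. fps_X ^ e u dvd eps u j"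
        using prod(2) by (simp_all add: filt_def)
      have "fps_X ^ (Suc t * e u) dvd eps u (i \<otimes> j)" if "u < s" for u
      proof -
        have "fps_X ^ (t * e u) * fps_X ^ e u dvd eps u i * eps u j"
          using i j that by (intro mult_dvd_mono) simp_all
        moreover have "eps u (i \<otimes> j) = eps u i * eps u j" using i j that by (simp add: eps_mult)
        ultimately show ?thesis by (simp only: mult_Suc add.commute[of "e u"] power_add)
      qed
      then show ?case using i j by (simp add: filt_def)
    next
      case (sum s1 s2)
      then show ?case
        by (intro additive_subgroup.a_closed[OF ideal.axioms(1)[OF filt_ideal]])
    qed
  qed
qed

text \<open>Such an element is divisible by \<open>f0 [^] t\<close>. Together with \<open>max_ideal_pow_subset\<close> this pins down the powers
  of the maximal ideal up to an error that does not grow with \<open>t\<close>.\<close>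

lemma filt_subset_max_ideal_pow: "filt (\<lambda>u. t * e u + N) \<subseteq> max_ideal_pow R t"
proof
  fix f assume f: "f \<in> filt (\<lambda>u. t * e u + N)"
  have pow: "f0 [^] t \<in> max_ideal_pow R t"
  proof (induction t)
    case (Suc t)
    then show ?case using ideal_prod.prod[OF _ f0_in] by (simp add: max_ideal_pow_Suc)
  qed (simp add: max_ideal_pow_0)
  interpret domain R by (rule domain_R)
  have "\<exists>c\<in>carrier R. f = f0 [^] t \<otimes> c"
  proof (rule divide)
    fix u assume u: "u < s"
    have "has_order (N + t * e u) (fps_X ^ N * eps u (f0 [^] t))"
      using u f0_closed has_order_power[OF f0_order[OF u], of t]
      by (intro has_order_mult) (simp_all add: eps_pow has_order_def)
    then show "fps_X ^ N * eps u (f0 [^] t) dvd eps u f"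
      using f u by (simp add: has_order_dvd_iff filt_def add.commute)
  next
    show "f0 [^] t \<noteq> \<zero>"
      using f0_nonzero f0_closed by (induction t) (auto simp: integral_iff one_not_zero)
  qed (use f f0_closed in \<open>auto simp: filt_def\<close>)
  then show "f \<in> max_ideal_pow R t"
    using pow ideal.I_r_closed[OF max_ideal_pow_ideal] by auto
qed

text \<open>If the maximal ideal is principal, with generator \<open>a\<close>, then every non-zero element is a unit times a power of
  \<open>a\<close>, so all orders on the branch \<open>u\<close> are multiples of \<open>e u\<close>. But the consecutive orders \<open>N\<close> and \<open>N + 1\<close> both occur.\<close>

lemma regular_imp_unramified:
  assumes "regular_local_ring R" "u < s"
  shows "e u = 1"
proof -
  from assms(1) obtain S where S: "S \<subseteq> carrier R" "finite S" "enat (card S) = krull_dim R"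
    "Idl S = filt e"
    unfolding regular_local_ring_def max_ideal_eq by blast
  then have "card S = 1" by (simp add: krull_dim_eq_1 one_enat_def)
  then obtain a where "S = {a}" by (auto simp: card_1_singleton_iff)
  then have a: "a \<in> carrier R" "filt e = PIdl a"
    using S cgenideal_eq_genideal[of a] by auto
  have ae: "a \<in> filt e" using a cgenideal_self by simp
  have eps_a: "has_order (e u) (eps u a)"
  proof -
    obtain c where c: "c \<in> carrier R" "f0 = c \<otimes> a" using f0_in a by (auto simp: cgenideal_def)
    then have "eps u a dvd eps u f0" using assms a by (simp add: eps_mult)
    then obtain h where h: "eps u f0 = eps u a * h" by (elim dvdE)
    have X: "fps_X ^ e u dvd eps u a" using ae assms by (simp add: filt_def)
    have "fps_nth (eps u a) (e u) \<noteq> 0"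
    proof
      assume "fps_nth (eps u a) (e u) = 0"
      with X have "fps_X ^ Suc (e u) dvd eps u a" by (simp add: fps_X_power_dvd_Suc_iff del: power_Suc)
      then have "fps_X ^ Suc (e u) dvd eps u f0" using h by (metis dvd_mult2)
      then show False using f0_order[OF assms(2)] by (auto simp: has_order_def fps_X_power_dvd_Suc_iff simp del: power_Suc)
    qed
    then show ?thesis using X by (simp add: has_order_def)
  qed
  have div: "e u dvd k" if "f \<in> carrier R" "has_order k (eps u f)" for f k
    using that
  proof (induction k arbitrary: f rule: less_induct)
    case (less k)
    show ?case
    proof (cases "f \<in> filt e")
      case True
      then obtain c where c: "c \<in> carrier R" "f = c \<otimes> a" using a by (auto simp: cgenideal_def)
      have ef: "eps u f = eps u c * eps u a" using c a assms by (simp add: eps_mult)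
      then have nz: "eps u c \<noteq> 0" using has_order_imp_nonzero[OF less.prems(2)] by auto
      define j where "j = subdegree (eps u c)"
      have j: "has_order j (eps u c)" unfolding j_def using nz by (rule has_order_subdegree)
      have "k = j + e u"
        using has_order_mult[OF j eps_a] less.prems(2) ef has_order_unique by metis
      moreover have "e u dvd j"
        using less.IH[OF _ c(1) j] calculation e_pos[OF assms(2)] by simp
      ultimately show ?thesis by simp
    next
      case False
      then have "f \<in> Units R" using not_unit_iff less.prems by blast
      then have "fps_nth (eps u f) 0 \<noteq> 0"
        using not_unit_iff[OF less.prems(1)] vanish[OF less.prems(1) assms(2)] less.prems(1)
        by (auto simp: filt_def)
      then have "k = 0" using less.prems(2) has_order_0_iff has_order_unique by blast
      then show ?thesis by simp
    qed
  qed
  have "\<exists>a\<in>carrier R. \<forall>u<s. has_order N (eps u a)"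
    "\<exists>a\<in>carrier R. \<forall>u<s. has_order (Suc N) (eps u a)"
    by (rule attain, simp)+
  then have "e u dvd N" "e u dvd Suc N" using div assms by blast+
  then have "e u dvd Suc N - N" using dvd_diff_nat by blast
  then show ?thesis by simp
qed

end

context curve_germ
begin

subsection \<open>Multiplicity\<close>

definition ideal_chain :: "nat \<Rightarrow> (nat \<Rightarrow> 'a set) \<Rightarrow> bool" where
  "ideal_chain l J \<longleftrightarrow> (\<forall>i\<le>l. ideal (J i) R) \<and> (\<forall>i<l. J i \<subset> J (Suc i))"

lemma ideal_chain_bottom: "ideal_chain l J \<Longrightarrow> i \<le> l \<Longrightarrow> J 0 \<subseteq> J i"
proof (induction i)
  case (Suc i)
  then show ?case unfolding ideal_chain_def by (meson Suc_leD Suc_le_lessD order_trans psubset_imp_subset)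
qed simp

text \<open>A position \<open>(u, i)\<close> stands for the coefficient of degree \<open>i\<close> on the branch \<open>u\<close>; positions are ordered by branch
  first. Modulo \<open>filt w\<close> only finitely many of them are left, and an ideal is recorded by the positions that
  occur as first non-zero coefficients of its elements, as in Gaussian elimination.\<close>

definition leading_positions :: "(nat \<Rightarrow> nat) \<Rightarrow> 'a set \<Rightarrow> (nat \<times> nat) set" where
  "leading_positions w J = {(u, i). u < s \<and> i < w u \<and>
     (\<exists>f\<in>J. (\<forall>v<u. fps_X ^ w v dvd eps v f) \<and> has_order i (eps u f))}"

lemma leading_positions_subset: "leading_positions w J \<subseteq> (SIGMA u:{..<s}. {..<w u})"
  by (auto simp: leading_positions_def)

text \<open>An element of the larger ideal can be reduced by elements of the smaller one, killing one coefficient after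
  the other, until it lies in \<open>filt w\<close>. The two inductions run downwards through the positions.\<close>

lemma leading_positions_eq_imp_subset:
  assumes J: "ideal J R" and J': "ideal J' R" and "J \<subseteq> J'" and filt: "filt w \<subseteq> J"
    and eq: "leading_positions w J' \<subseteq> leading_positions w J"
  shows "J' \<subseteq> J"
proof -
  have "\<forall>f\<in>J'. (\<forall>v<u. fps_X ^ w v dvd eps v f) \<longrightarrow> f \<in> J" if "u \<le> s" for u
    using that
  proof (induction u rule: inc_induct)
    case base
    then show ?case using filt ideal.Icarr[OF J'] by (auto simp: filt_def)
  next
    case (step u)
    have "\<forall>f\<in>J'. (\<forall>v<u. fps_X ^ w v dvd eps v f) \<longrightarrow> fps_X ^ i dvd eps u f \<longrightarrow> f \<in> J"
      if "i \<le> w u" for i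
      using that
    proof (induction i rule: inc_induct)
      case base
      then show ?case using step.IH by (auto simp: less_Suc_eq)
    next
      case (step i)
      show ?case
      proof (intro ballI impI)
        fix f assume f: "f \<in> J'" "\<forall>v<u. fps_X ^ w v dvd eps v f" "fps_X ^ i dvd eps u f"
        have fc: "f \<in> carrier R" using f ideal.Icarr[OF J'] by blast
        show "f \<in> J"
        proof (cases "fps_nth (eps u f) i = 0")
          case True
          then have "fps_X ^ Suc i dvd eps u f" using f(3) unfolding fps_X_power_dvd_Suc_iff by blast
          then show ?thesis using step.IH f by blast
        next
          case False
          then have "(u, i) \<in> leading_positions w J'"
            using f \<open>u < s\<close> \<open>i < w u\<close> by (auto simp: leading_positions_def has_order_def)
          then have "(u, i) \<in> leading_positions w J" by (rule subsetD[OF eq])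
          then obtain h where h: "h \<in> J" "\<forall>v<u. fps_X ^ w v dvd eps v h" "has_order i (eps u h)"
            by (auto simp: leading_positions_def)
          have hc: "h \<in> carrier R" using h ideal.Icarr[OF J] by blast
          define c where "c = const (fps_nth (eps u f) i / fps_nth (eps u h) i)"
          have c: "c \<in> carrier R" by (simp add: c_def const_closed)
          have ch: "c \<otimes> h \<in> J" using J c h(1) by (simp add: ideal.I_l_closed)
          define f' where "f' = f \<ominus> c \<otimes> h"
          have eps_f': "eps v f' = eps v f - eps v c * eps v h" if "v < s" for v
            unfolding f'_def using fc c hc that by (simp add: eps_minus eps_mult)
          have "f' \<in> J'" unfolding f'_def a_minus_def
            using f(1) ch \<open>J \<subseteq> J'\<close> J'
            by (intro additive_subgroup.a_closed[OF ideal.axioms(1)[OF J']]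
                additive_subgroup.a_inv_closed[OF ideal.axioms(1)[OF J']]) auto
          moreover have "\<forall>v<u. fps_X ^ w v dvd eps v f'"
            using f(2) h(2) \<open>u < s\<close> by (auto simp: eps_f')
          moreover have "fps_X ^ Suc i dvd eps u f'"
            using f(3) h(3) \<open>u < s\<close>
            by (auto simp: eps_f' c_def eps_const fps_X_power_dvd_Suc_iff has_order_def simp del: power_Suc)
          ultimately have "f' \<in> J" using step.IH by blast
          moreover have "f = f' \<oplus> c \<otimes> h"
            unfolding f'_def using fc hc c by (simp add: a_minus_def a_assoc l_neg)
          ultimately show ?thesis
            using additive_subgroup.a_closed[OF ideal.axioms(1)[OF J] _ ch] by simp
        qed
      qed
    qed
    from this[of 0] show ?case by auto
  qed
  from this[of 0] show ?thesis by auto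
qed

text \<open>Along a strict chain the set of leading positions grows strictly, and there are only \<open>\<Sum>u<s. w u\<close> positions.\<close>

lemma ideal_chain_length_le:
  assumes chain: "ideal_chain l J" and filt: "filt w \<subseteq> J 0"
  shows "l \<le> (\<Sum>u<s. w u)"
proof -
  have fin: "finite (SIGMA u:{..<s}. {..<w u})" by auto
  have "i \<le> card (leading_positions w (J i))" if "i \<le> l" for i
    using that
  proof (induction i)
    case (Suc i)
    have J: "ideal (J i) R" "ideal (J (Suc i)) R" "J i \<subset> J (Suc i)"
      using chain Suc.prems by (auto simp: ideal_chain_def)
    have "filt w \<subseteq> J i" using filt ideal_chain_bottom[OF chain] Suc.prems by (meson Suc_leD order_trans)
    then have "\<not> leading_positions w (J (Suc i)) \<subseteq> leading_positions w (J i)"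
      using leading_positions_eq_imp_subset[OF J(1,2)] J(3) by blast
    moreover have "leading_positions w (J i) \<subseteq> leading_positions w (J (Suc i))"
      using J(3) by (fastforce simp: leading_positions_def)
    ultimately have "leading_positions w (J i) \<subset> leading_positions w (J (Suc i))" by blast
    then have "card (leading_positions w (J i)) < card (leading_positions w (J (Suc i)))"
      by (intro psubset_card_mono finite_subset[OF leading_positions_subset fin])
    then show ?case using Suc by simp
  qed simp
  from this[of l] have "l \<le> card (leading_positions w (J l))" by simp
  also have "\<dots> \<le> card (SIGMA u:{..<s}. {..<w u})"
    by (intro card_mono fin leading_positions_subset)
  finally show ?thesis by simp
qed

text \<open>As long as all orders stay at least \<open>N\<close>, lowering a single \<open>w u\<close> by one strictly enlarges \<open>filt w\<close>, since
  every tuple of orders from \<open>N\<close> on is attained.\<close>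

lemma filt_chain_exists:
  assumes "\<And>u. u < s \<Longrightarrow> N \<le> w u"
  shows "\<exists>J. ideal_chain (\<Sum>u<s. w u - N) J \<and> J 0 = filt w"
  using assms
proof (induction "\<Sum>u<s. w u - N" arbitrary: w)
  case 0
  then show ?case by (intro exI[of _ "\<lambda>_. filt w"]) (simp add: ideal_chain_def filt_ideal)
next
  case (Suc n)
  then have "(\<Sum>u<s. w u - N) \<noteq> 0" by (metis nat.distinct(1))
  then obtain u0 where u0: "u0 < s" "w u0 - N \<noteq> 0" using sum.neutral[of "{..<s}" "\<lambda>u. w u - N"] by auto
  define w' where "w' = w(u0 := w u0 - 1)"
  have "(\<Sum>u<s. w u - N) = (w u0 - N) + (\<Sum>u\<in>{..<s} - {u0}. w u - N)"
    using u0 by (subst sum.remove[of _ u0]) auto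
  moreover have "(\<Sum>u<s. w' u - N) = (w' u0 - N) + (\<Sum>u\<in>{..<s} - {u0}. w' u - N)"
    using u0 by (subst sum.remove[of _ u0]) auto
  moreover have "(\<Sum>u\<in>{..<s} - {u0}. w' u - N) = (\<Sum>u\<in>{..<s} - {u0}. w u - N)"
    by (rule sum.cong) (auto simp: w'_def)
  ultimately have n: "n = (\<Sum>u<s. w' u - N)" using Suc.hyps(2) u0 by (simp add: w'_def)
  have w': "N \<le> w' u" if "u < s" for u using Suc.prems[OF that] u0 by (auto simp: w'_def)
  obtain J where J: "ideal_chain n J" "J 0 = filt w'" using Suc.hyps(1)[OF n w'] n by auto
  obtain f where f: "f \<in> carrier R" "\<forall>u<s. has_order (w' u) (eps u f)"
    using attain[of w'] w' by blast
  have "f \<in> filt w'" using f by (auto simp: filt_def has_order_def)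
  moreover have "f \<notin> filt w"
  proof
    assume "f \<in> filt w"
    then have "fps_X ^ Suc (w' u0) dvd eps u0 f" using u0 by (auto simp: filt_def w'_def)
    then show False using f u0 by (auto simp: fps_X_power_dvd_Suc_iff has_order_def simp del: power_Suc)
  qed
  moreover have "filt w \<subseteq> filt w'" by (rule filt_antimono) (simp add: w'_def)
  ultimately have "filt w \<subset> filt w'" by blast
  define J' where "J' = case_nat (filt w) J"
  have "ideal_chain (Suc n) J'" "J' 0 = filt w"
    using J \<open>filt w \<subset> filt w'\<close> filt_ideal
    by (auto simp: ideal_chain_def J'_def split: nat.splits)
  then show ?case using Suc.hyps(2) by auto
qed

lemma quot_chain_iff:
  assumes P: "ideal P R"
  shows "(\<exists>J :: nat \<Rightarrow> 'a set set. (\<forall>i\<le>l. ideal (J i) (R Quot P)) \<and> (\<forall>i<l. J i \<subset> J (Suc i))) \<longleftrightarrow>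
    (\<exists>J. ideal_chain l J \<and> P \<subseteq> J 0)"
proof
  let ?h = "\<lambda>J. (+>) P ` J"
  have bij: "bij_betw ?h {J. ideal J R \<and> P \<subseteq> J} {J. ideal J (R Quot P)}"
    by (rule quot_ideal_correspondence[OF P])
  {
    assume "\<exists>J :: nat \<Rightarrow> 'a set set. (\<forall>i\<le>l. ideal (J i) (R Quot P)) \<and> (\<forall>i<l. J i \<subset> J (Suc i))"
    then obtain J where J: "\<And>i. i \<le> l \<Longrightarrow> ideal (J i) (R Quot P)" "\<And>i. i < l \<Longrightarrow> J i \<subset> J (Suc i)"
      by blast
    have "\<exists>K. ideal K R \<and> P \<subseteq> K \<and> ?h K = J i" if "i \<le> l" for i
      using J(1)[OF that] bij unfolding bij_betw_def by (smt (verit, ccfv_threshold) imageE mem_Collect_eq)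
    then obtain K where K: "\<And>i. i \<le> l \<Longrightarrow> ideal (K i) R \<and> P \<subseteq> K i \<and> ?h (K i) = J i" by metis
    have "K i \<subset> K (Suc i)" if "i < l" for i
    proof -
      have Ki: "K i = \<Union> (J i)" "K (Suc i) = \<Union> (J (Suc i))"
        using K[of i] K[of "Suc i"] that ideal_incl_iff[OF P] by (metis Suc_leI less_imp_le)+
      then have "K i \<subseteq> K (Suc i)" using J(2)[OF that] by blast
      moreover have "K i \<noteq> K (Suc i)" using K[of i] K[of "Suc i"] J(2)[OF that] that by auto
      ultimately show ?thesis by blast
    qed
    then show "\<exists>J. ideal_chain l J \<and> P \<subseteq> J 0"
      using K by (intro exI[of _ K]) (auto simp: ideal_chain_def)
  }
  {
    assume "\<exists>J. ideal_chain l J \<and> P \<subseteq> J 0"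
    then obtain J where J: "ideal_chain l J" "P \<subseteq> J 0" by blast
    have PJ: "P \<subseteq> J i" if "i \<le> l" for i using J ideal_chain_bottom[OF J(1) that] by blast
    have "?h (J i) \<subset> ?h (J (Suc i))" if "i < l" for i
    proof -
      have "J i \<subset> J (Suc i)" "ideal (J i) R" "ideal (J (Suc i)) R"
        using J(1) that by (auto simp: ideal_chain_def)
      moreover have "inj_on ?h {J. ideal J R \<and> P \<subseteq> J}" using bij by (rule bij_betw_imp_inj_on)
      ultimately have "?h (J i) \<noteq> ?h (J (Suc i))"
        using PJ[of i] PJ[of "Suc i"] that unfolding inj_on_def by auto
      then show ?thesis using \<open>J i \<subset> J (Suc i)\<close> by blast
    qed
    moreover have "ideal (?h (J i)) (R Quot P)" if "i \<le> l" for i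
      using ring_ideal_imp_quot_ideal[OF P] J(1) that by (simp add: ideal_chain_def)
    ultimately show "\<exists>J :: nat \<Rightarrow> 'a set set. (\<forall>i\<le>l. ideal (J i) (R Quot P)) \<and> (\<forall>i<l. J i \<subset> J (Suc i))"
      by (intro exI[of _ "\<lambda>i. ?h (J i)"]) auto
  }
qed

text \<open>The \<open>t\<close>-th power of the maximal ideal lies between \<open>filt (\<lambda>u. t * e u + N)\<close> and \<open>filt (\<lambda>u. t * e u)\<close>. The smaller
  of these bounds the length of the quotient from above, the larger one bounds it from below.\<close>

lemma length_bounds:
  assumes "N \<le> t"
  shows "\<bar>real (the_enat (ring_length (R Quot max_ideal_pow R t))) - real t * real (\<Sum>u<s. e u)\<bar>
    \<le> real (s * N)"
proof -
  let ?P = "max_ideal_pow R t"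
  define L where "L = {l. \<exists>J. ideal_chain l J \<and> ?P \<subseteq> J 0}"
  have len: "ring_length (R Quot ?P) = (SUP l\<in>L. enat l)"
    unfolding ring_length_def L_def by (simp add: quot_chain_iff[OF max_ideal_pow_ideal])
  have upper: "l \<le> t * (\<Sum>u<s. e u) + s * N" if lL: "l \<in> L" for l
  proof -
    obtain J where J: "ideal_chain l J" "?P \<subseteq> J 0" using lL[unfolded L_def] by blast
    have "l \<le> (\<Sum>u<s. t * e u + N)"
      using ideal_chain_length_le[OF J(1)] filt_subset_max_ideal_pow J(2) by blast
    then show ?thesis by (simp add: sum.distrib sum_distrib_left)
  qed
  define l0 where "l0 = (\<Sum>u<s. t * e u - N)"
  have te: "N \<le> t * e u" if "u < s" for u
    using assms e_pos[OF that] by (metis Suc_leI le_trans mult.right_neutral mult_le_mono2 One_nat_def)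
  then obtain J where "ideal_chain l0 J" "J 0 = filt (\<lambda>u. t * e u)"
    using filt_chain_exists[of "\<lambda>u. t * e u"] unfolding l0_def by auto
  then have "l0 \<in> L" using max_ideal_pow_subset by (auto simp: L_def)
  have "l0 + s * N = (\<Sum>u<s. (t * e u - N) + N)" by (simp add: l0_def sum.distrib)
  also have "\<dots> = (\<Sum>u<s. t * e u)" by (rule sum.cong) (use te in auto)
  finally have l0: "l0 + s * N = t * (\<Sum>u<s. e u)" by (simp add: sum_distrib_left)
  have "(SUP l\<in>L. enat l) \<le> enat (t * (\<Sum>u<s. e u) + s * N)"
    by (rule SUP_least) (use upper in auto)
  then obtain k where k: "(SUP l\<in>L. enat l) = enat k" "k \<le> t * (\<Sum>u<s. e u) + s * N"
    by (metis enat_ile enat_ord_simps(1))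
  have "enat l0 \<le> enat k" unfolding k(1)[symmetric] using \<open>l0 \<in> L\<close> by (rule SUP_upper)
  then have "l0 \<le> k" by simp
  have "real l0 + real (s * N) = real t * real (\<Sum>u<s. e u)"
    using arg_cong[OF l0, of real] by (simp only: of_nat_add of_nat_mult)
  moreover have "real k \<le> real t * real (\<Sum>u<s. e u) + real (s * N)"
    using k(2) by (metis of_nat_add of_nat_mult of_nat_le_iff)
  ultimately show ?thesis using \<open>l0 \<le> k\<close> unfolding len k(1) the_enat.simps by linarith
qed

lemma samuel_multiplicity_eq: "samuel_multiplicity R = (\<Sum>u<s. e u)"
proof -
  define f where "f = (\<lambda>t. real (the_enat (ring_length (R Quot max_ideal_pow R t))) / real t)"
  let ?E = "\<Sum>u<s. e u"
  have lim: "f \<longlonglongrightarrow> real ?E"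
  proof -
    have "(\<lambda>t. f t - real ?E) \<longlonglongrightarrow> 0"
    proof (rule tendsto_0_le)
      show "\<forall>\<^sub>F t in sequentially. norm (f t - real ?E) \<le> norm (real (s * N) / real t) * 1"
        using eventually_ge_at_top[of "max 1 N"]
      proof eventually_elim
        case (elim t)
        then have t: "real t > 0" "N \<le> t" by auto
        have "f t - real ?E = (real (the_enat (ring_length (R Quot max_ideal_pow R t))) - real t * real ?E) / real t"
          using t by (simp add: f_def field_simps)
        then show ?case using length_bounds[OF t(2)] t(1)
          by (simp add: divide_right_mono del: of_nat_sum)
      qed
      show "(\<lambda>t. real (s * N) / real t) \<longlonglongrightarrow> 0" by (rule lim_const_over_n)
    qed
    then show ?thesis by (simp add: LIM_zero_iff)
  qed
  have "samuel_multiplicity R = (THE m. f \<longlonglongrightarrow> real m)"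
    unfolding samuel_multiplicity_def krull_dim_eq_1 f_def by (simp add: one_enat_def Let_def)
  also have "\<dots> = ?E"
  proof (rule the_equality)
    show "m = ?E" if "f \<longlonglongrightarrow> real m" for m
      using LIMSEQ_unique[OF lim that] by (simp only: of_nat_eq_iff)
  qed (rule lim)
  finally show ?thesis .
qed

end

context curve_germ
begin

subsection \<open>Branches\<close>

lemma coset_mem_iff:
  assumes I: "ideal I R" and "a \<in> carrier R" "x \<in> carrier R"
  shows "x \<in> I +> a \<longleftrightarrow> x \<ominus> a \<in> I"
  by (rule abelian_subgroup.a_rcos_module_minus[OF abelian_subgroupI3[OF ideal.axioms(1)[OF I]
    is_abelian_group] ring_axioms assms(2,3)])

lemma coset_eq_iff:
  assumes I: "ideal I R" and "a \<in> carrier R" "x \<in> carrier R"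
  shows "I +> x = I +> a \<longleftrightarrow> x \<ominus> a \<in> I"
  using quotient_eq_iff_same_a_r_cos[OF I assms(3,2)] by simp

abbreviation mpow :: "nat \<Rightarrow> 'a set" where "mpow t \<equiv> max_ideal_pow R t"

abbreviation quo :: "nat \<Rightarrow> 'a set ring" where "quo t \<equiv> R Quot mpow t"

lemma quo_ring: "ring (quo t)" "cring (quo t)"
  by (rule ideal.quotient_is_ring[OF max_ideal_pow_ideal])
    (rule ideal.quotient_is_cring[OF max_ideal_pow_ideal is_cring])

lemma quo_carrierE:
  assumes "c \<in> carrier (quo t)"
  obtains a where "a \<in> carrier R" "c = mpow t +> a"
  using assms unfolding FactRing_def A_RCOSETS_def' by auto

lemma quo_carrierI: "a \<in> carrier R \<Longrightarrow> mpow t +> a \<in> carrier (quo t)"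
  unfolding FactRing_def A_RCOSETS_def' by auto

lemma quo_add: "a \<in> carrier R \<Longrightarrow> b \<in> carrier R \<Longrightarrow>
    (mpow t +> a) \<oplus>\<^bsub>quo t\<^esub> (mpow t +> b) = mpow t +> (a \<oplus> b)"
  using ring_hom_add[OF ideal.rcos_ring_hom[OF max_ideal_pow_ideal]] by metis

lemma quo_mult: "a \<in> carrier R \<Longrightarrow> b \<in> carrier R \<Longrightarrow>
    (mpow t +> a) \<otimes>\<^bsub>quo t\<^esub> (mpow t +> b) = mpow t +> (a \<otimes> b)"
  using ring_hom_mult[OF ideal.rcos_ring_hom[OF max_ideal_pow_ideal]] by metis

lemma quo_one: "\<one>\<^bsub>quo t\<^esub> = mpow t +> \<one>"
  using ring_hom_one[OF ideal.rcos_ring_hom[OF max_ideal_pow_ideal]] by metis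

lemma quo_zero: "\<zero>\<^bsub>quo t\<^esub> = mpow t +> \<zero>"
  using ring_hom_zero[OF ideal.rcos_ring_hom[OF max_ideal_pow_ideal] ring_axioms quo_ring(1)] by metis

text \<open>Sequences of representatives for the elements of the completion; \<open>cosets\<close> is the passage to the classes.\<close>

definition coherent :: "(nat \<Rightarrow> 'a) \<Rightarrow> bool" where
  "coherent x \<longleftrightarrow> (\<forall>t. x t \<in> carrier R) \<and> (\<forall>t. x (Suc t) \<ominus> x t \<in> mpow t)"

definition cosets :: "(nat \<Rightarrow> 'a) \<Rightarrow> nat \<Rightarrow> 'a set" where
  "cosets x = (\<lambda>t. mpow t +> x t)"

abbreviation "Rhat \<equiv> completion R"

lemma coset_subset_iff:
  assumes "a \<in> carrier R" "b \<in> carrier R"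
  shows "mpow (Suc t) +> a \<subseteq> mpow t +> b \<longleftrightarrow> a \<ominus> b \<in> mpow t"
proof
  assume *: "mpow (Suc t) +> a \<subseteq> mpow t +> b"
  have "a \<in> mpow (Suc t) +> a"
    using assms coset_mem_iff[OF max_ideal_pow_ideal, of a a]
      additive_subgroup.zero_closed[OF ideal.axioms(1)[OF max_ideal_pow_ideal]] by (simp add: a_minus_def r_neg)
  then have "a \<in> mpow t +> b" using * by (rule subsetD[rotated])
  then show "a \<ominus> b \<in> mpow t" using coset_mem_iff[OF max_ideal_pow_ideal] assms by simp
next
  assume *: "a \<ominus> b \<in> mpow t"
  then have eq: "mpow t +> a = mpow t +> b"
    using coset_eq_iff[OF max_ideal_pow_ideal] assms by simp
  show "mpow (Suc t) +> a \<subseteq> mpow t +> b"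
    unfolding eq[symmetric] using max_ideal_pow_antimono[of t "Suc t"]
    by (auto simp: a_r_coset_def')
qed

lemma completion_carrier: "carrier Rhat = cosets ` {x. coherent x}"
proof
  show "carrier Rhat \<subseteq> cosets ` {x. coherent x}"
  proof
    fix f assume "f \<in> carrier Rhat"
    then have f: "\<forall>t. f t \<in> carrier (quo t)" "\<forall>t. f (Suc t) \<subseteq> f t" by (auto simp: completion_def)
    have "\<forall>t. \<exists>a\<in>carrier R. f t = mpow t +> a" using f(1) quo_carrierE by metis
    then obtain x where x: "\<And>t. x t \<in> carrier R" "\<And>t. f t = mpow t +> x t" by metis
    then have "coherent x" using f(2) by (simp add: coherent_def coset_subset_iff)
    moreover have "f = cosets x" using x by (auto simp: cosets_def)
    ultimately show "f \<in> cosets ` {x. coherent x}" by blast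
  qed
  show "cosets ` {x. coherent x} \<subseteq> carrier Rhat"
  proof
    fix f assume "f \<in> cosets ` {x. coherent x}"
    then obtain x where x: "coherent x" "f = cosets x" by blast
    then have "f t \<in> carrier (quo t)" "f (Suc t) \<subseteq> f t" for t
      using coset_subset_iff[of "x (Suc t)" "x t" t]
      by (simp_all add: cosets_def coherent_def quo_carrierI)
    then show "f \<in> carrier Rhat" by (simp add: completion_def)
  qed
qed

lemma mpow_closed: "a \<in> mpow t \<Longrightarrow> b \<in> mpow t \<Longrightarrow> a \<oplus> b \<in> mpow t"
  by (rule additive_subgroup.a_closed[OF ideal.axioms(1)[OF max_ideal_pow_ideal]])

lemma coherent_add: "coherent x \<Longrightarrow> coherent y \<Longrightarrow> coherent (\<lambda>t. x t \<oplus> y t)"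
proof -
  assume xy: "coherent x" "coherent y"
  then have c: "x t \<in> carrier R" "y t \<in> carrier R" for t by (auto simp: coherent_def)
  have "x (Suc t) \<oplus> y (Suc t) \<ominus> (x t \<oplus> y t) = (x (Suc t) \<ominus> x t) \<oplus> (y (Suc t) \<ominus> y t)" for t
    using c[of t] c[of "Suc t"] by algebra
  then show ?thesis using xy mpow_closed by (simp add: coherent_def)
qed

lemma coherent_mult: "coherent x \<Longrightarrow> coherent y \<Longrightarrow> coherent (\<lambda>t. x t \<otimes> y t)"
proof -
  assume xy: "coherent x" "coherent y"
  then have c: "x t \<in> carrier R" "y t \<in> carrier R" for t by (auto simp: coherent_def)
  have "x (Suc t) \<otimes> y (Suc t) \<ominus> (x t \<otimes> y t) =
      y (Suc t) \<otimes> (x (Suc t) \<ominus> x t) \<oplus> x t \<otimes> (y (Suc t) \<ominus> y t)" for t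
    using c[of t] c[of "Suc t"] by algebra
  moreover have "y (Suc t) \<otimes> (x (Suc t) \<ominus> x t) \<in> mpow t" "x t \<otimes> (y (Suc t) \<ominus> y t) \<in> mpow t" for t
    using xy c by (auto simp: coherent_def intro!: ideal.I_l_closed[OF max_ideal_pow_ideal])
  ultimately show ?thesis using xy mpow_closed by (simp add: coherent_def)
qed

lemma coherent_const: "a \<in> carrier R \<Longrightarrow> coherent (\<lambda>_. a)"
  using additive_subgroup.zero_closed[OF ideal.axioms(1)[OF max_ideal_pow_ideal]]
  by (simp add: coherent_def a_minus_def r_neg)

lemma coherent_a_inv: "coherent x \<Longrightarrow> coherent (\<lambda>t. \<ominus> x t)"
  using coherent_mult[OF coherent_const[of "\<ominus> \<one>"], of x]
  by (simp add: l_minus coherent_def)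

lemma cosets_add: "coherent x \<Longrightarrow> coherent y \<Longrightarrow> cosets x \<oplus>\<^bsub>Rhat\<^esub> cosets y = cosets (\<lambda>t. x t \<oplus> y t)"
  by (simp add: completion_def cosets_def coherent_def quo_add)

lemma cosets_mult: "coherent x \<Longrightarrow> coherent y \<Longrightarrow> cosets x \<otimes>\<^bsub>Rhat\<^esub> cosets y = cosets (\<lambda>t. x t \<otimes> y t)"
  by (simp add: completion_def cosets_def coherent_def quo_mult)

lemma cosets_one: "\<one>\<^bsub>Rhat\<^esub> = cosets (\<lambda>_. \<one>)"
  by (simp add: completion_def cosets_def quo_one)

lemma cosets_zero: "\<zero>\<^bsub>Rhat\<^esub> = cosets (\<lambda>_. \<zero>)"
  by (simp add: completion_def cosets_def quo_zero)

lemma coherent_closed: "coherent x \<Longrightarrow> x t \<in> carrier R"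
  by (simp add: coherent_def)

lemma completion_cring: "cring Rhat"
proof (rule cringI)
  show "abelian_group Rhat"
  proof (rule abelian_groupI)
    fix f assume "f \<in> carrier Rhat"
    then obtain x where x: "coherent x" "f = cosets x" by (auto simp: completion_carrier)
    then have "cosets (\<lambda>t. \<ominus> x t) \<oplus>\<^bsub>Rhat\<^esub> f = \<zero>\<^bsub>Rhat\<^esub>"
      by (simp add: cosets_add coherent_a_inv cosets_zero l_neg coherent_closed)
    then show "\<exists>h\<in>carrier Rhat. h \<oplus>\<^bsub>Rhat\<^esub> f = \<zero>\<^bsub>Rhat\<^esub>"
      using coherent_a_inv[OF x(1)] by (auto simp: completion_carrier)
  qed (auto simp: completion_carrier cosets_add cosets_zero coherent_add coherent_const
        coherent_closed a_ac intro!: imageI)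
  show "Group.comm_monoid Rhat"
    by (rule comm_monoidI)
      (auto simp: completion_carrier cosets_mult cosets_one coherent_mult coherent_const
        coherent_closed m_ac intro!: imageI)
qed (auto simp: completion_carrier cosets_add cosets_mult coherent_add coherent_mult coherent_closed l_distr)

lemma eps_cong_nth:
  assumes "a \<in> carrier R" "b \<in> carrier R" "a \<ominus> b \<in> mpow t" "i < t" "u < s"
  shows "fps_nth (eps u a) i = fps_nth (eps u b) i"
proof -
  have "a \<ominus> b \<in> filt (\<lambda>u. t * e u)" using max_ideal_pow_subset assms(3) by (rule subsetD)
  then have "fps_X ^ (t * e u) dvd eps u a - eps u b"
    using assms by (simp add: filt_def eps_minus)
  moreover have "i < t * e u" using assms(4) e_pos[OF assms(5)] by (metis less_le_trans mult.right_neutral mult_le_mono2 Suc_leI One_nat_def)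
  ultimately show ?thesis by (simp add: fps_X_power_dvd_iff)
qed

lemma coherent_diff:
  assumes x: "coherent x" and "t \<le> t'"
  shows "x t' \<ominus> x t \<in> mpow t"
  using assms(2)
proof (induction t' rule: dec_induct)
  case base
  show ?case
    using x additive_subgroup.zero_closed[OF ideal.axioms(1)[OF max_ideal_pow_ideal]]
    by (simp add: coherent_closed a_minus_def r_neg)
next
  case (step t')
  have c: "x t \<in> carrier R" "x t' \<in> carrier R" "x (Suc t') \<in> carrier R"
    using x by (simp_all add: coherent_closed)
  have "x (Suc t') \<ominus> x t' \<in> mpow t"
    using x step.hyps max_ideal_pow_antimono[of t t'] by (auto simp: coherent_def)
  moreover have "x (Suc t') \<ominus> x t = (x (Suc t') \<ominus> x t') \<oplus> (x t' \<ominus> x t)" using c by algebra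
  ultimately show ?case using step.IH mpow_closed by simp
qed

text \<open>The extension of \<open>eps u\<close> to the completion. The coefficients of degree below \<open>t\<close> only depend on the class
  modulo the \<open>t\<close>-th power of the maximal ideal, as \<open>e u\<close> is positive.\<close>

definition lim_eps :: "nat \<Rightarrow> (nat \<Rightarrow> 'a) \<Rightarrow> 'k fps" where
  "lim_eps u x = Abs_fps (\<lambda>i. fps_nth (eps u (x (Suc i))) i)"

lemma lim_eps_nth: "coherent x \<Longrightarrow> i < t \<Longrightarrow> u < s \<Longrightarrow> fps_nth (lim_eps u x) i = fps_nth (eps u (x t)) i"
  using eps_cong_nth[of "x t" "x (Suc i)" "Suc i" i u] coherent_diff[of x "Suc i" t]
  by (simp add: lim_eps_def coherent_closed)

lemma lim_eps_add: "coherent x \<Longrightarrow> coherent y \<Longrightarrow> u < s \<Longrightarrow>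
    lim_eps u (\<lambda>t. x t \<oplus> y t) = lim_eps u x + lim_eps u y"
  by (rule fps_ext) (simp add: lim_eps_def eps_add coherent_closed)

lemma lim_eps_mult:
  assumes "coherent x" "coherent y" "u < s"
  shows "lim_eps u (\<lambda>t. x t \<otimes> y t) = lim_eps u x * lim_eps u y"
proof (rule fps_ext)
  fix n
  have "fps_nth (lim_eps u (\<lambda>t. x t \<otimes> y t)) n = fps_nth (eps u (x (Suc n)) * eps u (y (Suc n))) n"
    using assms by (simp add: lim_eps_def eps_mult coherent_closed)
  also have "\<dots> = fps_nth (lim_eps u x * lim_eps u y) n"
    unfolding fps_mult_nth using assms
    by (intro sum.cong) (simp_all add: lim_eps_nth[of _ _ "Suc n"])
  finally show "fps_nth (lim_eps u (\<lambda>t. x t \<otimes> y t)) n = fps_nth (lim_eps u x * lim_eps u y) n" .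
qed

text \<open>The completion embeds into the product of the power series rings of the branches: if all expansions of the
  limit vanish, then far along the sequence the representatives lie in \<open>filt (\<lambda>u. r * e u + N)\<close>, hence in the
  \<open>r\<close>-th power of the maximal ideal.\<close>

lemma lim_eps_zero_imp:
  assumes x: "coherent x" and "\<And>u. u < s \<Longrightarrow> lim_eps u x = 0"
  shows "cosets x = \<zero>\<^bsub>Rhat\<^esub>"
proof -
  have "x r \<in> mpow r" for r
  proof -
    define t where "t = (\<Sum>u<s. r * e u + N) + r"
    have "x t \<in> filt (\<lambda>u. r * e u + N)"
    proof -
      have "fps_X ^ (r * e u + N) dvd eps u (x t)" if "u < s" for u
      proof -
        have "r * e u + N \<le> (\<Sum>u<s. r * e u + N)"
          using that by (intro member_le_sum) auto
        then have "fps_nth (eps u (x t)) i = 0" if "i < r * e u + N" for i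
          using lim_eps_nth[OF x _ \<open>u < s\<close>, of i t] assms(2)[OF \<open>u < s\<close>] that by (simp add: t_def)
        then show ?thesis by (simp add: fps_X_power_dvd_iff)
      qed
      then show ?thesis using x by (simp add: filt_def coherent_closed)
    qed
    then have "x t \<in> mpow r" using filt_subset_max_ideal_pow by blast
    moreover have "x t \<ominus> x r \<in> mpow r" using x by (rule coherent_diff) (simp add: t_def)
    moreover have "x r = x t \<oplus> \<ominus> (x t \<ominus> x r)"
      using coherent_closed[OF x] by (simp add: a_minus_def minus_add a_assoc[symmetric] r_neg)
    ultimately show ?thesis
      using mpow_closed additive_subgroup.a_inv_closed[OF ideal.axioms(1)[OF max_ideal_pow_ideal]]
      by metis
  qed
  then show ?thesis
    unfolding cosets_zero cosets_def using coherent_closed[OF x]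
    by (intro ext) (simp add: coset_eq_iff[OF max_ideal_pow_ideal] a_minus_def)
qed

text \<open>The kernel of the \<open>u\<close>-th completed expansion; it is prime because power series form a domain. These kernels
  intersect in zero and are pairwise incomparable, so they are the minimal primes of the completion.\<close>

definition branch_prime :: "nat \<Rightarrow> (nat \<Rightarrow> 'a set) set" where
  "branch_prime u = cosets ` {x. coherent x \<and> lim_eps u x = 0}"

lemma cosets_eq_imp_lim_eps_eq:
  assumes "coherent x" "coherent y" "cosets x = cosets y" "u < s"
  shows "lim_eps u x = lim_eps u y"
proof (rule fps_ext)
  fix i
  have "mpow (Suc i) +> x (Suc i) = mpow (Suc i) +> y (Suc i)"
    using assms(3) unfolding cosets_def by metis
  then have "x (Suc i) \<ominus> y (Suc i) \<in> mpow (Suc i)"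
    using coset_eq_iff[OF max_ideal_pow_ideal] assms by (simp add: coherent_closed)
  then show "fps_nth (lim_eps u x) i = fps_nth (lim_eps u y) i"
    unfolding lim_eps_def using assms by (simp add: eps_cong_nth[of _ _ "Suc i"] coherent_closed)
qed

lemma cosets_in_branch_prime:
  "coherent x \<Longrightarrow> u < s \<Longrightarrow> cosets x \<in> branch_prime u \<longleftrightarrow> lim_eps u x = 0"
proof
  assume *: "coherent x" "u < s" "cosets x \<in> branch_prime u"
  then obtain y where "coherent y" "lim_eps u y = 0" "cosets x = cosets y"
    unfolding branch_prime_def by blast
  then show "lim_eps u x = 0" using cosets_eq_imp_lim_eps_eq[of x y u] * by simp
qed (simp add: branch_prime_def)

lemma lim_eps_const: "u < s \<Longrightarrow> lim_eps u (\<lambda>_. a) = eps u a"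
  by (rule fps_ext) (simp add: lim_eps_def)

lemma branch_prime_primeideal:
  assumes u: "u < s"
  shows "primeideal (branch_prime u) Rhat"
proof (rule primeidealI)
  interpret Rh: cring Rhat by (rule completion_cring)
  show "ideal (branch_prime u) Rhat"
  proof (rule idealI[OF Rh.ring_axioms])
    show "subgroup (branch_prime u) (add_monoid Rhat)"
    proof (rule group.subgroupI[OF Rh.a_group])
      show "branch_prime u \<subseteq> carrier (add_monoid Rhat)"
        by (auto simp: branch_prime_def completion_carrier)
      have "cosets (\<lambda>_. \<zero>) \<in> branch_prime u"
        using u by (simp add: cosets_in_branch_prime coherent_const lim_eps_const eps_zero)
      then show "branch_prime u \<noteq> {}" by blast
      fix f assume "f \<in> branch_prime u"
      then obtain x where x: "coherent x" "lim_eps u x = 0" "f = cosets x" by (auto simp: branch_prime_def)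
      have "cosets (\<lambda>t. \<ominus> x t) \<oplus>\<^bsub>Rhat\<^esub> f = \<zero>\<^bsub>Rhat\<^esub>"
        using x by (simp add: cosets_add coherent_a_inv cosets_zero l_neg coherent_closed)
      then have "\<ominus>\<^bsub>Rhat\<^esub> f = cosets (\<lambda>t. \<ominus> x t)"
        using Rh.minus_equality x coherent_a_inv[OF x(1)] by (auto simp: completion_carrier)
      moreover have "lim_eps u (\<lambda>t. \<ominus> x t) = 0"
        using lim_eps_add[OF x(1) coherent_a_inv[OF x(1)] u] x
        by (simp add: r_neg coherent_closed lim_eps_const u eps_zero)
      ultimately show "inv\<^bsub>add_monoid Rhat\<^esub> f \<in> branch_prime u"
        unfolding a_inv_def[symmetric] using x u by (simp add: cosets_in_branch_prime coherent_a_inv)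
    next
      fix f h assume "f \<in> branch_prime u" "h \<in> branch_prime u"
      then obtain x y where "coherent x" "lim_eps u x = 0" "f = cosets x"
        "coherent y" "lim_eps u y = 0" "h = cosets y" by (auto simp: branch_prime_def)
      then show "f \<otimes>\<^bsub>add_monoid Rhat\<^esub> h \<in> branch_prime u"
        using u by (simp add: cosets_add cosets_in_branch_prime coherent_add lim_eps_add)
    qed
    fix f h assume "f \<in> branch_prime u" "h \<in> carrier Rhat"
    then obtain x y where xy: "coherent x" "lim_eps u x = 0" "f = cosets x"
      "coherent y" "h = cosets y" by (auto simp: branch_prime_def completion_carrier)
    show "h \<otimes>\<^bsub>Rhat\<^esub> f \<in> branch_prime u" "f \<otimes>\<^bsub>Rhat\<^esub> h \<in> branch_prime u"
      using u xy by (simp_all add: cosets_mult cosets_in_branch_prime coherent_mult lim_eps_mult)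
  qed
  show "cring Rhat" by (rule completion_cring)
  have "\<one>\<^bsub>Rhat\<^esub> \<notin> branch_prime u"
    using u by (simp add: cosets_one cosets_in_branch_prime coherent_const lim_eps_const eps_one)
  then show "carrier Rhat \<noteq> branch_prime u" using Rh.one_closed by metis
  fix f h assume fh: "f \<in> carrier Rhat" "h \<in> carrier Rhat" "f \<otimes>\<^bsub>Rhat\<^esub> h \<in> branch_prime u"
  then obtain x y where "coherent x" "f = cosets x" "coherent y" "h = cosets y"
    by (auto simp: completion_carrier)
  then show "f \<in> branch_prime u \<or> h \<in> branch_prime u"
    using u fh(3) by (simp add: cosets_mult cosets_in_branch_prime coherent_mult lim_eps_mult)
qed

text \<open>Otherwise \<open>Q\<close> misses an element of each branch prime, hence also their product, which lies in all branch
  primes and so is zero.\<close>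

lemma prime_contains_branch_prime:
  assumes Q: "primeideal Q Rhat"
  obtains u where "u < s" "branch_prime u \<subseteq> Q"
proof -
  interpret Rh: cring Rhat by (rule completion_cring)
  have "\<exists>u<s. branch_prime u \<subseteq> Q"
  proof (rule ccontr)
    assume no: "\<not> ?thesis"
    have "\<exists>x. coherent x \<and> cosets x \<notin> Q \<and> (\<forall>u<r. lim_eps u x = 0)" if "r \<le> s" for r
      using that
    proof (induction r)
      case 0
      have "\<one>\<^bsub>Rhat\<^esub> \<notin> Q"
        using ideal.one_imp_carrier[OF primeideal.axioms(1)[OF Q]] primeideal.I_notcarr[OF Q] by metis
      then show ?case by (intro exI[of _ "\<lambda>_. \<one>"]) (simp add: cosets_one coherent_const)
    next
      case (Suc r)
      then obtain x where x: "coherent x" "cosets x \<notin> Q" "\<forall>u<r. lim_eps u x = 0" by auto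
      have "\<not> branch_prime r \<subseteq> Q" using no Suc.prems by auto
      then obtain y where y: "coherent y" "cosets y \<notin> Q" "lim_eps r y = 0"
        by (auto simp: branch_prime_def)
      have "cosets x \<in> carrier Rhat" "cosets y \<in> carrier Rhat"
        using x y by (auto simp: completion_carrier)
      then have "cosets x \<otimes>\<^bsub>Rhat\<^esub> cosets y \<notin> Q" using primeideal.I_prime[OF Q] x(2) y(2) by metis
      then show ?case using x y Suc.prems
        by (intro exI[of _ "\<lambda>t. x t \<otimes> y t"])
          (auto simp: cosets_mult coherent_mult lim_eps_mult less_Suc_eq)
    qed
    from this[of s] obtain x where x: "coherent x" "cosets x \<notin> Q" "\<forall>u<s. lim_eps u x = 0" by auto
    then have "cosets x = \<zero>\<^bsub>Rhat\<^esub>" using lim_eps_zero_imp by blast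
    then show False using x(2) additive_subgroup.zero_closed[OF ideal.axioms(1)[OF primeideal.axioms(1)[OF Q]]] by metis
  qed
  then show thesis using that by blast
qed

text \<open>Subtracting suitable multiples of elements of order exactly \<open>M\<close> on one branch and \<open>Suc M\<close> on the others
  removes the coefficients of degree \<open>M\<close>, one branch at a time. As \<open>N < M\<close>, the order on the branch \<open>u'\<close> is not affected.\<close>

lemma single_branch_step:
  assumes u': "u' < s" and f: "f \<in> carrier R" "has_order N (eps u' f)"
    and M: "N < M" and ord: "\<forall>u<s. u \<noteq> u' \<longrightarrow> fps_X ^ M dvd eps u f"
  shows "\<exists>f'\<in>carrier R. has_order N (eps u' f') \<and> (\<forall>u<s. u \<noteq> u' \<longrightarrow> fps_X ^ Suc M dvd eps u f') \<and>
    f' \<ominus> f \<in> filt (\<lambda>_. M)"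
proof -
  have "\<exists>f'\<in>carrier R. has_order N (eps u' f') \<and> (\<forall>u<s. u \<noteq> u' \<longrightarrow> fps_X ^ M dvd eps u f') \<and>
     (\<forall>u<r. u \<noteq> u' \<longrightarrow> fps_X ^ Suc M dvd eps u f') \<and> f' \<ominus> f \<in> filt (\<lambda>_. M)" if "r \<le> s" for r
    using that
  proof (induction r)
    case 0
    have "f \<ominus> f \<in> filt (\<lambda>_. M)" using f by (simp add: filt_def a_minus_def r_neg eps_zero)
    then show ?case using f ord by auto
  next
    case (Suc r)
    then obtain h where h: "h \<in> carrier R" "has_order N (eps u' h)" "\<forall>u<s. u \<noteq> u' \<longrightarrow> fps_X ^ M dvd eps u h"
      "\<forall>u<r. u \<noteq> u' \<longrightarrow> fps_X ^ Suc M dvd eps u h" "h \<ominus> f \<in> filt (\<lambda>_. M)" by auto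
    show ?case
    proof (cases "r = u'")
      case True
      then show ?thesis using h by (auto simp: less_Suc_eq)
    next
      case False
      have r: "r < s" using Suc.prems by simp
      obtain a where a: "a \<in> carrier R" "\<forall>u<s. has_order (if u = r then M else Suc M) (eps u a)"
      proof -
        have "N \<le> (if u = r then M else Suc M)" for u using M by simp
        then have "\<exists>a\<in>carrier R. \<forall>u<s. has_order (if u = r then M else Suc M) (eps u a)" by (rule attain)
        then show thesis using that by (elim bexE)
      qed
      define c where "c = const (fps_nth (eps r h) M / fps_nth (eps r a) M)"
      have c: "c \<in> carrier R" by (simp add: c_def const_closed)
      define h' where "h' = h \<ominus> c \<otimes> a"
      have h'c: "h' \<in> carrier R" using h a c by (simp add: h'_def)
      have eps_h': "eps v h' = eps v h - eps v c * eps v a" if "v < s" for v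
        unfolding h'_def using h a c that by (simp add: eps_minus eps_mult)
      have aM: "fps_X ^ M dvd eps u a" if "u < s" for u
        using a(2) that by (cases "u = r") (auto simp: has_order_def simp del: power_Suc intro: fps_X_power_dvd_le)
      have aM': "fps_X ^ Suc M dvd eps u a" if "u < s" "u \<noteq> r" for u
        using a(2) that by (auto simp: has_order_def simp del: power_Suc)
      have "has_order N (eps u' h')"
      proof -
        have "fps_X ^ Suc N dvd eps u' c * eps u' a"
          by (rule dvd_mult, rule fps_X_power_dvd_le[OF aM[OF u']]) (use M in simp)
        then have "fps_nth (eps u' c * eps u' a) i = 0" if "i \<le> N" for i
          using that unfolding fps_X_power_dvd_iff by simp
        then have "fps_nth (eps u' h') i = fps_nth (eps u' h) i" if "i \<le> N" for i
          unfolding eps_h'[OF u'] using that by simp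
        then show ?thesis using h(2) unfolding has_order_def fps_X_power_dvd_iff by simp
      qed
      moreover have hM: "fps_X ^ M dvd eps u h'" if "u < s" "u \<noteq> u'" for u
        unfolding eps_h'[OF that(1)] using aM[OF that(1)] h(3) that by (intro dvd_diff dvd_mult) auto
      moreover have "fps_X ^ Suc M dvd eps u h'" if "u < Suc r" "u \<noteq> u'" for u
      proof (cases "u = r")
        case True
        have "fps_nth (eps r a) M \<noteq> 0" using a(2) r by (auto simp: has_order_def)
        then have "fps_nth (eps r h') M = 0" using r by (simp add: eps_h' c_def eps_const)
        then show ?thesis using hM[of u] True r that(2)
          unfolding fps_X_power_dvd_Suc_iff by simp
      next
        case False
        then have "u < r" using that by simp
        then have "u < s" using r by simp
        then show ?thesis unfolding eps_h'[OF \<open>u < s\<close>]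
          using aM'[of u] h(4) that \<open>u < r\<close> False by (intro dvd_diff dvd_mult) auto
      qed
      moreover have "h' \<ominus> f \<in> filt (\<lambda>_. M)"
      proof -
        have "h' \<ominus> f = (h \<ominus> f) \<oplus> \<ominus> (c \<otimes> a)" unfolding h'_def using h(1) f(1) a(1) c by algebra
        moreover have "c \<otimes> a \<in> filt (\<lambda>_. M)" using a(1) c aM by (simp add: filt_def eps_mult)
        ultimately show ?thesis using h(5)
          additive_subgroup.a_closed[OF ideal.axioms(1)[OF filt_ideal]]
          additive_subgroup.a_inv_closed[OF ideal.axioms(1)[OF filt_ideal]] by metis
      qed
      ultimately show ?thesis using h'c by blast
    qed
  qed
  from this[of s] show ?thesis by auto
qed

text \<open>Idempotents of the normalisation need not lie in the completion, but multiples of them by elements of the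
  conductor do. Here such an element is built by successive approximation.\<close>

lemma separating_element:
  assumes u': "u' < s"
  obtains x where "coherent x" "lim_eps u' x \<noteq> 0" "\<And>u. u < s \<Longrightarrow> u \<noteq> u' \<Longrightarrow> lim_eps u x = 0"
proof -
  define good where "good = (\<lambda>M f. f \<in> carrier R \<and> has_order N (eps u' f) \<and>
    (\<forall>u<s. u \<noteq> u' \<longrightarrow> fps_X ^ (Suc N + M) dvd eps u f))"
  have "\<exists>f. \<forall>M. good M (f M) \<and> f (Suc M) \<ominus> f M \<in> filt (\<lambda>_. Suc N + M)"
  proof (rule dependent_nat_choice)
    obtain a where "a \<in> carrier R" "\<forall>u<s. has_order (if u = u' then N else Suc N) (eps u a)"
    proof -
      have "N \<le> (if u = u' then N else Suc N)" for u by simp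
      then have "\<exists>a\<in>carrier R. \<forall>u<s. has_order (if u = u' then N else Suc N) (eps u a)" by (rule attain)
      then show thesis using that by (elim bexE)
    qed
    then have "good 0 a" using u' by (auto simp: good_def has_order_def)
    then show "\<exists>f. good 0 f" ..
  next
    fix f M assume "good M f"
    then show "\<exists>f'. good (Suc M) f' \<and> f' \<ominus> f \<in> filt (\<lambda>_. Suc N + M)"
      using single_branch_step[OF u', of f "Suc N + M"] by (auto simp: good_def)
  qed
  then obtain f where f: "\<And>M. good M (f M)" "\<And>M. f (Suc M) \<ominus> f M \<in> filt (\<lambda>_. Suc N + M)" by blast
  define E where "E = (\<Sum>u<s. e u)"
  \<comment> \<open>Speeding the sequence up makes consecutive members congruent modulo the powers of the maximal ideal,
    as its \<open>t\<close>-th power contains all elements whose orders are at least \<open>t * E + N\<close>.\<close>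
  define x where "x = (\<lambda>t. f (t * E + N))"
  have fc: "f M \<in> carrier R" for M using f(1) by (auto simp: good_def)
  have f_diff: "f M' \<ominus> f M \<in> filt (\<lambda>_. M)" if "M \<le> M'" for M M'
    using that
  proof (induction M' rule: dec_induct)
    case base
    then show ?case using fc by (simp add: filt_def a_minus_def r_neg eps_zero)
  next
    case (step M')
    have "f (Suc M') \<ominus> f M = (f (Suc M') \<ominus> f M') \<oplus> (f M' \<ominus> f M)"
      using fc[of M] fc[of M'] fc[of "Suc M'"] by algebra
    moreover have "f (Suc M') \<ominus> f M' \<in> filt (\<lambda>_. M)"
      using f(2)[of M'] filt_antimono[of "\<lambda>_. M" "\<lambda>_. Suc N + M'"] step.hyps by auto
    ultimately show ?case
      using step.IH additive_subgroup.a_closed[OF ideal.axioms(1)[OF filt_ideal]] by metis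
  qed
  have e_le: "e u \<le> E" if "u < s" for u
    unfolding E_def using that by (intro member_le_sum) auto
  have x: "coherent x"
    unfolding coherent_def
  proof (intro conjI allI)
    show "x t \<in> carrier R" for t by (simp add: x_def fc)
    fix t
    have "x (Suc t) \<ominus> x t \<in> filt (\<lambda>_. t * E + N)" unfolding x_def by (rule f_diff) simp
    also have "\<dots> \<subseteq> filt (\<lambda>u. t * e u + N)" by (rule filt_antimono) (simp add: e_le)
    also have "\<dots> \<subseteq> mpow t" by (rule filt_subset_max_ideal_pow)
    finally show "x (Suc t) \<ominus> x t \<in> mpow t" .
  qed
  have E: "0 < E" using e_le[OF s_pos] e_pos[OF s_pos] by linarith
  have "fps_nth (lim_eps u' x) N \<noteq> 0"
    using lim_eps_nth[OF x _ u', of N "Suc N"] f(1) by (auto simp: x_def good_def has_order_def)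
  then have "lim_eps u' x \<noteq> 0" by auto
  moreover have "lim_eps u x = 0" if "u < s" "u \<noteq> u'" for u
  proof (rule fps_ext)
    fix i
    have "fps_X ^ (Suc N + (Suc i * E + N)) dvd eps u (x (Suc i))"
      using f(1) that unfolding x_def good_def by blast
    moreover have "i \<le> i * E" using E by (cases E) simp_all
    then have "i < Suc N + (Suc i * E + N)" unfolding mult_Suc by linarith
    ultimately have "fps_nth (eps u (x (Suc i))) i = 0" unfolding fps_X_power_dvd_iff by blast
    then show "fps_nth (lim_eps u x) i = fps_nth 0 i" by (simp add: lim_eps_def)
  qed
  ultimately show thesis using x that by blast
qed

lemma branch_prime_subset_iff:
  assumes "u < s" "v < s"
  shows "branch_prime u \<subseteq> branch_prime v \<longleftrightarrow> u = v"
proof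
  assume *: "branch_prime u \<subseteq> branch_prime v"
  obtain x where x: "coherent x" "lim_eps v x \<noteq> 0" "\<And>u. u < s \<Longrightarrow> u \<noteq> v \<Longrightarrow> lim_eps u x = 0"
    using separating_element[OF assms(2)] by blast
  show "u = v"
  proof (rule ccontr)
    assume "u \<noteq> v"
    then have "cosets x \<in> branch_prime u" using x assms by (simp add: cosets_in_branch_prime)
    then have "cosets x \<in> branch_prime v" using * by blast
    then show False using x assms by (simp add: cosets_in_branch_prime)
  qed
qed simp

lemma branch_number_eq: "branch_number R = s"
proof -
  have "minimal_primes Rhat = branch_prime ` {..<s}"
  proof
    show "minimal_primes Rhat \<subseteq> branch_prime ` {..<s}"
    proof
      fix P assume P: "P \<in> minimal_primes Rhat"
      then have "primeideal P Rhat" by (simp add: minimal_primes_def)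
      then obtain u where u: "u < s" "branch_prime u \<subseteq> P" by (rule prime_contains_branch_prime)
      then have "branch_prime u = P"
        using P branch_prime_primeideal[OF u(1)] by (simp add: minimal_primes_def)
      then show "P \<in> branch_prime ` {..<s}" using u by blast
    qed
    show "branch_prime ` {..<s} \<subseteq> minimal_primes Rhat"
    proof
      fix P assume "P \<in> branch_prime ` {..<s}"
      then obtain u where u: "u < s" "P = branch_prime u" by blast
      have "Q = P" if Q: "primeideal Q Rhat" "Q \<subseteq> P" for Q
      proof -
        obtain v where v: "v < s" "branch_prime v \<subseteq> Q" by (rule prime_contains_branch_prime[OF Q(1)])
        then have "branch_prime v \<subseteq> branch_prime u" using Q(2) u(2) by simp
        then have "v = u" using branch_prime_subset_iff[OF v(1) u(1)] by simp
        then show ?thesis using Q u v by blast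
      qed
      then show "P \<in> minimal_primes Rhat"
        using branch_prime_primeideal[OF u(1)] u(2) by (simp add: minimal_primes_def)
    qed
  qed
  moreover have "inj_on branch_prime {..<s}"
    by (rule inj_onI) (use branch_prime_subset_iff in auto)
  ultimately show ?thesis by (simp add: branch_number_def card_image)
qed

end

section \<open>Binary forms\<close>

lemma comm_ring_hom_poly_map:
  assumes "comm_ring_hom \<kappa>"
  shows "comm_ring_hom (\<lambda>p. poly (map_poly \<kappa> p) a)"
proof -
  interpret comm_ring_hom \<kappa> by (rule assms)
  have add: "poly (map_poly \<kappa> (p + q)) a = poly (map_poly \<kappa> p) a + poly (map_poly \<kappa> q) a" for p q
  proof -
    have "map_poly \<kappa> (p + q) = map_poly \<kappa> p + map_poly \<kappa> q"
      by (rule poly_eqI) (simp add: coeff_map_poly hom_add)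
    then show ?thesis by simp
  qed
  have smult: "poly (map_poly \<kappa> (Polynomial.smult c q)) a = \<kappa> c * poly (map_poly \<kappa> q) a" for c q
  proof -
    have "map_poly \<kappa> (Polynomial.smult c q) = Polynomial.smult (\<kappa> c) (map_poly \<kappa> q)"
      by (rule poly_eqI) (simp add: coeff_map_poly hom_mult)
    then show ?thesis by simp
  qed
  have pCons: "poly (map_poly \<kappa> (pCons c q)) a = \<kappa> c + a * poly (map_poly \<kappa> q) a" for c q
    by (simp add: map_poly_pCons)
  have mult: "poly (map_poly \<kappa> (p * q)) a = poly (map_poly \<kappa> p) a * poly (map_poly \<kappa> q) a" for p q
    by (induction p) (simp_all add: add smult pCons mult_pCons_left algebra_simps)
  show ?thesis
    by unfold_locales (simp_all add: add mult one_pCons pCons)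
qed

definition varx :: "'k :: comm_ring_1 poly poly" where "varx = [:[:0, 1:]:]"
definition vary :: "'k :: comm_ring_1 poly poly" where "vary = [:0, 1:]"
definition cst :: "'k :: comm_ring_1 \<Rightarrow> 'k poly poly" where "cst c = [:[:c:]:]"

definition ev2 :: "('k :: comm_ring_1 \<Rightarrow> 'r :: comm_ring_1) \<Rightarrow> 'r \<Rightarrow> 'r \<Rightarrow> 'k poly poly \<Rightarrow> 'r" where
  "ev2 \<kappa> a b f = poly (map_poly (\<lambda>c. poly (map_poly \<kappa> c) a) f) b"

lemma comm_ring_hom_ev2: "comm_ring_hom \<kappa> \<Longrightarrow> comm_ring_hom (ev2 \<kappa> a b)"
  unfolding ev2_def by (intro comm_ring_hom_poly_map)

lemma ev2_values:
  assumes "comm_ring_hom \<kappa>"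
  shows "ev2 \<kappa> a b (cst c) = \<kappa> c" "ev2 \<kappa> a b varx = a" "ev2 \<kappa> a b vary = b"
proof -
  interpret comm_ring_hom \<kappa> by (rule assms)
  show "ev2 \<kappa> a b (cst c) = \<kappa> c" "ev2 \<kappa> a b varx = a" "ev2 \<kappa> a b vary = b"
    by (simp_all add: ev2_def map_poly_pCons cst_def varx_def vary_def)
qed

text \<open>Homomorphisms on \<open>k[x,y]\<close> are compared on the constants and on the two variables; the congruence modulo \<open>r\<close>
  also serves for divisibility by linear forms.\<close>

lemma hom_cong:
  fixes h h' :: "'k :: comm_ring_1 poly poly \<Rightarrow> 'r :: comm_ring_1"
  assumes h: "comm_ring_hom h" and h': "comm_ring_hom h'"
    and C: "\<And>c. h (cst c) = h' (cst c)" and X: "r dvd h varx - h' varx" and Y: "r dvd h vary - h' vary"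
  shows "r dvd h f - h' f"
proof -
  interpret h: comm_ring_hom h by (rule h)
  interpret h': comm_ring_hom h' by (rule h')
  have mult: "r dvd h p * h q - h' p * h' q" if "r dvd h p - h' p" "r dvd h q - h' q" for p q
  proof -
    have "h p * h q - h' p * h' q = (h p - h' p) * h q + h' p * (h q - h' q)"
      by (simp add: algebra_simps)
    then show ?thesis using that by simp
  qed
  have 1: "r dvd h [:p:] - h' [:p:]" for p
  proof (induction p)
    case (pCons a p)
    have "[:pCons a p:] = cst a + varx * [:p:]" by (simp add: cst_def varx_def)
    then have "h [:pCons a p:] - h' [:pCons a p:] = h varx * h [:p:] - h' varx * h' [:p:]"
      using C by (simp only: h.hom_add h'.hom_add h.hom_mult h'.hom_mult) simp
    then show ?case using mult[of varx "[:p:]"] X pCons by simp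
  qed simp
  show ?thesis
  proof (induction f)
    case (pCons p f)
    have "pCons p f = [:p:] + vary * f" by (simp add: vary_def)
    then have "h (pCons p f) - h' (pCons p f) = (h [:p:] - h' [:p:]) + (h vary * h f - h' vary * h' f)"
      by (simp only: h.hom_add h'.hom_add h.hom_mult h'.hom_mult) simp
    then show ?case using mult[of vary f] Y pCons 1 by simp
  qed simp
qed

lemma hom_ext:
  assumes "comm_ring_hom h" "comm_ring_hom h'" "\<And>c. h (cst c) = h' (cst c)" "h varx = h' varx" "h vary = h' vary"
  shows "h f = h' f"
  using hom_cong[of h h' 0 f] assms by simp

lemma comm_ring_hom_comp: "comm_ring_hom h \<Longrightarrow> comm_ring_hom h' \<Longrightarrow> comm_ring_hom (\<lambda>x. h (h' x))"
proof -
  assume "comm_ring_hom h" "comm_ring_hom h'"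
  then interpret h: comm_ring_hom h + h': comm_ring_hom h' .
  show ?thesis by unfold_locales (simp_all add: h.hom_add h.hom_mult h'.hom_add h'.hom_mult)
qed

lemma comm_ring_hom_ident: "comm_ring_hom (\<lambda>x. x)"
  by unfold_locales simp_all

lemma comm_ring_hom_poly_const: "comm_ring_hom (\<lambda>c. [:c:])"
  by unfold_locales (simp_all add: one_pCons)

lemma comm_ring_hom_C: "comm_ring_hom cst"
  unfolding cst_def by (rule comm_ring_hom_comp[OF comm_ring_hom_poly_const comm_ring_hom_poly_const])

interpretation cst: comm_ring_hom cst
  by (rule comm_ring_hom_C)

lemma cst_eq_0_iff [simp]: "cst c = 0 \<longleftrightarrow> c = 0"
  by (simp add: cst_def)

lemma cst_dvd_1: "c \<noteq> 0 \<Longrightarrow> cst c dvd 1" for c :: "'k :: field"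
  by (rule dvdI[of _ _ "cst (1 / c)"]) (simp flip: cst.hom_mult)

lemma comm_ring_hom_fps_const: "comm_ring_hom fps_const"
  by unfold_locales simp_all

lemma comm_ring_hom_poly: "comm_ring_hom (\<lambda>p. poly p a)"
  by unfold_locales simp_all

lemma comm_ring_hom_eval2: "comm_ring_hom (\<lambda>f. eval2 f a b)"
  unfolding eval2_def by (rule comm_ring_hom_comp[OF comm_ring_hom_poly comm_ring_hom_poly])

interpretation eval2: comm_ring_hom "\<lambda>f. eval2 f a b" for a b
  by (rule comm_ring_hom_eval2)

lemma eval2_values [simp]: "eval2 (cst c) a b = c" "eval2 varx a b = a" "eval2 vary a b = b"
  by (simp_all add: eval2_def cst_def varx_def vary_def)

subsection \<open>Homogeneous components\<close>

lemma poly_poly_eqI: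
  "(\<And>i j. coeff (coeff f j) i = coeff (coeff g j) i) \<Longrightarrow> f = g"
  by (intro poly_eqI) auto

lemma coeff_mult2:
  "coeff (coeff (f * g) j) i = (\<Sum>k\<le>j. \<Sum>l\<le>i. coeff (coeff f k) l * coeff (coeff g (j - k)) (i - l))"
  by (simp add: coeff_mult coeff_sum)

lemma form_zero [simp]: "bihomogeneous d 0"
  by (simp add: bihomogeneous_def)

lemma form_add: "bihomogeneous d f \<Longrightarrow> bihomogeneous d g \<Longrightarrow> bihomogeneous d (f + g)"
  unfolding bihomogeneous_def by (metis add_0 coeff_add)

lemma form_uminus: "bihomogeneous d f \<Longrightarrow> bihomogeneous d (- f)"
  for f :: "'k :: comm_ring_1 poly poly"
  by (simp add: bihomogeneous_def)

lemma form_diff: "bihomogeneous d f \<Longrightarrow> bihomogeneous d g \<Longrightarrow> bihomogeneous d (f - g)"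
  for f g :: "'k :: comm_ring_1 poly poly"
  using form_add[of d f "- g"] form_uminus[of d g] by simp

lemma form_sum: "(\<And>x. x \<in> A \<Longrightarrow> bihomogeneous d (f x)) \<Longrightarrow> bihomogeneous d (sum f A)"
  by (induction A rule: infinite_finite_induct) (simp_all add: form_add)

lemma form_mult:
  fixes f g :: "'k :: comm_ring_1 poly poly"
  assumes "bihomogeneous d f" "bihomogeneous e g"
  shows "bihomogeneous (d + e) (f * g)"
  unfolding bihomogeneous_def
proof (intro allI impI)
  fix i j assume "coeff (coeff (f * g) j) i \<noteq> 0"
  then obtain k where k: "k \<le> j" "(\<Sum>l\<le>i. coeff (coeff f k) l * coeff (coeff g (j - k)) (i - l)) \<noteq> 0"
    unfolding coeff_mult2 by (meson atMost_iff sum.not_neutral_contains_not_neutral)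
  then obtain l where l: "l \<le> i" "coeff (coeff f k) l * coeff (coeff g (j - k)) (i - l) \<noteq> 0"
    by (meson atMost_iff sum.not_neutral_contains_not_neutral)
  then have "coeff (coeff f k) l \<noteq> 0" "coeff (coeff g (j - k)) (i - l) \<noteq> 0" by auto
  then have "l + k = d" "(i - l) + (j - k) = e" using assms by (auto simp: bihomogeneous_def)
  then show "i + j = d + e" using k l by linarith
qed

lemma form_const: "bihomogeneous 0 (cst c)"
  by (auto simp: bihomogeneous_def cst_def coeff_pCons split: nat.splits)

lemma form_one: "bihomogeneous 0 (1 :: 'k :: comm_ring_1 poly poly)"
  using form_const[of 1] by simp

lemma form_const_mult: "bihomogeneous d f \<Longrightarrow> bihomogeneous d (cst c * f)"
  using form_mult[OF form_const] by fastforce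

lemma form_X: "bihomogeneous 1 varx"
  by (auto simp: varx_def bihomogeneous_def coeff_pCons split: nat.splits)

lemma form_Y: "bihomogeneous 1 vary"
  by (auto simp: vary_def bihomogeneous_def coeff_pCons one_pCons split: nat.splits)

lemma form_power: "bihomogeneous d f \<Longrightarrow> bihomogeneous (n * d) (f ^ n)"
  for f :: "'k :: comm_ring_1 poly poly"
  by (induction n) (simp_all add: form_one form_mult)

lemma form_prod:
  "(\<And>x. x \<in> A \<Longrightarrow> bihomogeneous (d x) (f x)) \<Longrightarrow> bihomogeneous (sum d A) (prod f A)"
  for f :: "'b \<Rightarrow> 'k :: comm_ring_1 poly poly"
  by (induction A rule: infinite_finite_induct) (simp_all add: form_one form_mult)

lemma form_0_const:
  assumes "bihomogeneous 0 f"
  obtains c where "f = cst c"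
proof -
  have "f = cst (coeff (coeff f 0) 0)"
    by (rule poly_poly_eqI) (use assms in \<open>auto simp: bihomogeneous_def cst_def coeff_pCons split: nat.splits\<close>)
  then show thesis by (rule that)
qed

lemma form_degree_unique: "bihomogeneous d f \<Longrightarrow> bihomogeneous e f \<Longrightarrow> f \<noteq> 0 \<Longrightarrow> d = e"
  unfolding bihomogeneous_def by (metis leading_coeff_0_iff)

text \<open>The homogeneous component of degree \<open>n\<close>.\<close>

definition hcomp :: "nat \<Rightarrow> 'k :: comm_ring_1 poly poly \<Rightarrow> 'k poly poly" where
  "hcomp n f = (\<Sum>i\<le>n. monom (monom (coeff (coeff f (n - i)) i) i) (n - i))"

lemma coeff_hcomp: "coeff (coeff (hcomp n f) j) i = (if i + j = n then coeff (coeff f j) i else 0)"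
proof -
  have "coeff (coeff (hcomp n f) j) i =
      (\<Sum>k\<le>n. if k = i then if n - k = j then coeff (coeff f (n - k)) k else 0 else 0)"
    unfolding hcomp_def coeff_sum by (intro sum.cong) auto
  also have "\<dots> = (if i \<le> n then if n - i = j then coeff (coeff f (n - i)) i else 0 else 0)"
    by (simp add: sum.delta)
  finally show ?thesis by auto
qed

lemma form_hcomp: "bihomogeneous n (hcomp n f)"
  by (simp add: bihomogeneous_def coeff_hcomp)

lemma hcomp_form: "bihomogeneous n f \<Longrightarrow> hcomp n f = f"
  by (rule poly_poly_eqI) (auto simp: bihomogeneous_def coeff_hcomp)

lemma hcomp_form_other: "bihomogeneous m f \<Longrightarrow> m \<noteq> n \<Longrightarrow> hcomp n f = 0"
  by (rule poly_poly_eqI) (auto simp: bihomogeneous_def coeff_hcomp)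

lemma hcomp_mult_form:
  assumes g: "bihomogeneous e g"
  shows "hcomp (n + e) (f * g) = hcomp n f * g"
proof (rule poly_poly_eqI)
  fix i j
  show "coeff (coeff (hcomp (n + e) (f * g)) j) i = coeff (coeff (hcomp n f * g) j) i"
  proof (cases "i + j = n + e")
    case True
    have "coeff (coeff (hcomp n f) k) l * coeff (coeff g (j - k)) (i - l) =
        coeff (coeff f k) l * coeff (coeff g (j - k)) (i - l)" if "k \<le> j" "l \<le> i" for k l
    proof (cases "coeff (coeff g (j - k)) (i - l) = 0")
      case False
      then have "(i - l) + (j - k) = e" using g by (simp add: bihomogeneous_def)
      then have "l + k = n" using True that by linarith
      then show ?thesis by (simp add: coeff_hcomp)
    qed simp
    then have "(\<Sum>k\<le>j. \<Sum>l\<le>i. coeff (coeff (hcomp n f) k) l * coeff (coeff g (j - k)) (i - l)) =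
        (\<Sum>k\<le>j. \<Sum>l\<le>i. coeff (coeff f k) l * coeff (coeff g (j - k)) (i - l))"
      by (intro sum.cong) auto
    then show ?thesis using True by (simp only: coeff_hcomp[of "n + e"] coeff_mult2) simp
  next
    case False
    then have "coeff (coeff (hcomp n f * g) j) i = 0"
      using form_mult[OF form_hcomp g] by (auto simp: bihomogeneous_def)
    then show ?thesis using False by (simp add: coeff_hcomp)
  qed
qed

lemma form_quotient:
  fixes f g :: "'k :: idom poly poly"
  assumes fg: "bihomogeneous d (f * g)" and g: "bihomogeneous e g" "g \<noteq> 0"
  shows "bihomogeneous (d - e) f"
  unfolding bihomogeneous_def
proof (intro allI impI)
  fix i j assume ij: "coeff (coeff f j) i \<noteq> 0"
  then have "hcomp (i + j) f \<noteq> 0" by (metis coeff_hcomp coeff_0)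
  then have "hcomp (i + j + e) (f * g) \<noteq> 0" using g by (simp add: hcomp_mult_form)
  then have "d = i + j + e" using hcomp_form_other[OF fg] by blast
  then show "i + j = d - e" by simp
qed

subsection \<open>Linear forms\<close>

text \<open>The linear form that vanishes at the point \<open>(a : b)\<close>.\<close>

definition lin :: "'k :: comm_ring_1 \<Rightarrow> 'k \<Rightarrow> 'k poly poly" where
  "lin a b = cst b * varx - cst a * vary"

lemma lin_eq: "lin a b = [:[:0, b:], [:- a:]:]"
  by (simp add: lin_def cst_def varx_def vary_def)

lemma form_lin: "bihomogeneous 1 (lin a b)"
  unfolding lin_def using form_diff[OF form_const_mult[OF form_X] form_const_mult[OF form_Y]] by simp

lemma lin_nonzero: "(a, b) \<noteq> (0, 0) \<Longrightarrow> lin a b \<noteq> 0"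
  by (auto simp: lin_eq)

lemma eval2_lin: "eval2 (lin a b) c e = b * c - a * e"
  by (simp add: lin_def eval2.hom_minus eval2.hom_mult)

text \<open>Restriction to the line \<open>{(t a, t b)}\<close> through the origin, with \<open>t\<close> as the polynomial variable.\<close>

definition restrict_line :: "'k :: comm_ring_1 \<Rightarrow> 'k \<Rightarrow> 'k poly poly \<Rightarrow> 'k poly" where
  "restrict_line a b = ev2 (\<lambda>c. [:c:]) [:0, a:] [:0, b:]"

interpretation restrict_line: comm_ring_hom "restrict_line a b" for a b
  unfolding restrict_line_def by (intro comm_ring_hom_ev2 comm_ring_hom_poly_const)

lemma restrict_line_values [simp]:
  "restrict_line a b (cst c) = [:c:]" "restrict_line a b varx = [:0, a:]" "restrict_line a b vary = [:0, b:]"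
  unfolding restrict_line_def by (simp_all only: ev2_values[OF comm_ring_hom_poly_const])

text \<open>Modulo \<open>lin a b\<close> every polynomial is congruent to its restriction to the line, after a coordinate is
  substituted for the parameter of the line.\<close>

lemma lin_dvd_iff:
  fixes a b :: "'k :: field"
  assumes "(a, b) \<noteq> (0, 0)"
  shows "lin a b dvd f \<longleftrightarrow> restrict_line a b f = 0"
proof
  assume "lin a b dvd f"
  then obtain h where "f = lin a b * h" by (elim dvdE)
  moreover have "restrict_line a b (lin a b) = 0"
    by (simp add: lin_def restrict_line.hom_minus restrict_line.hom_mult)
  ultimately show "restrict_line a b f = 0" by (simp add: restrict_line.hom_mult)
next
  assume 0: "restrict_line a b f = 0"
  define w where "w = (if b = 0 then cst (1 / a) * varx else cst (1 / b) * vary)"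
  define \<psi> where "\<psi> = (\<lambda>p. poly (map_poly cst p) w)"
  have \<psi>: "comm_ring_hom \<psi>" unfolding \<psi>_def by (intro comm_ring_hom_poly_map comm_ring_hom_C)
  interpret \<psi>: comm_ring_hom \<psi> by (rule \<psi>)
  have "lin a b dvd f - \<psi> (restrict_line a b f)"
  proof (rule hom_cong[OF comm_ring_hom_ident comm_ring_hom_comp[OF \<psi> restrict_line.comm_ring_hom_axioms]])
    show "cst c = \<psi> (restrict_line a b (cst c))" for c by (simp add: \<psi>_def map_poly_pCons)
    have \<psi>l: "\<psi> [:0, c:] = cst c * w" for c by (simp add: \<psi>_def map_poly_pCons)
    show "lin a b dvd varx - \<psi> (restrict_line a b varx)"
    proof (cases "b = 0")
      case True
      have "cst a * cst (1 / a) = 1" using True assms by (simp flip: cst.hom_mult)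
      then show ?thesis using True by (simp add: \<psi>l w_def flip: mult.assoc)
    next
      case False
      have "cst b * cst (1 / b) = 1" using False by (simp flip: cst.hom_mult)
      then have "cst (1 / b) * (cst b * varx) = varx" by (metis mult.commute mult.left_commute mult.right_neutral)
      then have "varx - \<psi> (restrict_line a b varx) = cst (1 / b) * lin a b"
        using False by (simp add: \<psi>l w_def lin_def right_diff_distrib ac_simps)
      then show ?thesis by simp
    qed
    show "lin a b dvd vary - \<psi> (restrict_line a b vary)"
    proof (cases "b = 0")
      case True
      have "cst a * cst (1 / a) = 1" using True assms by (simp flip: cst.hom_mult)
      then have "cst (1 / a) * (cst a * vary) = vary" by (metis mult.commute mult.left_commute mult.right_neutral)
      then have "vary - \<psi> (restrict_line a b vary) = - (cst (1 / a) * lin a b)"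
        using True by (simp add: \<psi>l w_def lin_def)
      then show ?thesis by simp
    next
      case False
      have "cst b * cst (1 / b) = 1" using False by (simp flip: cst.hom_mult)
      then show ?thesis using False by (simp add: \<psi>l w_def flip: mult.assoc)
    qed
  qed
  then show "lin a b dvd f" using 0 by simp
qed

lemma lin_prime:
  fixes a b :: "'k :: field"
  assumes ab: "(a, b) \<noteq> (0, 0)" and "lin a b dvd f * g"
  shows "lin a b dvd f \<or> lin a b dvd g"
  using assms(2) unfolding lin_dvd_iff[OF ab] by (simp add: restrict_line.hom_mult)

lemma lin_not_unit:
  fixes a b :: "'k :: field"
  assumes "(a, b) \<noteq> (0, 0)"
  shows "\<not> lin a b dvd 1"
  unfolding lin_dvd_iff[OF assms] by simp

lemma form_expand:
  assumes "bihomogeneous d f"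
  shows "f = (\<Sum>i\<le>d. cst (coeff (coeff f (d - i)) i) * varx ^ i * vary ^ (d - i))"
proof -
  have "monom (monom c i) j = cst c * varx ^ i * vary ^ j" for c :: 'a and i j
  proof -
    have "varx ^ i = [:monom 1 i :: 'a poly:]"
      by (induction i) (simp_all add: monom_Suc one_pCons monom_0 varx_def)
    moreover have "vary ^ j = monom (1 :: 'a poly) j"
      by (induction j) (simp_all add: monom_Suc monom_0 vary_def)
    ultimately show ?thesis by (simp add: smult_monom cst_def)
  qed
  then show ?thesis using hcomp_form[OF assms] unfolding hcomp_def by simp
qed

lemma form_hom_scale:
  fixes f :: "'k :: comm_ring_1 poly poly" and \<kappa> :: "'k \<Rightarrow> 'r :: comm_ring_1"
  assumes f: "bihomogeneous d f" and \<kappa>: "comm_ring_hom \<kappa>"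
  shows "ev2 \<kappa> (z * a) (z * b) f = z ^ d * ev2 \<kappa> a b f"
proof -
  interpret ev: comm_ring_hom "ev2 \<kappa> u v" for u v by (intro comm_ring_hom_ev2 \<kappa>)
  define c where "c = (\<lambda>i. coeff (coeff f (d - i)) i)"
  have f_eq: "f = (\<Sum>i\<le>d. cst (c i) * varx ^ i * vary ^ (d - i))"
    unfolding c_def by (rule form_expand[OF f])
  have ev: "ev2 \<kappa> u v f = (\<Sum>i\<le>d. \<kappa> (c i) * u ^ i * v ^ (d - i))" for u v
    by (subst f_eq) (simp only: ev.hom_sum ev.hom_mult ev.hom_power ev2_values[OF \<kappa>])
  have "\<kappa> (c i) * (z * a) ^ i * (z * b) ^ (d - i) = z ^ d * (\<kappa> (c i) * a ^ i * b ^ (d - i))"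
    if "i \<le> d" for i
  proof -
    have "z ^ d = z ^ i * z ^ (d - i)" using that by (simp flip: power_add)
    then show ?thesis by (simp only: power_mult_distrib ac_simps)
  qed
  then show ?thesis unfolding ev sum_distrib_left by (intro sum.cong) auto
qed

lemma eval2_eq_ev2: "eval2 f a b = ev2 (\<lambda>c. c) a b f"
  by (rule hom_ext[OF comm_ring_hom_eval2 comm_ring_hom_ev2[OF comm_ring_hom_ident]])
    (simp_all only: ev2_values[OF comm_ring_hom_ident] eval2_values)

lemma form_eval2_scale: "bihomogeneous d f \<Longrightarrow> eval2 f (c * a) (c * b) = c ^ d * eval2 f a b"
  unfolding eval2_eq_ev2 by (rule form_hom_scale[OF _ comm_ring_hom_ident])

lemma form_restrict_line:
  assumes "bihomogeneous d f"
  shows "restrict_line a b f = monom (eval2 f a b) d"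
proof -
  have "restrict_line a b f = ev2 (\<lambda>c. [:c:]) ([:0, 1:] * [:a:]) ([:0, 1:] * [:b:]) f"
    by (simp add: restrict_line_def)
  also have "\<dots> = [:0, 1:] ^ d * ev2 (\<lambda>c. [:c:]) [:a:] [:b:] f"
    by (rule form_hom_scale[OF assms comm_ring_hom_poly_const])
  also have "ev2 (\<lambda>c. [:c:]) [:a:] [:b:] f = [:eval2 f a b:]"
    by (rule hom_ext[OF comm_ring_hom_ev2[OF comm_ring_hom_poly_const]
          comm_ring_hom_comp[OF comm_ring_hom_poly_const comm_ring_hom_eval2]])
      (simp_all only: ev2_values[OF comm_ring_hom_poly_const] eval2_values)
  also have "[:0, 1:] ^ d * [:eval2 f a b:] = monom (eval2 f a b) d"
    by (simp add: monom_altdef)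
  finally show ?thesis .
qed

lemma form_lin_dvd_iff:
  fixes a b :: "'k :: field"
  assumes "bihomogeneous d f" "(a, b) \<noteq> (0, 0)"
  shows "lin a b dvd f \<longleftrightarrow> eval2 f a b = 0"
  by (simp add: lin_dvd_iff[OF assms(2)] form_restrict_line[OF assms(1)])

lemma form_root_factor:
  fixes a b :: "'k :: field"
  assumes f: "bihomogeneous d f" and ab: "(a, b) \<noteq> (0, 0)" and "eval2 f a b = 0"
  obtains f' where "f = lin a b * f'" "bihomogeneous (d - 1) f'"
proof -
  obtain f' where f': "f = lin a b * f'"
    using assms form_lin_dvd_iff[OF f ab] by (auto elim: dvdE)
  then have "bihomogeneous (d - 1) f'"
    by (intro form_quotient[of d f' "lin a b" 1] form_lin lin_nonzero[OF ab]) (use f in \<open>simp add: mult.commute\<close>)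
  with f' show thesis by (rule that)
qed

text \<open>Each point of the projective line has exactly one such representative. Fixing representatives turns proportionality
  of points into equality.\<close>

definition normal_pt :: "'k :: {zero, one} \<Rightarrow> 'k \<Rightarrow> bool" where
  "normal_pt a b \<longleftrightarrow> b = 1 \<or> a = 1 \<and> b = 0"

lemma normal_pt_nonzero: "normal_pt a b \<Longrightarrow> (a, b) \<noteq> (0, 0)"
  for a b :: "'k :: zero_neq_one"
  by (auto simp: normal_pt_def)

lemma eval2_lin_normal:
  fixes a b c e :: "'k :: field"
  assumes "normal_pt a b" "normal_pt c e"
  shows "eval2 (lin a b) c e = 0 \<longleftrightarrow> (a, b) = (c, e)"
  using assms by (auto simp: normal_pt_def eval2_lin)

lemma form_has_root:
  fixes f :: "'k :: alg_closed_field poly poly"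
  assumes f: "bihomogeneous d f" and d: "0 < d"
  obtains a b where "normal_pt a b" "eval2 f a b = 0"
proof (cases "\<exists>a. eval2 f a 1 = 0")
  case True
  then obtain a where "eval2 f a 1 = 0" by blast
  then show thesis using that[of a 1] by (simp add: normal_pt_def)
next
  case False
  define p where "p = poly f [:1:]"
  have "poly p a \<noteq> 0" for a using False by (simp add: p_def eval2_def)
  then have "Polynomial.degree p = 0" using alg_closed_imp_poly_has_root[of p] by blast
  have "coeff p d = (\<Sum>j\<le>Polynomial.degree f. coeff (coeff f j) d)"
    by (simp add: p_def poly_altdef coeff_sum one_pCons[symmetric])
  also have "\<dots> = (\<Sum>j\<le>Polynomial.degree f. if j = 0 then coeff (coeff f 0) d else 0)"
  proof (intro sum.cong refl)
    fix j
    show "coeff (coeff f j) d = (if j = 0 then coeff (coeff f 0) d else 0)"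
      using f unfolding bihomogeneous_def by (cases "j = 0") fastforce+
  qed
  finally have "coeff (coeff f 0) d = 0"
    using \<open>Polynomial.degree p = 0\<close> d by (simp add: coeff_eq_0)
  have "eval2 f 1 0 = (\<Sum>i\<le>d. coeff (coeff f (d - i)) i * 0 ^ (d - i))"
    by (subst form_expand[OF f]) (simp add: eval2.hom_sum eval2.hom_mult eval2.hom_power)
  also have "\<dots> = (\<Sum>i\<le>d. if i = d then coeff (coeff f 0) d else 0)"
    by (intro sum.cong) auto
  finally have "eval2 f 1 0 = 0" using \<open>coeff (coeff f 0) d = 0\<close> by simp
  then show thesis using that[of 1 0] by (simp add: normal_pt_def)
qed

lemma form_induct [consumes 2, case_names const lin]:
  fixes f :: "'k :: alg_closed_field poly poly"
  assumes "bihomogeneous d f" "f \<noteq> 0"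
    and const: "\<And>c. c \<noteq> 0 \<Longrightarrow> P 0 (cst c)"
    and lin: "\<And>a b d f. (a, b) \<noteq> (0, 0) \<Longrightarrow> bihomogeneous d f \<Longrightarrow> f \<noteq> 0 \<Longrightarrow>
      normal_pt a b \<Longrightarrow> P d f \<Longrightarrow> P (Suc d) (lin a b * f)"
  shows "P d f"
  using assms(1,2)
proof (induction d arbitrary: f)
  case 0
  then obtain c where "f = cst c" by (auto elim: form_0_const)
  then show ?case using 0 const[of c] by auto
next
  case (Suc d)
  obtain a b where n: "normal_pt a b" and "eval2 f a b = 0"
    using form_has_root[OF Suc.prems(1)] by blast
  then have ab: "(a, b) \<noteq> (0, 0)" "eval2 f a b = 0" using normal_pt_nonzero[OF n] by blast+
  obtain f' where f': "f = lin a b * f'" "bihomogeneous (Suc d - 1) f'"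
    by (rule form_root_factor[OF Suc.prems(1) ab])
  have "f' \<noteq> 0" using f' Suc.prems(2) by auto
  then show ?case using f' ab Suc.IH[of f'] lin[OF ab(1), of d f'] n by simp
qed

text \<open>Divisors of a form are forms. As a form over an algebraically closed field is a product of linear forms, which
  are prime, this follows by distributing the linear factors among the two factors.\<close>

lemma form_divisor:
  fixes f :: "'k :: alg_closed_field poly poly"
  assumes "bihomogeneous d f" "f \<noteq> 0" "c dvd f"
  obtains i where "bihomogeneous i c" "c \<noteq> 0" "i \<le> d"
proof -
  have "\<forall>c c'. f = c * c' \<longrightarrow> (\<exists>i\<le>d. bihomogeneous i c)"
    using assms(1,2)
  proof (induction rule: form_induct)
    case (const k)
    show ?case
    proof (intro allI impI)
      fix c c' assume "cst k = c * c'"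
      then have "c dvd cst k" by simp
      moreover have "cst k dvd 1" using const by (intro cst_dvd_1)
      ultimately have "c dvd 1" by (rule dvd_trans)
      then obtain p where "c = [:p:]" "p dvd 1" unfolding is_unit_poly_iff by blast
      then obtain k' where "c = cst k'" unfolding is_unit_poly_iff cst_def by blast
      then show "\<exists>i\<le>0. bihomogeneous i c" using form_const by blast
    qed
  next
    case (lin a b d f)
    show ?case
    proof (intro allI impI)
      fix c c' assume eq: "lin a b * f = c * c'"
      then have "lin a b dvd c * c'" by (metis dvd_triv_left)
      then consider "lin a b dvd c" | "lin a b dvd c'" using lin_prime[OF lin(1)] by blast
      then show "\<exists>i\<le>Suc d. bihomogeneous i c"
      proof cases
        case 1
        then obtain c1 where c1: "c = lin a b * c1" by (elim dvdE)
        then have "f = c1 * c'" using eq lin_nonzero[OF lin(1)] by (simp add: mult.assoc)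
        then obtain i where "i \<le> d" "bihomogeneous i c1" using lin.IH by blast
        then show ?thesis using c1 form_mult[OF form_lin, of i c1 a b] by (intro exI[of _ "Suc i"]) simp
      next
        case 2
        then obtain c1 where c1: "c' = lin a b * c1" by (elim dvdE)
        then have "f = c * c1" using eq lin_nonzero[OF lin(1)] by (simp add: mult.left_commute)
        then obtain i where "i \<le> d" "bihomogeneous i c" using lin.IH by blast
        then show ?thesis by (intro exI[of _ i]) simp
      qed
    qed
  qed
  moreover obtain c' where "f = c * c'" using assms(3) by (elim dvdE)
  ultimately show thesis using assms(2) that by auto
qed

subsection \<open>Germs\<close>

text \<open>The expansion of a polynomial at \<open>(a, b)\<close> along a direction transversal to the line through \<open>(a, b)\<close>: along \<open>x\<close>
  if \<open>b \<noteq> 0\<close> and along \<open>y\<close> otherwise. On forms its order is the order of vanishing at the point \<open>(a : b)\<close> of the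
  projective line.\<close>

definition germ :: "'k :: field \<Rightarrow> 'k \<Rightarrow> 'k poly poly \<Rightarrow> 'k fps" where
  "germ a b = ev2 fps_const
     (fps_const a + fps_const (if b = 0 then 0 else 1) * fps_X)
     (fps_const b + fps_const (if b = 0 then 1 else 0) * fps_X)"

interpretation germ: comm_ring_hom "germ a b" for a b
  unfolding germ_def by (intro comm_ring_hom_ev2 comm_ring_hom_fps_const)

lemma germ_cst [simp]: "germ a b (cst c) = fps_const c"
  and germ_varx: "germ a b varx = fps_const a + fps_const (if b = 0 then 0 else 1) * fps_X"
  and germ_vary: "germ a b vary = fps_const b + fps_const (if b = 0 then 1 else 0) * fps_X"
  unfolding germ_def by (simp_all only: ev2_values[OF comm_ring_hom_fps_const])

lemma germ_nth_0: "fps_nth (germ a b f) 0 = eval2 f a b"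
proof -
  have "comm_ring_hom (\<lambda>f. fps_nth (germ a b f) 0)"
    by unfold_locales (simp_all add: germ.hom_add germ.hom_mult)
  from hom_ext[OF this comm_ring_hom_eval2] show ?thesis
    by (simp add: germ_varx germ_vary)
qed

lemma germ_lin:
  "germ a b (lin c e) = fps_const (e * a - c * b) +
    fps_const (e * (if b = 0 then 0 else 1) - c * (if b = 0 then 1 else 0)) * fps_X"
  unfolding lin_def germ.hom_minus germ.hom_mult germ_cst germ_varx germ_vary
  by (rule fps_ext) (simp add: fps_X_def algebra_simps)

lemma germ_lin_order:
  assumes "(a, b) \<noteq> (0, 0)" "(c, e) \<noteq> (0, 0)"
  shows "has_order (if e * a = c * b then 1 else 0) (germ a b (lin c e))"
proof (cases "e * a = c * b")
  case True
  then have "e * (if b = 0 then 0 else 1) - c * (if b = 0 then 1 else 0) \<noteq> 0" using assms by auto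
  then show ?thesis using True by (simp add: germ_lin has_order_def)
next
  case False
  then show ?thesis by (simp add: germ_lin has_order_def)
qed

lemma germ_nonzero:
  fixes f :: "'k :: alg_closed_field poly poly"
  assumes "bihomogeneous d f" "f \<noteq> 0" "(a, b) \<noteq> (0, 0)"
  shows "germ a b f \<noteq> 0"
  using assms(1,2)
proof (induction rule: form_induct)
  case (lin c e d f)
  then show ?case using has_order_imp_nonzero[OF germ_lin_order[OF assms(3) lin(1)]] by (simp add: germ.hom_mult)
qed simp

text \<open>Divisibility of forms is a local question: the linear factors of \<open>f\<close> are cancelled one after the other, each at
  its own zero.\<close>

lemma form_dvdI:
  fixes f h :: "'k :: alg_closed_field poly poly"
  assumes "bihomogeneous d f" "f \<noteq> 0" "bihomogeneous m h"
    and "\<And>a b. normal_pt a b \<Longrightarrow> germ a b f dvd germ a b h"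
  shows "f dvd h"
  using assms
proof (induction arbitrary: h m rule: form_induct)
  case (const c)
  then have "cst c dvd 1" by (intro cst_dvd_1)
  then show ?case by (rule unit_imp_dvd)
next
  case (lin a b d f)
  have "germ a b (lin a b) dvd germ a b h"
    using lin.prems(2)[OF lin(4)] by (simp add: germ.hom_mult dvd_mult_left)
  then have "fps_X ^ 1 dvd germ a b h"
    using has_order_dvd_iff[OF germ_lin_order[OF lin(1) lin(1)]] by (simp add: mult.commute)
  then have "eval2 h a b = 0" unfolding germ_nth_0[symmetric] fps_X_power_dvd_iff by simp
  then obtain h' where h': "h = lin a b * h'" "bihomogeneous (m - 1) h'"
    by (rule form_root_factor[OF lin.prems(1) lin(1)])
  have "germ c e f dvd germ c e h'" if "normal_pt c e" for c e
    using lin.prems(2)[OF that] has_order_imp_nonzero[OF germ_lin_order[OF normal_pt_nonzero[OF that] lin(1)]]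
    by (simp add: h' germ.hom_mult)
  then have "f dvd h'" by (rule lin.IH[OF h'(2)])
  then show ?case using h' by simp
qed

subsection \<open>Zeros\<close>

lemma finite_affine_roots:
  fixes f :: "'k :: alg_closed_field poly poly"
  assumes "bihomogeneous d f" "f \<noteq> 0"
  shows "finite {a. eval2 f a 1 = 0}"
  using assms
proof (induction rule: form_induct)
  case (lin c e d f)
  have "{a. e * a = c} \<subseteq> {c / e}" using lin(1) by (cases "e = 0") (auto simp: field_simps)
  then have "finite {a. e * a = c}" by (rule finite_subset) simp
  moreover have "{a. eval2 (lin c e * f) a 1 = 0} = {a. e * a = c} \<union> {a. eval2 f a 1 = 0}"
    by (auto simp: eval2.hom_mult eval2_lin)
  ultimately show ?case using lin by simp
qed simp

lemma form_eq_0I: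
  fixes f :: "'k :: {alg_closed_field, field_char_0} poly poly"
  assumes "bihomogeneous d f" "\<And>a b. (a, b) \<noteq> (0, 0) \<Longrightarrow> eval2 f a b = 0"
  shows "f = 0"
proof (rule ccontr)
  assume "f \<noteq> 0"
  with assms(1) have "finite {a. eval2 f a 1 = 0}" by (rule finite_affine_roots)
  moreover have "{a. eval2 f a 1 = 0} = UNIV" using assms(2) by auto
  ultimately show False using infinite_UNIV_char_0 by metis
qed

section \<open>Evaluation of polynomials in many variables\<close>

definition mono_val :: "(nat \<Rightarrow> 'r :: comm_ring_1) \<Rightarrow> (nat \<Rightarrow>\<^sub>0 nat) \<Rightarrow> 'r" where
  "mono_val \<gamma> m = (\<Prod>i\<in>Poly_Mapping.keys m. \<gamma> i ^ Poly_Mapping.lookup m i)"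

text \<open>The homomorphism on polynomials that is given by \<open>\<kappa>\<close> on the coefficients and sends the \<open>i\<close>-th variable to \<open>\<gamma> i\<close>.
  It covers the evaluation at points, the substitution of the forms \<open>g\<close> and the expansion along a branch.\<close>

definition mev :: "('k :: comm_ring_1 \<Rightarrow> 'r :: comm_ring_1) \<Rightarrow> (nat \<Rightarrow> 'r) \<Rightarrow> 'k mpol \<Rightarrow> 'r" where
  "mev \<kappa> \<gamma> F = (\<Sum>m\<in>Poly_Mapping.keys F. \<kappa> (Poly_Mapping.lookup F m) * mono_val \<gamma> m)"

lemma mono_val_superset:
  assumes "finite A" "Poly_Mapping.keys m \<subseteq> A"
  shows "mono_val \<gamma> m = (\<Prod>i\<in>A. \<gamma> i ^ Poly_Mapping.lookup m i)"
  unfolding mono_val_def using assms by (intro prod.mono_neutral_left) (auto simp: in_keys_iff)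

lemma mono_val_add: "mono_val \<gamma> (m + m') = mono_val \<gamma> m * mono_val \<gamma> m'"
proof -
  let ?A = "Poly_Mapping.keys m \<union> Poly_Mapping.keys m'"
  have "mono_val \<gamma> (m + m') = (\<Prod>i\<in>?A. \<gamma> i ^ Poly_Mapping.lookup (m + m') i)"
    using Poly_Mapping.keys_add[of m m'] by (intro mono_val_superset) auto
  also have "\<dots> = (\<Prod>i\<in>?A. \<gamma> i ^ Poly_Mapping.lookup m i) * (\<Prod>i\<in>?A. \<gamma> i ^ Poly_Mapping.lookup m' i)"
    by (simp add: lookup_add power_add prod.distrib)
  also have "\<dots> = mono_val \<gamma> m * mono_val \<gamma> m'"
    by (simp add: mono_val_superset[of ?A])
  finally show ?thesis .
qed

lemma mono_val_zero [simp]: "mono_val \<gamma> 0 = 1"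
  by (simp add: mono_val_def)

definition mono_deg :: "(nat \<Rightarrow>\<^sub>0 nat) \<Rightarrow> nat" where
  "mono_deg m = (\<Sum>i\<in>Poly_Mapping.keys m. Poly_Mapping.lookup m i)"

lemma mono_deg_superset:
  assumes "finite A" "Poly_Mapping.keys m \<subseteq> A"
  shows "mono_deg m = (\<Sum>i\<in>A. Poly_Mapping.lookup m i)"
  unfolding mono_deg_def using assms by (intro sum.mono_neutral_left) (auto simp: in_keys_iff)

lemma mono_deg_add: "mono_deg (m + m') = mono_deg m + mono_deg m'"
proof -
  let ?A = "Poly_Mapping.keys m \<union> Poly_Mapping.keys m'"
  have "mono_deg (m + m') = (\<Sum>i\<in>?A. Poly_Mapping.lookup (m + m') i)"
    using Poly_Mapping.keys_add[of m m'] by (intro mono_deg_superset) auto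
  also have "\<dots> = mono_deg m + mono_deg m'"
    by (simp add: lookup_add sum.distrib mono_deg_superset[of ?A])
  finally show ?thesis .
qed

lemma form_in_iff:
  "form_in n e F \<longleftrightarrow> (\<forall>m\<in>Poly_Mapping.keys F. Poly_Mapping.keys m \<subseteq> {..<n} \<and> mono_deg m = e)"
  by (simp add: form_in_def mono_deg_def)

lemma mev_superset:
  assumes "comm_ring_hom \<kappa>" "finite A" "Poly_Mapping.keys F \<subseteq> A"
  shows "mev \<kappa> \<gamma> F = (\<Sum>m\<in>A. \<kappa> (Poly_Mapping.lookup F m) * mono_val \<gamma> m)"
proof -
  interpret comm_ring_hom \<kappa> by (rule assms)
  show ?thesis
    unfolding mev_def using assms by (intro sum.mono_neutral_left) (auto simp: in_keys_iff)
qed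

lemma mev_add:
  assumes "comm_ring_hom \<kappa>"
  shows "mev \<kappa> \<gamma> (F + G) = mev \<kappa> \<gamma> F + mev \<kappa> \<gamma> G"
proof -
  interpret comm_ring_hom \<kappa> by (rule assms)
  let ?A = "Poly_Mapping.keys F \<union> Poly_Mapping.keys G"
  have "mev \<kappa> \<gamma> (F + G) = (\<Sum>m\<in>?A. \<kappa> (Poly_Mapping.lookup (F + G) m) * mono_val \<gamma> m)"
    using Poly_Mapping.keys_add[of F G] by (intro mev_superset assms) auto
  then show ?thesis
    by (simp add: mev_superset[OF assms, of ?A] lookup_add hom_add sum.distrib algebra_simps)
qed

lemma mev_single:
  assumes "comm_ring_hom \<kappa>"
  shows "mev \<kappa> \<gamma> (Poly_Mapping.single m c) = \<kappa> c * mono_val \<gamma> m"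
proof -
  interpret comm_ring_hom \<kappa> by (rule assms)
  show ?thesis
    by (subst mev_superset[OF assms, of "{m}"]) (auto simp: in_keys_iff lookup_single when_def)
qed

lemma mpol_sum_monomials:
  "F = (\<Sum>m\<in>Poly_Mapping.keys F. Poly_Mapping.single m (Poly_Mapping.lookup F m))"
  for F :: "'k :: comm_ring_1 mpol"
proof (rule poly_mapping_eqI)
  fix k
  have "(\<Sum>m\<in>Poly_Mapping.keys F. Poly_Mapping.lookup (Poly_Mapping.single m (Poly_Mapping.lookup F m)) k) =
      (\<Sum>m\<in>Poly_Mapping.keys F. if m = k then Poly_Mapping.lookup F k else 0)"
    by (intro sum.cong) (auto simp: lookup_single when_def)
  then show "Poly_Mapping.lookup F k =
      Poly_Mapping.lookup (\<Sum>m\<in>Poly_Mapping.keys F. Poly_Mapping.single m (Poly_Mapping.lookup F m)) k"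
    by (simp add: lookup_sum in_keys_iff)
qed

lemma mev_sum:
  assumes "comm_ring_hom \<kappa>"
  shows "mev \<kappa> \<gamma> (sum f A) = (\<Sum>x\<in>A. mev \<kappa> \<gamma> (f x))"
proof -
  have "mev \<kappa> \<gamma> 0 = 0" by (simp add: mev_def)
  then show ?thesis by (induction A rule: infinite_finite_induct) (simp_all add: mev_add[OF assms])
qed

lemma comm_ring_hom_mev:
  assumes "comm_ring_hom \<kappa>"
  shows "comm_ring_hom (mev \<kappa> \<gamma>)"
proof -
  interpret \<kappa>: comm_ring_hom \<kappa> by (rule assms)
  have mult: "mev \<kappa> \<gamma> (F * G) = mev \<kappa> \<gamma> F * mev \<kappa> \<gamma> G" for F G
  proof -
    define s where "s = (\<lambda>F m. Poly_Mapping.single m (Poly_Mapping.lookup F m) :: 'a mpol)"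
    have s: "F = (\<Sum>m\<in>Poly_Mapping.keys F. s F m)" for F
      unfolding s_def by (rule mpol_sum_monomials)
    have s_mult: "mev \<kappa> \<gamma> (s F m * s G m') = mev \<kappa> \<gamma> (s F m) * mev \<kappa> \<gamma> (s G m')" for m m'
      by (simp add: s_def mult_single mev_single[OF assms] mono_val_add \<kappa>.hom_mult ac_simps)
    have "F * G = (\<Sum>m\<in>Poly_Mapping.keys F. \<Sum>m'\<in>Poly_Mapping.keys G. s F m * s G m')"
      by (subst (1) s[of F], subst (1) s[of G]) (simp add: sum_product)
    then have "mev \<kappa> \<gamma> (F * G) =
        (\<Sum>m\<in>Poly_Mapping.keys F. \<Sum>m'\<in>Poly_Mapping.keys G. mev \<kappa> \<gamma> (s F m) * mev \<kappa> \<gamma> (s G m'))"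
      by (simp add: mev_sum[OF assms] s_mult)
    also have "\<dots> = mev \<kappa> \<gamma> (\<Sum>m\<in>Poly_Mapping.keys F. s F m) * mev \<kappa> \<gamma> (\<Sum>m\<in>Poly_Mapping.keys G. s G m)"
      by (simp add: mev_sum[OF assms] sum_product)
    finally show ?thesis by (simp flip: s)
  qed
  have one: "mev \<kappa> \<gamma> 1 = 1"
    using mev_single[OF assms, of \<gamma> 0 1] by simp
  show ?thesis
    by unfold_locales (simp_all add: mult one mev_add[OF assms] mev_def[of _ _ 0])
qed

lemma mev_hom:
  assumes "comm_ring_hom h"
  shows "h (mev \<kappa> \<gamma> F) = mev (\<lambda>c. h (\<kappa> c)) (\<lambda>i. h (\<gamma> i)) F"
proof -
  interpret comm_ring_hom h by (rule assms)
  show ?thesis by (simp add: mev_def mono_val_def hom_sum hom_mult hom_prod hom_power)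
qed

lemma mono_val_cong:
  "Poly_Mapping.keys m \<subseteq> {..<n} \<Longrightarrow> (\<And>i. i < n \<Longrightarrow> \<gamma> i = \<gamma>' i) \<Longrightarrow> mono_val \<gamma> m = mono_val \<gamma>' m"
  unfolding mono_val_def by (intro prod.cong) auto

lemma mev_cong:
  assumes "form_in n e F" "\<And>i. i < n \<Longrightarrow> \<gamma> i = \<gamma>' i"
  shows "mev \<kappa> \<gamma> F = mev \<kappa> \<gamma>' F"
  unfolding mev_def using assms mono_val_cong[of _ n \<gamma> \<gamma>']
  by (intro sum.cong) (auto simp: form_in_iff)

lemma mono_val_scale: "mono_val (\<lambda>i. z * \<gamma> i) m = z ^ mono_deg m * mono_val \<gamma> m"
  by (simp add: mono_val_def mono_deg_def power_mult_distrib prod.distrib power_sum)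

lemma mev_scale:
  assumes "form_in n e F"
  shows "mev \<kappa> (\<lambda>i. z * \<gamma> i) F = z ^ e * mev \<kappa> \<gamma> F"
  unfolding mev_def sum_distrib_left using assms
  by (intro sum.cong) (auto simp: form_in_iff mono_val_scale ac_simps)

lemma dvd_diff_mult:
  "r dvd a - a' \<Longrightarrow> r dvd b - b' \<Longrightarrow> r dvd a * b - a' * b'" for r :: "'a :: comm_ring_1"
proof -
  assume "r dvd a - a'" "r dvd b - b'"
  moreover have "a * b - a' * b' = (a - a') * b + a' * (b - b')" by (simp add: algebra_simps)
  ultimately show ?thesis by simp
qed

lemma dvd_diff_power: "r dvd a - a' \<Longrightarrow> r dvd a ^ k - a' ^ k" for r :: "'a :: comm_ring_1"
  by (induction k) (simp_all add: dvd_diff_mult)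

lemma dvd_diff_prod:
  "(\<And>i. i \<in> A \<Longrightarrow> r dvd f i - f' i) \<Longrightarrow> r dvd prod f A - prod f' A" for r :: "'a :: comm_ring_1"
  by (induction A rule: infinite_finite_induct) (simp_all add: dvd_diff_mult)

lemma mev_dvd_diff:
  assumes "form_in n e F" "\<And>i. i < n \<Longrightarrow> r dvd \<gamma> i - \<gamma>' i"
  shows "r dvd mev \<kappa> \<gamma> F - mev \<kappa> \<gamma>' F"
proof -
  have "r dvd mono_val \<gamma> m - mono_val \<gamma>' m" if "m \<in> Poly_Mapping.keys F" for m
    unfolding mono_val_def using that assms
    by (intro dvd_diff_prod dvd_diff_power) (auto simp: form_in_iff)
  then show ?thesis
    unfolding mev_def sum_subtractf[symmetric] right_diff_distrib[symmetric]
    by (intro dvd_sum dvd_mult)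
qed

lemma form_in_add: "form_in n e F \<Longrightarrow> form_in n e G \<Longrightarrow> form_in n e (F + G)"
  unfolding form_in_iff using Poly_Mapping.keys_add[of F G] by blast

lemma form_in_mult:
  assumes "form_in n e F" "form_in n e' G"
  shows "form_in n (e + e') (F * G)"
  unfolding form_in_iff
proof
  fix m assume "m \<in> Poly_Mapping.keys (F * G)"
  then obtain a b where ab: "m = a + b" "a \<in> Poly_Mapping.keys F" "b \<in> Poly_Mapping.keys G"
    using keys_mult[of F G] by blast
  then have "Poly_Mapping.keys a \<subseteq> {..<n}" "Poly_Mapping.keys b \<subseteq> {..<n}" "mono_deg a = e" "mono_deg b = e'"
    using assms by (auto simp: form_in_iff)
  then show "Poly_Mapping.keys m \<subseteq> {..<n} \<and> mono_deg m = e + e'"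
    using Poly_Mapping.keys_add[of a b] by (simp add: ab(1) mono_deg_add) blast
qed

lemma form_in_zero: "form_in n e 0"
  by (simp add: form_in_iff)

lemma form_in_const: "form_in n 0 (Poly_Mapping.single 0 c)"
  by (auto simp: form_in_iff in_keys_iff lookup_single when_def mono_deg_def)

lemma form_in_uminus: "form_in n e F \<Longrightarrow> form_in n e (- F)" for F :: "'k :: comm_ring_1 mpol"
  by (simp add: form_in_iff in_keys_iff)

lemma form_in_var: "i < n \<Longrightarrow> form_in n 1 (Poly_Mapping.single (Poly_Mapping.single i 1) c)"
  by (auto simp: form_in_iff in_keys_iff lookup_single when_def mono_deg_def)

lemma eval_form_eq_mev: "eval_form F p = mev (\<lambda>c. c) (\<lambda>i. p $ i) F"
  by (simp add: eval_form_def mev_def mono_val_def)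

section \<open>The coordinate ring of the curve\<close>

text \<open>The pullback of polynomials along \<open>\<Psi>\<close>.\<close>

definition pull :: "'k :: field poly poly vec \<Rightarrow> 'k mpol \<Rightarrow> 'k poly poly" where
  "pull g = mev cst (\<lambda>i. g $ i)"

interpretation pull: comm_ring_hom "pull g" for g
  unfolding pull_def by (intro comm_ring_hom_mev comm_ring_hom_C)

lemma pull_const: "pull g (Poly_Mapping.single 0 c) = cst c"
  unfolding pull_def by (simp add: mev_single[OF comm_ring_hom_C])

lemma pull_var: "pull g (Poly_Mapping.single (Poly_Mapping.single i 1) c) = cst c * g $ i"
  unfolding pull_def by (simp add: mev_single[OF comm_ring_hom_C] mono_val_def)

text \<open>Membership in the degree \<open>j\<close> part of the homogeneous coordinate ring \<open>k[g\<^sub>1, \<dots>, g\<^sub>n]\<close> of the curve.\<close>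

definition coord :: "'k :: field poly poly vec \<Rightarrow> nat \<Rightarrow> 'k poly poly \<Rightarrow> bool" where
  "coord g j f \<longleftrightarrow> (\<exists>F. form_in (dim_vec g) j F \<and> pull g F = f)"

lemma coordI: "form_in (dim_vec g) j F \<Longrightarrow> coord g j (pull g F)"
  unfolding coord_def by blast

lemma coord_add: "coord g j f \<Longrightarrow> coord g j h \<Longrightarrow> coord g j (f + h)"
  unfolding coord_def by (metis form_in_add pull.hom_add)

lemma coord_mult: "coord g j f \<Longrightarrow> coord g i h \<Longrightarrow> coord g (j + i) (f * h)"
  unfolding coord_def by (metis form_in_mult pull.hom_mult)

lemma coord_zero: "coord g j 0"
  unfolding coord_def by (metis form_in_zero pull.hom_zero)

lemma coord_const: "coord g 0 (cst c)"
  unfolding coord_def by (metis form_in_const pull_const)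

lemma coord_gen: "i < dim_vec g \<Longrightarrow> coord g 1 (g $ i)"
  unfolding coord_def using form_in_var[of i "dim_vec g" 1] pull_var[of g i 1] by auto

lemma coord_cst_mult: "coord g j f \<Longrightarrow> coord g j (cst c * f)"
  using coord_mult[OF coord_const, of g j f c] by simp

lemma coord_sum: "(\<And>x. x \<in> A \<Longrightarrow> coord g j (f x)) \<Longrightarrow> coord g j (sum f A)"
  by (induction A rule: infinite_finite_induct) (simp_all add: coord_zero coord_add)

lemma coord_power: "coord g j f \<Longrightarrow> coord g (k * j) (f ^ k)"
  using coord_const[of g 1] by (induction k) (simp_all add: coord_mult)

locale rational_curve =
  fixes g :: "'k :: {alg_closed_field, field_char_0} poly poly vec" and n d :: nat
  assumes dim_g: "dim_vec g = n"
    and d_pos: "0 < d"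
    and g_form: "i < n \<Longrightarrow> bihomogeneous d (g $ i)"
    and base_point_free: "(a, b) \<noteq> (0, 0) \<Longrightarrow> \<exists>i<n. eval2 (g $ i) a b \<noteq> 0"
begin

lemma form_pull:
  assumes "form_in n e F"
  shows "bihomogeneous (e * d) (pull g F)"
  unfolding pull_def mev_def mono_val_def
proof (intro form_sum form_const_mult)
  fix m assume m: "m \<in> Poly_Mapping.keys F"
  have "bihomogeneous (\<Sum>i\<in>Poly_Mapping.keys m. Poly_Mapping.lookup m i * d)
      (\<Prod>i\<in>Poly_Mapping.keys m. g $ i ^ Poly_Mapping.lookup m i)"
    using assms m by (intro form_prod form_power g_form) (auto simp: form_in_def)
  moreover have "(\<Sum>i\<in>Poly_Mapping.keys m. Poly_Mapping.lookup m i * d) = e * d"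
    using assms m by (simp add: form_in_def flip: sum_distrib_right)
  ultimately show "bihomogeneous (e * d) (\<Prod>i\<in>Poly_Mapping.keys m. g $ i ^ Poly_Mapping.lookup m i)"
    by simp
qed

lemma eval2_pull:
  assumes "form_in n e F"
  shows "eval2 (pull g F) a b = eval_form F (param g a b)"
proof -
  have "eval2 (pull g F) a b = mev (\<lambda>c. c) (\<lambda>i. eval2 (g $ i) a b) F"
    unfolding pull_def by (subst mev_hom[OF comm_ring_hom_eval2]) (simp add: cst_def eval2_def)
  also have "\<dots> = mev (\<lambda>c. c) (\<lambda>i. param g a b $ i) F"
    by (rule mev_cong[OF assms]) (simp add: param_def dim_g)
  finally show ?thesis by (simp add: eval_form_eq_mev)
qed

lemma eval_form_scale:
  assumes "form_in n e F" "dim_vec p = n"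
  shows "eval_form F (c \<cdot>\<^sub>v p) = c ^ e * eval_form F p"
proof -
  have "eval_form F (c \<cdot>\<^sub>v p) = mev (\<lambda>c. c) (\<lambda>i. c * p $ i) F"
    unfolding eval_form_eq_mev by (rule mev_cong[OF assms(1)]) (simp add: assms(2))
  then show ?thesis unfolding mev_scale[OF assms(1)] by (simp add: eval_form_eq_mev)
qed

lemma g_nonzero: "\<exists>i<n. g $ i \<noteq> 0"
  using base_point_free[of 1 0] by auto

text \<open>Modulo the ideal of the \<open>g\<close>, a form of high degree can be made divisible by one linear form after the other:
  some \<open>g $ j\<close> does not vanish at the zero of the next linear form, and subtracting a multiple of it makes the
  cofactor \<open>A\<close> vanish there.\<close>

lemma high_degree_in_ideal_aux:
  assumes "bihomogeneous m h" "h \<noteq> 0"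
  shows "\<forall>i f. m + d \<le> i \<longrightarrow> bihomogeneous i f \<longrightarrow>
    (\<exists>A q. bihomogeneous (i - m) A \<and> (\<forall>j<n. bihomogeneous (i - d) (q j)) \<and> f = A * h + (\<Sum>j<n. q j * g $ j))"
  using assms
proof (induction rule: form_induct)
  case (const c)
  show ?case
  proof (intro allI impI)
    fix i and f :: "'k poly poly" assume "bihomogeneous i f"
    moreover have "cst (1 / c) * cst c = 1" using const by (simp flip: cst.hom_mult)
    then have "f = (cst (1 / c) * f) * cst c + (\<Sum>j<n. 0 * g $ j)"
      by (simp add: mult.commute mult.left_commute)
    ultimately show "\<exists>A q. bihomogeneous (i - 0) A \<and> (\<forall>j<n. bihomogeneous (i - d) (q j)) \<and>
        f = A * cst c + (\<Sum>j<n. q j * g $ j)"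
      by (intro exI[of _ "cst (1 / c) * f"] exI[of _ "\<lambda>_. 0"]) (simp add: form_const_mult)
  qed
next
  case (lin a b m h)
  show ?case
  proof (intro allI impI)
    fix i and f :: "'k poly poly" assume i: "Suc m + d \<le> i" and f: "bihomogeneous i f"
    then obtain A q where A: "bihomogeneous (i - m) A" and q: "\<forall>j<n. bihomogeneous (i - d) (q j)"
      and f_eq: "f = A * h + (\<Sum>j<n. q j * g $ j)"
      using lin.IH by (metis Suc_leD add_Suc)
    obtain j0 where j0: "j0 < n" "eval2 (g $ j0) a b \<noteq> 0" using base_point_free[OF lin(1)] by blast
    define B :: "'k poly poly" where "B = (if b = 0 then varx else vary) ^ (i - m - d)"
    have B: "bihomogeneous (i - m - d) B" "eval2 B a b \<noteq> 0"
      using form_power[OF form_X, of "i - m - d"] form_power[OF form_Y, of "i - m - d"] lin(1)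
      by (auto simp: B_def eval2.hom_power)
    define c where "c = eval2 A a b / (eval2 B a b * eval2 (g $ j0) a b)"
    have cBg: "bihomogeneous (i - m) (cst c * (B * g $ j0))"
      using form_const_mult[OF form_mult[OF B(1) g_form[OF j0(1)]], of c] i by simp
    have "eval2 (A - cst c * (B * g $ j0)) a b = 0"
      using B j0 by (simp add: c_def eval2.hom_minus eval2.hom_mult)
    then obtain A' where A': "A - cst c * (B * g $ j0) = lin a b * A'" "bihomogeneous (i - m - 1) A'"
      by (rule form_root_factor[OF form_diff[OF A cBg] lin(1)])
    define q' where "q' = q(j0 := q j0 + cst c * (B * h))"
    have "bihomogeneous (i - d) (cst c * (B * h))"
      using form_const_mult[OF form_mult[OF B(1) lin(2)], of c] i by (simp add: add.commute)
    then have q': "\<forall>j<n. bihomogeneous (i - d) (q' j)" using q j0 by (simp add: q'_def form_add)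
    have "(\<Sum>j<n. q' j * g $ j) = (\<Sum>j<n. q j * g $ j) + cst c * (B * h) * g $ j0"
    proof -
      have "(\<Sum>j<n. q' j * g $ j) = (\<Sum>j<n. q j * g $ j + (if j = j0 then cst c * (B * h) * g $ j0 else 0))"
        by (intro sum.cong) (auto simp: q'_def algebra_simps)
      then show ?thesis using j0 by (simp add: sum.distrib)
    qed
    moreover have "A = lin a b * A' + cst c * (B * g $ j0)" using A'(1) by (simp add: algebra_simps)
    ultimately have "f = A' * (lin a b * h) + (\<Sum>j<n. q' j * g $ j)"
      unfolding f_eq by (simp add: algebra_simps)
    then show "\<exists>A q. bihomogeneous (i - Suc m) A \<and> (\<forall>j<n. bihomogeneous (i - d) (q j)) \<and>
        f = A * (lin a b * h) + (\<Sum>j<n. q j * g $ j)"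
      using A'(2) q' by (intro exI[of _ A'] exI[of _ q']) simp
  qed
qed

text \<open>Take for \<open>h\<close> one of the \<open>g\<close> themselves. This makes \<open>\<Oplus> B\<^sub>j\<^sub>d\<close> finite over \<open>k[g\<^sub>1, \<dots>, g\<^sub>n]\<close>, with generators of degree
  at most \<open>d\<close>.\<close>

lemma high_degree_in_ideal:
  assumes "bihomogeneous i f" "2 * d \<le> i"
  obtains q where "\<And>j. j < n \<Longrightarrow> bihomogeneous (i - d) (q j)" "f = (\<Sum>j<n. q j * g $ j)"
proof -
  obtain j0 where j0: "j0 < n" "g $ j0 \<noteq> 0" using g_nonzero by blast
  obtain A q where A: "bihomogeneous (i - d) A" and q: "\<forall>j<n. bihomogeneous (i - d) (q j)"
    and f: "f = A * g $ j0 + (\<Sum>j<n. q j * g $ j)"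
    using high_degree_in_ideal_aux[OF g_form[OF j0(1)] j0(2)] assms unfolding mult_2 by metis
  define q' where "q' = q(j0 := q j0 + A)"
  have "(\<Sum>j<n. q' j * g $ j) = (\<Sum>j<n. q j * g $ j + (if j = j0 then A * g $ j0 else 0))"
    by (intro sum.cong) (auto simp: q'_def algebra_simps)
  then have "f = (\<Sum>j<n. q' j * g $ j)" using j0 by (simp add: sum.distrib f add.commute)
  moreover have "bihomogeneous (i - d) (q' j)" if "j < n" for j
    using that q A by (simp add: q'_def form_add)
  ultimately show thesis using that by blast
qed

text \<open>If \<open>[F : G]\<close> is a rational inverse of \<open>\<Psi>\<close>, then the pullbacks of \<open>F\<close> and \<open>G\<close> are proportional to \<open>x\<close> and \<open>y\<close>,
  and the factor of proportionality is \<open>A\<close>.\<close>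

lemma birational_factor:
  assumes "birational_onto_image g"
  obtains e A where "A \<noteq> 0" "bihomogeneous (e * d - 1) A" "0 < e * d"
    "coord g e (varx * A)" "coord g e (vary * A)"
proof -
  obtain e F G where F: "form_in n e F" and G: "form_in n e G"
    and nz: "\<exists>p\<in>curve g. (eval_form F p, eval_form G p) \<noteq> (0, 0)"
    and inverse: "\<And>a b. (a, b) \<noteq> (0, 0) \<Longrightarrow>
      (eval_form F (param g a b), eval_form G (param g a b)) \<noteq> (0, 0) \<Longrightarrow>
      \<exists>c. c \<noteq> 0 \<and> eval_form F (param g a b) = c * a \<and> eval_form G (param g a b) = c * b"
    using assms unfolding birational_onto_image_def dim_g Let_def by metis
  have "vary * pull g F - varx * pull g G = 0"
  proof (rule form_eq_0I)
    show "bihomogeneous (1 + e * d) (vary * pull g F - varx * pull g G)"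
      by (intro form_diff form_mult form_X form_Y form_pull F G)
    fix a b :: 'k assume ab: "(a, b) \<noteq> (0, 0)"
    show "eval2 (vary * pull g F - varx * pull g G) a b = 0"
      using inverse[OF ab]
      by (cases "eval_form F (param g a b) = 0 \<and> eval_form G (param g a b) = 0")
        (auto simp: eval2.hom_minus eval2.hom_mult eval2_pull[OF F] eval2_pull[OF G])
  qed
  then have eq: "vary * pull g F = varx * pull g G" by simp
  have varx: "varx = lin 0 (1 :: 'k)" by (simp add: lin_def)
  have "varx dvd vary * pull g F" unfolding eq by simp
  moreover have "\<not> varx dvd (vary :: 'k poly poly)"
    unfolding varx using form_lin_dvd_iff[OF form_Y, of 0 "1 :: 'k"] by simp
  ultimately have "varx dvd pull g F" unfolding varx using lin_prime[of 0 "1 :: 'k"] by auto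
  then obtain A where A: "pull g F = varx * A" by (elim dvdE)
  have x0: "varx \<noteq> (0 :: 'k poly poly)" by (simp add: varx_def)
  have "varx * (vary * A) = varx * pull g G" using eq A by (simp add: ac_simps)
  then have A': "pull g G = vary * A" using x0 by simp
  have "A \<noteq> 0"
  proof
    assume "A = 0"
    then have 0: "pull g F = 0" "pull g G = 0" using A A' by simp_all
    obtain p where p: "p \<in> curve g" "(eval_form F p, eval_form G p) \<noteq> (0, 0)" using nz by blast
    then obtain a b c where "p = c \<cdot>\<^sub>v param g a b" by (auto simp: curve_def proj_eq_def)
    then have "eval_form F p = 0" "eval_form G p = 0"
      using 0 eval2_pull[OF F, of a b] eval2_pull[OF G, of a b]
      by (simp_all add: eval_form_scale[OF F] eval_form_scale[OF G] param_def dim_g)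
    then show False using p by simp
  qed
  have "bihomogeneous (e * d - 1) A"
    by (rule form_quotient[of "e * d" A varx 1]) (use form_pull[OF F] A x0 form_X in \<open>simp_all add: mult.commute\<close>)
  moreover have "0 < e * d"
  proof -
    have "bihomogeneous (1 + (e * d - 1)) (pull g F)"
      unfolding A by (intro form_mult form_X calculation)
    moreover have "pull g F \<noteq> 0" using A x0 \<open>A \<noteq> 0\<close> by simp
    ultimately have "e * d = 1 + (e * d - 1)" using form_degree_unique form_pull[OF F] by blast
    then show ?thesis by linarith
  qed
  moreover have "coord g e (varx * A)" "coord g e (vary * A)"
    using A A' coordI[of g e F] coordI[of g e G] F G by (simp_all add: dim_g)
  ultimately show thesis using that \<open>A \<noteq> 0\<close> by blast
qed

text \<open>A homogeneous conductor is \<open>c = A\<^sup>d g\<^sub>j\<close>. The factor \<open>A\<^sup>d\<close> carries forms of degree \<open>d\<close> into the coordinate ring, since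
  \<open>x A\<close> and \<open>y A\<close> belong to it; forms of higher degree are reduced to degree \<open>d\<close> by \<open>high_degree_in_ideal\<close>.
  The factor \<open>g\<^sub>j\<close> makes \<open>c\<close> itself an element, which settles the constants.\<close>

lemma conductor:
  assumes "birational_onto_image g"
  obtains c k where "c \<noteq> 0" "bihomogeneous (k * d) c"
    "\<forall>j b. bihomogeneous (j * d) b \<longrightarrow> coord g (k + j) (c * b)"
proof -
  obtain e A where A: "A \<noteq> 0" "bihomogeneous (e * d - 1) A" "0 < e * d"
    "coord g e (varx * A)" "coord g e (vary * A)"
    by (rule birational_factor[OF assms])
  have clear: "coord g (i * e) (A ^ i * b)" if "bihomogeneous i b" for i b
  proof -
    have "A ^ i * b = (\<Sum>l\<le>i. cst (coeff (coeff b (i - l)) l) * ((varx * A) ^ l * (vary * A) ^ (i - l)))"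
    proof (subst form_expand[OF that], unfold sum_distrib_left, intro sum.cong refl)
      fix l assume "l \<in> {..i}"
      then have "A ^ i = A ^ l * A ^ (i - l)" by (simp flip: power_add)
      then show "A ^ i * (cst (coeff (coeff b (i - l)) l) * varx ^ l * vary ^ (i - l)) =
          cst (coeff (coeff b (i - l)) l) * ((varx * A) ^ l * (vary * A) ^ (i - l))"
        by (simp only: power_mult_distrib ac_simps)
    qed
    moreover have "coord g (l * e + (i - l) * e) ((varx * A) ^ l * (vary * A) ^ (i - l))" for l
      by (intro coord_mult coord_power A)
    then have "coord g (i * e) ((varx * A) ^ l * (vary * A) ^ (i - l))" if "l \<le> i" for l
      using that by (metis add_mult_distrib le_add_diff_inverse)
    ultimately show ?thesis by (auto intro: coord_sum coord_cst_mult)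
  qed
  obtain j0 where j0: "j0 < n" "g $ j0 \<noteq> 0" using g_nonzero by blast
  define c where "c = A ^ d * g $ j0"
  have c: "coord g (d * e) c" unfolding c_def by (rule clear[OF g_form[OF j0(1)]])
  have main: "coord g (d * e + j) (c * b)" if "bihomogeneous (j * d) b" for j b
    using that
  proof (induction j arbitrary: b)
    case 0
    then obtain k where "b = cst k" by (auto elim: form_0_const)
    then show ?case using coord_cst_mult[OF c, of k] by (simp add: mult.commute)
  next
    case (Suc j)
    show ?case
    proof (cases "j = 0")
      case True
      then have "coord g (d * e) (A ^ d * b)" using clear[of d b] Suc.prems by simp
      then have "coord g (d * e + 1) (A ^ d * b * g $ j0)"
        using coord_mult[OF _ coord_gen[of j0 g]] j0 dim_g by blast
      then show ?thesis using True by (simp add: c_def ac_simps)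
    next
      case False
      then have "2 * d \<le> Suc j * d" by (intro mult_le_mono1) simp
      then obtain q where q: "\<And>i. i < n \<Longrightarrow> bihomogeneous (Suc j * d - d) (q i)" "b = (\<Sum>i<n. q i * g $ i)"
        using high_degree_in_ideal[OF Suc.prems] by blast
      have "coord g (d * e + j + 1) (c * q i * g $ i)" if "i < n" for i
        using that q(1)[OF that] dim_g by (intro coord_mult coord_gen Suc.IH) simp_all
      then show ?thesis unfolding q(2) sum_distrib_left
        by (intro coord_sum) (simp add: mult.assoc)
    qed
  qed
  have "bihomogeneous (d * (e * d - 1) + d) c"
    unfolding c_def by (intro form_mult form_power A g_form j0)
  moreover have "d * (e * d - 1) + d = d * e * d"
    using A(3) by (cases "e * d") (simp_all add: algebra_simps)
  ultimately have "bihomogeneous (d * e * d) c" by simp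
  moreover have "c \<noteq> 0" using A j0 by (simp add: c_def)
  ultimately show thesis using main that by blast
qed

end

section \<open>The local ring of the curve at a point\<close>

lemma has_order_mult_cancel:
  fixes f h :: "'a :: field fps"
  assumes "has_order n (f * h)" "fps_nth h 0 \<noteq> 0"
  shows "has_order n f"
proof -
  have "f \<noteq> 0" using has_order_imp_nonzero[OF assms(1)] by auto
  then have f: "has_order (subdegree f) f" by (rule has_order_subdegree)
  moreover have "has_order 0 h" using assms(2) by (simp add: has_order_0_iff)
  ultimately have "has_order (subdegree f + 0) (f * h)" by (rule has_order_mult)
  then have "subdegree f = n" using assms(1) has_order_unique by fastforce
  then show ?thesis using f by simp
qed

lemma has_order_prod:
  "finite A \<Longrightarrow> (\<And>x. x \<in> A \<Longrightarrow> has_order (w x) (f x)) \<Longrightarrow> has_order (sum w A) (prod f A)"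
  for f :: "'b \<Rightarrow> 'a :: idom fps"
  by (induction A rule: finite_induct) (simp_all add: has_order_mult has_order_0_iff)

interpretation eval_form: comm_ring_hom "\<lambda>F. eval_form F p" for p
  unfolding eval_form_eq_mev by (intro comm_ring_hom_mev comm_ring_hom_ident)

lemma eval_form_const: "eval_form (Poly_Mapping.single 0 c) p = c"
  by (simp add: eval_form_eq_mev mev_single[OF comm_ring_hom_ident])

lemma eval_form_var: "eval_form (Poly_Mapping.single (Poly_Mapping.single i 1) c) p = c * p $ i"
  by (simp add: eval_form_eq_mev mev_single[OF comm_ring_hom_ident] mono_val_def)

lemma form_in_diff: "form_in n e F \<Longrightarrow> form_in n e G \<Longrightarrow> form_in n e (F - G)"
  for F G :: "'k :: comm_ring_1 mpol"
  using form_in_add[of n e F "- G"] form_in_uminus[of n e G] by simp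

lemma form_in_sum: "(\<And>x. x \<in> A \<Longrightarrow> form_in n e (f x)) \<Longrightarrow> form_in n e (sum f A)"
  by (induction A rule: infinite_finite_induct) (simp_all add: form_in_zero form_in_add)

lemma form_in_one: "form_in n 0 (1 :: 'k :: comm_ring_1 mpol)"
  using form_in_const[of n "1 :: 'k"] by simp

lemma form_in_power: "form_in n e F \<Longrightarrow> form_in n (k * e) (F ^ k)" for F :: "'k :: comm_ring_1 mpol"
  by (induction k) (simp_all add: form_in_one form_in_mult)

definition mvar :: "nat \<Rightarrow> 'k :: comm_ring_1 mpol" where
  "mvar i = Poly_Mapping.single (Poly_Mapping.single i 1) 1"

lemma form_in_mvar: "i < n \<Longrightarrow> form_in n 1 (mvar i)"
  unfolding mvar_def by (rule form_in_var)

lemma pull_mvar: "pull g (mvar i) = g $ i"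
  unfolding mvar_def by (subst pull_var) simp

lemma eval_form_mvar: "eval_form (mvar i) p = p $ i"
  unfolding mvar_def by (subst eval_form_var) simp

abbreviation mcst :: "'k :: comm_ring_1 \<Rightarrow> 'k mpol" where
  "mcst c \<equiv> Poly_Mapping.single 0 c"

lemma form_in_mcst_mult: "form_in n e F \<Longrightarrow> form_in n e (mcst c * F)"
  using form_in_mult[OF form_in_const] by fastforce

lemma a_inv_ring_of_type_algebra: "\<ominus>\<^bsub>ring_of_type_algebra\<^esub> x = - x" for x :: "'a :: comm_ring_1"
proof -
  interpret ring "ring_of_type_algebra :: 'a ring" by (rule ring_from_type_algebra)
  show ?thesis by (rule minus_equality) (simp_all add: ring_of_type_algebra_def)
qed

locale curve_point = rational_curve g n d for g :: "'k :: {alg_closed_field, field_char_0} poly poly vec" and n d +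
  fixes p :: "'k vec"
  assumes birational: "birational_onto_image g"
    and dim_p: "dim_vec p = n"
    and p_nonzero: "\<exists>i<n. p $ i \<noteq> 0"
begin

text \<open>A coordinate in which \<open>p\<close> does not vanish; \<open>T\<^sub>i\<^sub>0\<close> serves as a denominator at \<open>p\<close>.\<close>

definition i0 :: nat where "i0 = (SOME i. i < n \<and> p $ i \<noteq> 0)"

lemma i0: "i0 < n" "p $ i0 \<noteq> 0"
  using someI_ex[OF p_nonzero] by (simp_all add: i0_def)

text \<open>The pullbacks of the linear forms \<open>p\<^sub>i\<^sub>0 T\<^sub>j - p\<^sub>j T\<^sub>i\<^sub>0\<close>, which generate the ideal of the point \<open>p\<close>. Their common zeros
  are the points above \<open>p\<close>.\<close>

definition delta :: "nat \<Rightarrow> 'k poly poly" where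
  "delta j = cst (p $ i0) * g $ j - cst (p $ j) * g $ i0"

lemma form_delta: "j < n \<Longrightarrow> bihomogeneous d (delta j)"
  unfolding delta_def by (intro form_diff form_const_mult g_form i0)

definition fibre :: "('k \<times> 'k) set" where
  "fibre = {(a, b). normal_pt a b \<and> (\<forall>j<n. eval2 (delta j) a b = 0)}"

lemma delta_zero_imp:
  assumes "\<forall>j<n. eval2 (delta j) a b = 0" "(a, b) \<noteq> (0, 0)"
  shows "\<exists>c. c \<noteq> 0 \<and> param g a b = c \<cdot>\<^sub>v p"
proof -
  define c where "c = eval2 (g $ i0) a b / p $ i0"
  have eq: "eval2 (g $ j) a b = c * p $ j" if "j < n" for j
    using assms(1) that i0
    by (simp add: c_def delta_def eval2.hom_minus eval2.hom_mult field_simps)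
  have "c \<noteq> 0" using base_point_free[OF assms(2)] eq by auto
  moreover have "param g a b = c \<cdot>\<^sub>v p"
    by (rule eq_vecI) (simp_all add: param_def dim_g dim_p eq)
  ultimately show ?thesis by blast
qed

lemma param_prop_imp_delta_zero:
  assumes "param g a b = c \<cdot>\<^sub>v p" "j < n"
  shows "eval2 (delta j) a b = 0"
proof -
  have "eval2 (g $ i) a b = c * p $ i" if "i < n" for i
  proof -
    have "param g a b $ i = (c \<cdot>\<^sub>v p) $ i" using assms(1) by simp
    then show ?thesis using that by (simp add: param_def dim_g dim_p)
  qed
  then show ?thesis using assms(2) i0
    by (simp add: delta_def eval2.hom_minus eval2.hom_mult)
qed

lemma delta_nonzero: "\<exists>j<n. delta j \<noteq> 0"
proof (rule ccontr)
  assume no: "\<not> ?thesis"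
  obtain a b where ab: "(a, b) \<noteq> (0, 0)" "eval2 (g $ i0) a b = 0"
  proof -
    obtain a b where "normal_pt a b" "eval2 (g $ i0) a b = 0"
      using form_has_root[OF g_form[OF i0(1)] d_pos] by blast
    then show thesis using that normal_pt_nonzero by blast
  qed
  have "\<forall>j<n. eval2 (delta j) a b = 0" using no by auto
  then obtain c where c: "c \<noteq> 0" "param g a b = c \<cdot>\<^sub>v p" using delta_zero_imp ab by blast
  have "param g a b $ i0 = (c \<cdot>\<^sub>v p) $ i0" using c(2) by simp
  then show False using c(1) i0 ab(2) by (simp add: param_def dim_g dim_p)
qed

lemma finite_fibre: "finite fibre"
proof -
  obtain j where j: "j < n" "delta j \<noteq> 0" using delta_nonzero by blast
  have "fibre \<subseteq> (\<lambda>a. (a, 1)) ` {a. eval2 (delta j) a 1 = 0} \<union> {(1, 0)}"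
    using j by (auto simp: fibre_def normal_pt_def)
  moreover have "finite \<dots>" using finite_affine_roots[OF form_delta[OF j(1)] j(2)] by simp
  ultimately show ?thesis by (rule finite_subset)
qed

definition nbranch :: nat where "nbranch = card fibre"

text \<open>An enumeration of the points above \<open>p\<close>; each of them is going to be a branch.\<close>

definition pt :: "nat \<Rightarrow> 'k \<times> 'k" where
  "pt = (SOME q. bij_betw q {0..<nbranch} fibre)"

lemma pt_bij: "bij_betw pt {..<nbranch} fibre"
proof -
  have "\<exists>q. bij_betw q {0..<nbranch} fibre"
    unfolding nbranch_def by (rule ex_bij_betw_nat_finite[OF finite_fibre])
  then show ?thesis unfolding pt_def atLeast0LessThan[symmetric] by (rule someI_ex)
qed

lemma pt_in_fibre: "u < nbranch \<Longrightarrow> pt u \<in> fibre"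
  using pt_bij by (auto simp: bij_betw_def)

lemma fibre_pt: "q \<in> fibre \<Longrightarrow> \<exists>u<nbranch. q = pt u"
  using pt_bij by (auto simp: bij_betw_def)

lemma pt_eq_iff: "u < nbranch \<Longrightarrow> v < nbranch \<Longrightarrow> pt u = pt v \<longleftrightarrow> u = v"
  using pt_bij by (auto simp: bij_betw_def inj_on_def)

definition gm :: "nat \<Rightarrow> 'k poly poly \<Rightarrow> 'k fps" where
  "gm u = germ (fst (pt u)) (snd (pt u))"

interpretation gm: comm_ring_hom "gm u" for u
  unfolding gm_def by (rule germ.comm_ring_hom_axioms)

lemma pt_normal: "u < nbranch \<Longrightarrow> normal_pt (fst (pt u)) (snd (pt u))"
  using pt_in_fibre[of u] by (auto simp: fibre_def)

lemma pt_nonzero: "u < nbranch \<Longrightarrow> (fst (pt u), snd (pt u)) \<noteq> (0, 0)"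
  using normal_pt_nonzero[OF pt_normal] by blast

lemma gm_nth_0: "fps_nth (gm u f) 0 = eval2 f (fst (pt u)) (snd (pt u))"
  by (simp add: gm_def germ_nth_0)

lemma gm_nonzero: "u < nbranch \<Longrightarrow> bihomogeneous m f \<Longrightarrow> f \<noteq> 0 \<Longrightarrow> gm u f \<noteq> 0"
  unfolding gm_def by (rule germ_nonzero[OF _ _ pt_nonzero])

lemma gm_cst [simp]: "gm u (cst c) = fps_const c"
  by (simp add: gm_def)

lemma gm_pull_nth_0_iff:
  assumes "u < nbranch" "form_in n e F"
  shows "fps_nth (gm u (pull g F)) 0 = 0 \<longleftrightarrow> eval_form F p = 0"
proof -
  obtain a b where ab: "pt u = (a, b)" by fastforce
  then have "\<forall>j<n. eval2 (delta j) a b = 0" "(a, b) \<noteq> (0, 0)"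
    using pt_in_fibre[OF assms(1)] pt_nonzero[OF assms(1)] by (auto simp: fibre_def)
  then obtain c where c: "c \<noteq> 0" "param g a b = c \<cdot>\<^sub>v p" using delta_zero_imp by blast
  have "fps_nth (gm u (pull g F)) 0 = c ^ e * eval_form F p"
    by (simp add: gm_nth_0 ab eval2_pull[OF assms(2)] c eval_form_scale[OF assms(2) dim_p])
  then show ?thesis using c by simp
qed

lemma multiplicity_exists:
  assumes "(a, b) \<noteq> (0, 0)"
  shows "\<exists>k. (\<forall>j<n. fps_X ^ k dvd germ a b (delta j)) \<and> (\<exists>j<n. has_order k (germ a b (delta j)))"
proof -
  define k where "k = (LEAST k. \<exists>j<n. fps_nth (germ a b (delta j)) k \<noteq> 0)"
  obtain j where j: "j < n" "delta j \<noteq> 0" using delta_nonzero by blast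
  have "germ a b (delta j) \<noteq> 0" by (rule germ_nonzero[OF form_delta[OF j(1)] j(2) assms])
  then have ex: "\<exists>k. \<exists>j<n. fps_nth (germ a b (delta j)) k \<noteq> 0" using j(1) by (auto simp: fps_eq_iff)
  have 1: "\<exists>j<n. fps_nth (germ a b (delta j)) k \<noteq> 0" unfolding k_def by (rule LeastI_ex[OF ex])
  have 2: "\<forall>j<n. fps_X ^ k dvd germ a b (delta j)"
    unfolding fps_X_power_dvd_iff k_def using not_less_Least by blast
  show ?thesis using 1 2 by (auto simp: has_order_def)
qed

text \<open>The ramification order: the least order at \<open>(a : b)\<close> among the pullbacks of the linear forms through \<open>p\<close>.
  It is zero unless \<open>(a : b)\<close> lies above \<open>p\<close>.\<close>

definition mult_at :: "'k \<Rightarrow> 'k \<Rightarrow> nat" where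
  "mult_at a b = (SOME k. (\<forall>j<n. fps_X ^ k dvd germ a b (delta j)) \<and>
    (\<exists>j<n. has_order k (germ a b (delta j))))"

lemma mult_at:
  assumes "(a, b) \<noteq> (0, 0)"
  shows "\<And>j. j < n \<Longrightarrow> fps_X ^ mult_at a b dvd germ a b (delta j)"
    "\<exists>j<n. has_order (mult_at a b) (germ a b (delta j))"
  using someI_ex[OF multiplicity_exists[OF assms]] unfolding mult_at_def by blast+

lemma mult_at_pos_iff:
  assumes "(a, b) \<noteq> (0, 0)"
  shows "0 < mult_at a b \<longleftrightarrow> (\<forall>j<n. eval2 (delta j) a b = 0)"
proof
  assume *: "0 < mult_at a b"
  show "\<forall>j<n. eval2 (delta j) a b = 0"
  proof (intro allI impI)
    fix j assume "j < n"
    then have "fps_nth (germ a b (delta j)) 0 = 0"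
      using mult_at(1)[OF assms] * unfolding fps_X_power_dvd_iff by blast
    then show "eval2 (delta j) a b = 0" by (simp add: germ_nth_0)
  qed
next
  assume *: "\<forall>j<n. eval2 (delta j) a b = 0"
  obtain j where "j < n" "has_order (mult_at a b) (germ a b (delta j))" using mult_at(2)[OF assms] by blast
  then show "0 < mult_at a b"
    using * by (cases "mult_at a b") (auto simp: has_order_0_iff germ_nth_0)
qed

definition em :: "nat \<Rightarrow> nat" where "em u = mult_at (fst (pt u)) (snd (pt u))"

lemma em_pos: "u < nbranch \<Longrightarrow> 0 < em u"
  unfolding em_def using mult_at_pos_iff[OF pt_nonzero] pt_in_fibre by (force simp: fibre_def)

lemma em_dvd: "u < nbranch \<Longrightarrow> j < n \<Longrightarrow> fps_X ^ em u dvd gm u (delta j)"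
  unfolding em_def gm_def by (rule mult_at(1)[OF pt_nonzero])

lemma em_order: "u < nbranch \<Longrightarrow> \<exists>j<n. has_order (em u) (gm u (delta j))"
  unfolding em_def gm_def by (rule mult_at(2)[OF pt_nonzero])

subsection \<open>Denominators and the conductor\<close>

text \<open>A form without zeros above \<open>p\<close> becomes invertible in the local ring at \<open>p\<close>. For each of its zeros there is a
  hyperplane through the image of the zero that avoids \<open>p\<close>.\<close>

lemma form_pull_cover:
  assumes "bihomogeneous m b" "b \<noteq> 0" "\<And>u. u < nbranch \<Longrightarrow> fps_nth (gm u b) 0 \<noteq> 0"
  shows "\<exists>k H. form_in n k H \<and> eval_form H p \<noteq> 0 \<and> b dvd pull g H"
  using assms
proof (induction rule: form_induct)
  case (const c)
  then have "cst c dvd pull g 1" using unit_imp_dvd[OF cst_dvd_1[OF const(1)]] by blast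
  then show ?case using form_in_one[of n] by (intro exI[of _ 0] exI[of _ 1]) simp
next
  case (lin a b m f)
  have nz: "fps_nth (gm u (lin a b)) 0 \<noteq> 0" "fps_nth (gm u f) 0 \<noteq> 0" if "u < nbranch" for u
    using lin.prems[OF that] by (simp_all add: gm.hom_mult)
  obtain k H where H: "form_in n k H" "eval_form H p \<noteq> 0" "f dvd pull g H"
    using lin.IH nz(2) by blast
  have "(a, b) \<notin> fibre"
  proof
    assume "(a, b) \<in> fibre"
    then obtain u where "u < nbranch" "pt u = (a, b)" using fibre_pt by metis
    then show False using nz(1)[of u] by (simp add: gm_nth_0 eval2_lin)
  qed
  then obtain j where j: "j < n" "eval2 (delta j) a b \<noteq> 0" using lin(4) by (auto simp: fibre_def)
  define L where "L = mcst (eval2 (g $ j) a b) * mvar i0 - mcst (eval2 (g $ i0) a b) * mvar j"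
  have L: "form_in n 1 L"
    unfolding L_def by (intro form_in_diff form_in_mcst_mult form_in_mvar i0 j)
  have pull_L: "pull g L = cst (eval2 (g $ j) a b) * g $ i0 - cst (eval2 (g $ i0) a b) * g $ j"
    by (simp add: L_def pull.hom_minus pull.hom_mult pull_const pull_mvar)
  have "eval_form L p \<noteq> 0"
    using j(2) by (simp add: L_def eval_form.hom_minus eval_form.hom_mult eval_form_const eval_form_mvar
      delta_def eval2.hom_minus eval2.hom_mult mult.commute)
  moreover have "lin a b dvd pull g L"
    using form_lin_dvd_iff[OF form_pull[OF L] lin(1)]
    by (simp add: pull_L eval2.hom_minus eval2.hom_mult)
  ultimately show ?case
    using form_in_mult[OF L H(1)] H(2,3)
    by (intro exI[of _ "1 + k"] exI[of _ "L * H"])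
      (simp add: eval_form.hom_mult pull.hom_mult mult_dvd_mono)
qed

text \<open>A form is the product of a part with zeros only above \<open>p\<close> and a part without zeros above \<open>p\<close>.\<close>

lemma form_split:
  assumes "bihomogeneous m f" "f \<noteq> 0"
  shows "\<exists>f0 f1 m0 m1. f = f0 * f1 \<and> bihomogeneous m0 f0 \<and> bihomogeneous m1 f1 \<and>
    (\<forall>u<nbranch. fps_nth (gm u f1) 0 \<noteq> 0) \<and>
    (\<forall>a b. normal_pt a b \<longrightarrow> (a, b) \<notin> fibre \<longrightarrow> eval2 f0 a b \<noteq> 0)"
  using assms
proof (induction rule: form_induct)
  case (const c)
  then show ?case
    by (intro exI[of _ "cst c"] exI[of _ 1] exI[of _ 0]) (simp add: form_const form_one)
next
  case (lin a b m f)
  then obtain f0 f1 m0 m1 where f: "f = f0 * f1" "bihomogeneous m0 f0" "bihomogeneous m1 f1"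
    "\<forall>u<nbranch. fps_nth (gm u f1) 0 \<noteq> 0" "\<forall>a b. normal_pt a b \<longrightarrow> (a, b) \<notin> fibre \<longrightarrow> eval2 f0 a b \<noteq> 0"
    by blast
  show ?case
  proof (cases "(a, b) \<in> fibre")
    case True
    have "eval2 (lin a b * f0) c e \<noteq> 0" if "normal_pt c e" "(c, e) \<notin> fibre" for c e
      using f(5) that True by (auto simp: eval2.hom_mult eval2_lin_normal[OF lin(4) that(1)])
    moreover have "bihomogeneous (1 + m0) (lin a b * f0)" by (rule form_mult[OF form_lin f(2)])
    moreover have "lin a b * f = (lin a b * f0) * f1" by (simp add: f(1) mult.assoc)
    ultimately show ?thesis using f(3,4) by blast
  next
    case False
    have "fps_nth (gm u (lin a b * f1)) 0 \<noteq> 0" if "u < nbranch" for u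
    proof -
      have "eval2 (lin a b) (fst (pt u)) (snd (pt u)) \<noteq> 0"
        using False pt_in_fibre[OF that] eval2_lin_normal[OF lin(4) pt_normal[OF that]] by auto
      then show ?thesis using f(4) that by (simp add: gm.hom_mult) (simp add: gm_nth_0)
    qed
    moreover have "bihomogeneous (1 + m1) (lin a b * f1)" by (rule form_mult[OF form_lin f(3)])
    moreover have "lin a b * f = f0 * (lin a b * f1)" by (simp add: f(1) ac_simps)
    ultimately show ?thesis using f(2,5) by blast
  qed
qed

lemma fibre_part_dvd:
  assumes f0: "bihomogeneous m0 f0" "f0 \<noteq> 0"
      "\<forall>a b. normal_pt a b \<longrightarrow> (a, b) \<notin> fibre \<longrightarrow> eval2 f0 a b \<noteq> 0"
    and a: "bihomogeneous m a" "\<And>u. u < nbranch \<Longrightarrow> gm u f0 dvd gm u a"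
  shows "f0 dvd a"
proof (rule form_dvdI[OF f0(1,2) a(1)])
  fix c e :: 'k assume ce: "normal_pt c e"
  show "germ c e f0 dvd germ c e a"
  proof (cases "(c, e) \<in> fibre")
    case True
    then obtain u where "u < nbranch" "pt u = (c, e)" using fibre_pt by metis
    then show ?thesis using a(2)[of u] by (simp add: gm_def)
  next
    case False
    then have "fps_nth (germ c e f0) 0 \<noteq> 0" using f0(3) ce by (simp add: germ_nth_0)
    then show ?thesis by (rule fps_unit_dvd)
  qed
qed

text \<open>At \<open>p\<close> only the zeros of the conductor above \<open>p\<close> matter, and divisibility by the corresponding part is a
  condition on the orders along the branches. The other part is absorbed into the denominator \<open>G\<close>.\<close>

lemma local_conductor:
  obtains N k G where "form_in n k G" "eval_form G p \<noteq> 0"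
    "\<forall>j a. bihomogeneous (j * d) a \<longrightarrow> (\<forall>u<nbranch. fps_X ^ N dvd gm u a) \<longrightarrow>
      coord g (k + j) (a * pull g G)"
proof -
  obtain c k where c: "c \<noteq> 0" "bihomogeneous (k * d) c"
    "\<forall>j b. bihomogeneous (j * d) b \<longrightarrow> coord g (k + j) (c * b)"
    by (rule conductor[OF birational])
  obtain c0 c1 m0 m1 where sp: "c = c0 * c1" "bihomogeneous m0 c0" "bihomogeneous m1 c1"
    "\<forall>u<nbranch. fps_nth (gm u c1) 0 \<noteq> 0" "\<forall>a b. normal_pt a b \<longrightarrow> (a, b) \<notin> fibre \<longrightarrow> eval2 c0 a b \<noteq> 0"
    using form_split[OF c(2,1)] by blast
  have c01: "c0 \<noteq> 0" "c1 \<noteq> 0" using c(1) sp(1) by auto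
  obtain k1 G where G: "form_in n k1 G" "eval_form G p \<noteq> 0" "c1 dvd pull g G"
    using form_pull_cover[OF sp(3) c01(2)] sp(4) by blast
  then obtain b1 where b1: "pull g G = c1 * b1" by (elim dvdE)
  define N where "N = (\<Sum>u<nbranch. subdegree (gm u c))"
  have main: "coord g (k1 + j) (a * pull g G)"
    if a: "bihomogeneous (j * d) a" "\<And>u. u < nbranch \<Longrightarrow> fps_X ^ N dvd gm u a" for j a
  proof (cases "a * pull g G = 0")
    case True
    then show ?thesis by (simp only: coord_zero)
  next
    case False
    have "c0 dvd a"
    proof (rule fibre_part_dvd[OF sp(2) c01(1) sp(5) a(1)])
      fix u assume u: "u < nbranch"
      have "subdegree (gm u c) \<le> N" unfolding N_def using u by (intro member_le_sum) auto
      then have "fps_X ^ subdegree (gm u c) dvd gm u a" by (rule fps_X_power_dvd_le[OF a(2)[OF u]])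
      then have "gm u c dvd gm u a"
        using has_order_dvd_iff[OF has_order_subdegree[OF gm_nonzero[OF u c(2,1)]]] by simp
      then show "gm u c0 dvd gm u a" unfolding sp(1) gm.hom_mult by (rule dvd_mult_left)
    qed
    then obtain a' where a': "a = c0 * a'" by (elim dvdE)
    have eq: "a * pull g G = (a' * b1) * c" by (simp add: a' b1 sp(1) ac_simps)
    have deg: "bihomogeneous ((k1 + j) * d) (a * pull g G)"
      using form_mult[OF a(1) form_pull[OF G(1)]] by (simp add: algebra_simps)
    then have q: "bihomogeneous ((k1 + j) * d - k * d) (a' * b1)"
      unfolding eq by (rule form_quotient[OF _ c(2,1)])
    then have "bihomogeneous ((k1 + j) * d - k * d + k * d) (a * pull g G)"
      unfolding eq by (rule form_mult[OF _ c(2)])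
    then have "(k1 + j) * d - k * d + k * d = (k1 + j) * d"
      using deg False by (rule form_degree_unique)
    then have "k * d \<le> (k1 + j) * d" by (metis le_add2)
    then have "k \<le> k1 + j" using d_pos by simp
    have "bihomogeneous ((k1 + j - k) * d) (a' * b1)" using q by (simp add: diff_mult_distrib)
    with c(3) have "coord g (k + (k1 + j - k)) (c * (a' * b1))" by blast
    then show ?thesis unfolding eq using \<open>k \<le> k1 + j\<close> by (simp add: mult.commute)
  qed
  show thesis using that[OF G(1,2)] main by blast
qed

end

context curve_point
begin

interpretation gm: comm_ring_hom "gm u" for u
  unfolding gm_def by (rule germ.comm_ring_hom_axioms)

subsection \<open>Branches as homomorphisms of the local ring\<close>

text \<open>\<open>F\<close> and \<open>G\<close> form an admissible fraction, that is, \<open>F / G\<close> is a regular function at \<open>p\<close>.\<close>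

definition adm :: "'k mpol \<Rightarrow> 'k mpol \<Rightarrow> nat \<Rightarrow> bool" where
  "adm F G e \<longleftrightarrow> form_in n e F \<and> form_in n e G \<and> eval_form G p \<noteq> 0"

lemma adm_denominator: "adm F G e \<Longrightarrow> G \<noteq> 0"
  by (auto simp: adm_def eval_form.hom_zero)

lemma adm_mult: "adm F G e \<Longrightarrow> adm F' G' e' \<Longrightarrow> adm (F * F') (G * G') (e + e')"
  by (simp add: adm_def form_in_mult eval_form.hom_mult)

lemma adm_add: "adm F G e \<Longrightarrow> adm F' G' e' \<Longrightarrow> adm (F * G' + F' * G) (G * G') (e + e')"
  using form_in_mult[of n e F e' G'] form_in_mult[of n e' F' e G]
  by (simp add: adm_def form_in_mult eval_form.hom_mult form_in_add add.commute)

abbreviation "PLoc \<equiv> proj_local_ring p"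
abbreviation "ICurve \<equiv> curve_ideal_at g p"
abbreviation "Loc \<equiv> curve_local_ring g p"
abbreviation "FPS \<equiv> ring_of_type_algebra :: 'k fps ring"

lemma PLoc_simps:
  "carrier PLoc = {Fract F G | F G e. adm F G e}"
  "x \<otimes>\<^bsub>PLoc\<^esub> y = x * y" "x \<oplus>\<^bsub>PLoc\<^esub> y = x + y" "\<one>\<^bsub>PLoc\<^esub> = 1" "\<zero>\<^bsub>PLoc\<^esub> = 0"
  unfolding proj_local_ring_def ring_of_type_algebra_def adm_def by (simp_all add: dim_p)

lemma FPS_simps:
  "carrier FPS = UNIV" "x \<otimes>\<^bsub>FPS\<^esub> y = x * y" "x \<oplus>\<^bsub>FPS\<^esub> y = x + y" "\<one>\<^bsub>FPS\<^esub> = 1" "\<zero>\<^bsub>FPS\<^esub> = 0"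
  unfolding ring_of_type_algebra_def by simp_all

lemma ring_FPS: "ring FPS"
  by (rule ring_from_type_algebra)

lemma cring_PLoc: "cring PLoc"
proof -
  let ?T = "ring_of_type_algebra :: 'k mpol fract ring"
  let ?K = "{Fract F G | F G e. adm F G e}"
  interpret T: cring ?T by (rule cring_from_type_algebra)
  have T: "carrier ?T = UNIV" "x \<otimes>\<^bsub>?T\<^esub> y = x * y" "x \<oplus>\<^bsub>?T\<^esub> y = x + y" "\<one>\<^bsub>?T\<^esub> = 1" for x y
    unfolding ring_of_type_algebra_def by simp_all
  have "subring ?K ?T"
  proof (rule T.subringI)
    show "\<one>\<^bsub>?T\<^esub> \<in> ?K"
    proof -
      have "adm 1 1 0" by (simp add: adm_def form_in_one eval_form.hom_one)
      then show ?thesis unfolding T One_fract_def by blast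
    qed
    show "\<ominus>\<^bsub>?T\<^esub> h \<in> ?K" if "h \<in> ?K" for h
      using that form_in_uminus unfolding a_inv_ring_of_type_algebra adm_def by fastforce
    show "h1 \<otimes>\<^bsub>?T\<^esub> h2 \<in> ?K" if "h1 \<in> ?K" "h2 \<in> ?K" for h1 h2
      using that unfolding T using adm_mult by fastforce
    show "h1 \<oplus>\<^bsub>?T\<^esub> h2 \<in> ?K" if h: "h1 \<in> ?K" "h2 \<in> ?K" for h1 h2
    proof -
      obtain F G e F' G' e' where *: "h1 = Fract F G" "adm F G e" "h2 = Fract F' G'" "adm F' G' e'"
        using h by blast
      then have "h1 + h2 = Fract (F * G' + F' * G) (G * G')" by (simp add: adm_denominator)
      then show ?thesis using adm_add[OF *(2,4)] unfolding T by blast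
    qed
  qed (simp add: T)
  then have "cring (?T\<lparr>carrier := ?K\<rparr>)"
    using T.subcring_iff[of ?K] T.subcringI'[of ?K] T by simp
  moreover have "?T\<lparr>carrier := ?K\<rparr> = PLoc" unfolding proj_local_ring_def adm_def by (simp add: dim_p)
  ultimately show ?thesis by simp
qed

lemma gm_pull_unit: "u < nbranch \<Longrightarrow> adm F G e \<Longrightarrow> fps_nth (gm u (pull g G)) 0 \<noteq> 0"
  using gm_pull_nth_0_iff[of u e G] by (simp add: adm_def)

lemma gm_pull_denominator: "u < nbranch \<Longrightarrow> adm F G e \<Longrightarrow> gm u (pull g G) \<noteq> 0"
  using gm_pull_unit by fastforce

text \<open>The expansion of the function \<open>F / G\<close> along the \<open>u\<close>-th branch. It is defined by its product with the expansion of
  the denominator, which is invertible since \<open>G\<close> does not vanish at \<open>p\<close>.\<close>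

definition fgerm :: "nat \<Rightarrow> 'k mpol fract \<Rightarrow> 'k fps" where
  "fgerm u z = (THE w. \<exists>F G e. adm F G e \<and> z = Fract F G \<and> w * gm u (pull g G) = gm u (pull g F))"

lemma fgerm_cross:
  assumes "Fract F G = Fract F' G'" "adm F G e" "adm F' G' e'"
  shows "gm u (pull g F) * gm u (pull g G') = gm u (pull g F') * gm u (pull g G)"
proof -
  have "F * G' = F' * G" using assms by (simp add: eq_fract adm_denominator)
  then have "pull g F * pull g G' = pull g F' * pull g G" by (simp flip: pull.hom_mult)
  then show ?thesis by (simp flip: gm.hom_mult)
qed

lemma fgerm_Fract:
  assumes u: "u < nbranch" and FG: "adm F G e"
  shows "fgerm u (Fract F G) * gm u (pull g G) = gm u (pull g F)"
proof -
  define w where "w = gm u (pull g F) * inverse (gm u (pull g G))"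
  have w: "w * gm u (pull g G) = gm u (pull g F)"
    using inverse_mult_eq_1[OF gm_pull_unit[OF u FG]] by (simp add: w_def mult.assoc)
  have "fgerm u (Fract F G) = w"
    unfolding fgerm_def
  proof (rule the_equality)
    show "\<exists>F' G' e. adm F' G' e \<and> Fract F G = Fract F' G' \<and> w * gm u (pull g G') = gm u (pull g F')"
      using w FG by blast
    fix w' assume "\<exists>F' G' e. adm F' G' e \<and> Fract F G = Fract F' G' \<and> w' * gm u (pull g G') = gm u (pull g F')"
    then obtain F' G' e' where *: "adm F' G' e'" "Fract F G = Fract F' G'"
      "w' * gm u (pull g G') = gm u (pull g F')" by blast
    have "w' * (gm u (pull g G') * gm u (pull g G)) = w * (gm u (pull g G') * gm u (pull g G))"
      using fgerm_cross[OF *(2) FG *(1), of u] *(3) w by (metis mult.assoc mult.commute)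
    then show "w' = w" using gm_pull_denominator[OF u FG] gm_pull_denominator[OF u *(1)] by simp
  qed
  then show ?thesis using w by simp
qed

lemma fgerm_unique:
  "u < nbranch \<Longrightarrow> adm F G e \<Longrightarrow> w * gm u (pull g G) = gm u (pull g F) \<Longrightarrow> fgerm u (Fract F G) = w"
  using fgerm_Fract[of u F G e] gm_pull_denominator[of u F G e] by (metis mult_cancel_right)

lemma fgerm_hom:
  assumes u: "u < nbranch"
  shows "ring_hom_ring PLoc FPS (fgerm u)"
proof (rule ring_hom_ringI[OF cring.axioms(1)[OF cring_PLoc] ring_FPS])
  show "fgerm u x \<in> carrier FPS" for x by (simp add: FPS_simps)
  show "fgerm u \<one>\<^bsub>PLoc\<^esub> = \<one>\<^bsub>FPS\<^esub>"
    unfolding PLoc_simps FPS_simps One_fract_def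
    by (rule fgerm_unique[OF u, of 1 1 0]) (simp_all add: adm_def form_in_one eval_form.hom_one)
  fix x y assume "x \<in> carrier PLoc" "y \<in> carrier PLoc"
  then obtain F G e F' G' e' where *: "x = Fract F G" "adm F G e" "y = Fract F' G'" "adm F' G' e'"
    unfolding PLoc_simps by blast
  have fx: "fgerm u x * gm u (pull g G) = gm u (pull g F)" unfolding * by (rule fgerm_Fract[OF u *(2)])
  have fy: "fgerm u y * gm u (pull g G') = gm u (pull g F')" unfolding * by (rule fgerm_Fract[OF u *(4)])
  have "fgerm u (Fract (F * F') (G * G')) = fgerm u x * fgerm u y"
    by (rule fgerm_unique[OF u adm_mult[OF *(2,4)]])
      (simp add: pull.hom_mult gm.hom_mult flip: fx fy)
  then show "fgerm u (x \<otimes>\<^bsub>PLoc\<^esub> y) = fgerm u x \<otimes>\<^bsub>FPS\<^esub> fgerm u y"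
    unfolding PLoc_simps FPS_simps by (simp add: *)
  have "fgerm u (Fract (F * G' + F' * G) (G * G')) = fgerm u x + fgerm u y"
    by (rule fgerm_unique[OF u adm_add[OF *(2,4)]])
      (simp add: pull.hom_mult gm.hom_mult pull.hom_add gm.hom_add algebra_simps flip: fx fy)
  then show "fgerm u (x \<oplus>\<^bsub>PLoc\<^esub> y) = fgerm u x \<oplus>\<^bsub>FPS\<^esub> fgerm u y"
    unfolding PLoc_simps FPS_simps *(1,3) add_fract[OF adm_denominator[OF *(2)] adm_denominator[OF *(4)]] .
qed

lemma vanishes_on_curve_iff:
  assumes F: "form_in n e F"
  shows "(\<forall>q\<in>curve g. eval_form F q = 0) \<longleftrightarrow> pull g F = 0"
proof
  assume *: "\<forall>q\<in>curve g. eval_form F q = 0"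
  show "pull g F = 0"
  proof (rule form_eq_0I[OF form_pull[OF F]])
    fix a b :: 'k assume ab: "(a, b) \<noteq> (0, 0)"
    have "proj_eq (param g a b) (param g a b)" unfolding proj_eq_def by (intro exI[of _ 1]) simp
    then have "param g a b \<in> curve g" using ab unfolding curve_def by blast
    then show "eval2 (pull g F) a b = 0" using * by (simp add: eval2_pull[OF F])
  qed
next
  assume *: "pull g F = 0"
  show "\<forall>q\<in>curve g. eval_form F q = 0"
  proof
    fix q assume "q \<in> curve g"
    then obtain a b c where q: "q = c \<cdot>\<^sub>v param g a b" by (auto simp: curve_def proj_eq_def)
    have "eval_form F (param g a b) = 0" using * eval2_pull[OF F, of a b] by simp
    then show "eval_form F q = 0" unfolding q by (simp add: eval_form_scale[OF F] param_def dim_g)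
  qed
qed

lemma ICurve_eq: "ICurve = {Fract F G | F G e. adm F G e \<and> pull g F = 0}"
proof -
  have "adm F G e \<and> pull g F = 0 \<longleftrightarrow> form_in n e F \<and> form_in n e G \<and> eval_form G p \<noteq> 0 \<and>
      (\<forall>q\<in>curve g. eval_form F q = 0)" for F G e
    using vanishes_on_curve_iff[of e F] by (auto simp: adm_def)
  then show ?thesis unfolding curve_ideal_at_def dim_p by simp
qed

lemma fgerm_eq_0_iff:
  assumes "u < nbranch" "adm F G e"
  shows "fgerm u (Fract F G) = 0 \<longleftrightarrow> pull g F = 0"
proof
  assume "fgerm u (Fract F G) = 0"
  then have "gm u (pull g F) = 0" using fgerm_Fract[OF assms] by simp
  then show "pull g F = 0" using gm_nonzero[OF assms(1) form_pull] assms(2) by (auto simp: adm_def)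
next
  assume "pull g F = 0"
  then show "fgerm u (Fract F G) = 0" by (intro fgerm_unique[OF assms]) simp
qed

text \<open>Functions that vanish along one branch vanish on the whole curve, as a form in two variables is determined by its
  expansion at any point. Hence every single branch embeds the local ring of the curve.\<close>

lemma kernel_fgerm: "u < nbranch \<Longrightarrow> a_kernel PLoc FPS (fgerm u) = ICurve"
  unfolding a_kernel_def' PLoc_simps FPS_simps ICurve_eq using fgerm_eq_0_iff by blast

definition cls :: "'k mpol \<Rightarrow> 'k mpol \<Rightarrow> 'k mpol fract set" where
  "cls F G = ICurve +>\<^bsub>PLoc\<^esub> Fract F G"

definition branch :: "nat \<Rightarrow> 'k mpol fract set \<Rightarrow> 'k fps" where
  "branch u C = the_elem (fgerm u ` C)"

lemma ideal_ICurve: "0 < nbranch \<Longrightarrow> ideal ICurve PLoc"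
  using ring_hom_ring.kernel_is_ideal[OF fgerm_hom] kernel_fgerm by metis

lemma cring_Loc: "0 < nbranch \<Longrightarrow> cring Loc"
  unfolding curve_local_ring_def by (rule ideal.quotient_is_cring[OF ideal_ICurve cring_PLoc])

lemma branch_hom: "u < nbranch \<Longrightarrow> branch u \<in> Ring.ring_hom Loc FPS"
  using ring_hom_ring.the_elem_hom[OF fgerm_hom] kernel_fgerm
  unfolding curve_local_ring_def branch_def by metis

lemma branch_cls: "u < nbranch \<Longrightarrow> adm F G e \<Longrightarrow> branch u (cls F G) = fgerm u (Fract F G)"
  using ring_hom_ring.the_elem_simp[OF fgerm_hom, of u "Fract F G"] kernel_fgerm[of u]
  unfolding branch_def cls_def PLoc_simps by auto

lemma branch_inj:
  "u < nbranch \<Longrightarrow> C \<in> carrier Loc \<Longrightarrow> D \<in> carrier Loc \<Longrightarrow> branch u C = branch u D \<Longrightarrow> C = D"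
  using ring_hom_ring.the_elem_inj[OF fgerm_hom, of u C D] kernel_fgerm[of u]
  unfolding branch_def curve_local_ring_def by auto

lemma cls_closed: "adm F G e \<Longrightarrow> cls F G \<in> carrier Loc"
  unfolding cls_def curve_local_ring_def FactRing_def A_RCOSETS_def' PLoc_simps by auto

lemma Loc_cases:
  assumes "C \<in> carrier Loc"
  obtains F G e where "adm F G e" "C = cls F G"
  using assms unfolding cls_def curve_local_ring_def FactRing_def A_RCOSETS_def' PLoc_simps by auto

lemma branch_cls_mult:
  "u < nbranch \<Longrightarrow> adm F G e \<Longrightarrow> branch u (cls F G) * gm u (pull g G) = gm u (pull g F)"
  by (simp add: branch_cls fgerm_Fract)

lemma branch_mult:
  "u < nbranch \<Longrightarrow> C \<in> carrier Loc \<Longrightarrow> D \<in> carrier Loc \<Longrightarrow> branch u (C \<otimes>\<^bsub>Loc\<^esub> D) = branch u C * branch u D"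
  using ring_hom_mult[OF branch_hom] by (simp add: FPS_simps)

lemma branch_one: "u < nbranch \<Longrightarrow> branch u \<one>\<^bsub>Loc\<^esub> = 1"
  using ring_hom_one[OF branch_hom] by (simp add: FPS_simps)

lemma cls_dvd_iff:
  assumes "u < nbranch" "adm F G e"
  shows "fps_X ^ k dvd branch u (cls F G) \<longleftrightarrow> fps_X ^ k dvd gm u (pull g F)"
proof -
  have "is_unit (gm u (pull g G))" using gm_pull_unit[OF assms] by (simp add: fps_is_unit_iff)
  then show ?thesis unfolding branch_cls_mult[OF assms, symmetric] by (simp add: dvd_mult_unit_iff)
qed

lemma cls_order:
  assumes "u < nbranch" "adm F G e" "has_order k (gm u (pull g F))"
  shows "has_order k (branch u (cls F G))"
  by (rule has_order_mult_cancel[OF _ gm_pull_unit[OF assms(1,2)]])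
    (simp add: branch_cls_mult[OF assms(1,2)] assms(3))

lemma cls_nth_0_iff:
  assumes "u < nbranch" "adm F G e"
  shows "fps_nth (branch u (cls F G)) 0 = 0 \<longleftrightarrow> eval_form F p = 0"
proof -
  have "fps_nth (branch u (cls F G)) 0 = 0 \<longleftrightarrow> fps_nth (gm u (pull g F)) 0 = 0"
    unfolding branch_cls_mult[OF assms, symmetric] using gm_pull_unit[OF assms] by simp
  also have "\<dots> \<longleftrightarrow> eval_form F p = 0" using assms(2) by (intro gm_pull_nth_0_iff[OF assms(1), of e F]) (simp add: adm_def)
  finally show ?thesis .
qed

text \<open>Homogeneity lets \<open>F\<close> be evaluated at \<open>p\<^sub>i\<^sub>0 g\<close> instead of \<open>g\<close>, and modulo \<open>X ^ em u\<close> this vector is the multiple \<open>g\<^sub>i\<^sub>0 p\<close>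
  of \<open>p\<close>, where \<open>F\<close> vanishes.\<close>

lemma vanishing_form_order:
  assumes "u < nbranch" "form_in n e F" "eval_form F p = 0"
  shows "fps_X ^ em u dvd gm u (pull g F)"
proof -
  let ?\<gamma> = "\<lambda>i. fps_const (p $ i0) * gm u (g $ i)" and ?\<gamma>' = "\<lambda>i. gm u (g $ i0) * fps_const (p $ i)"
  have pull: "gm u (pull g F) = mev fps_const (\<lambda>i. gm u (g $ i)) F"
    unfolding pull_def by (subst mev_hom[OF gm.comm_ring_hom_axioms]) simp
  have "?\<gamma> i - ?\<gamma>' i = gm u (delta i)" for i
    by (simp add: delta_def gm.hom_minus gm.hom_mult mult.commute)
  then have "fps_X ^ em u dvd mev fps_const ?\<gamma> F - mev fps_const ?\<gamma>' F"
    using em_dvd[OF assms(1)] by (intro mev_dvd_diff[OF assms(2)]) simp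
  moreover have "mev fps_const ?\<gamma>' F = gm u (g $ i0) ^ e * mev fps_const (\<lambda>i. fps_const (p $ i)) F"
    by (rule mev_scale[OF assms(2)])
  moreover have "mev fps_const (\<lambda>i. fps_const (p $ i)) F = fps_const (eval_form F p)"
    unfolding eval_form_eq_mev by (subst mev_hom[OF comm_ring_hom_fps_const]) simp
  moreover have "mev fps_const ?\<gamma> F = fps_const (p $ i0) ^ e * gm u (pull g F)"
    unfolding pull by (rule mev_scale[OF assms(2)])
  ultimately have "fps_X ^ em u dvd fps_const (p $ i0) ^ e * gm u (pull g F)" using assms(3) by simp
  moreover have "is_unit (fps_const (p $ i0) ^ e)" using i0 by (simp add: fps_is_unit_iff fps_const_power)
  ultimately show ?thesis by (simp only: mult.commute[of _ "gm u (pull g F)"] dvd_mult_unit_iff)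
qed

text \<open>On each branch some \<open>delta j\<close> has the least order \<open>em u\<close>. The combination \<open>\<Sum>j<n. \<tau>\<^sup>j delta j\<close> has it on all branches at
  once if \<open>\<tau>\<close> avoids the zeros of finitely many non-zero polynomials.\<close>

lemma generic_line:
  obtains L where "form_in n 1 L" "\<forall>u<nbranch. has_order (em u) (gm u (pull g L))"
proof -
  define w where "w = (\<lambda>u. \<Sum>j<n. monom (fps_nth (gm u (delta j)) (em u)) j)"
  have "w u \<noteq> 0" if u: "u < nbranch" for u
  proof -
    obtain j where j: "j < n" "has_order (em u) (gm u (delta j))" using em_order[OF u] by blast
    have "coeff (w u) j = (\<Sum>i<n. if i = j then fps_nth (gm u (delta j)) (em u) else 0)"
      unfolding w_def coeff_sum by (intro sum.cong) auto
    then have "coeff (w u) j \<noteq> 0" using j by (simp add: has_order_def)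
    then show ?thesis by auto
  qed
  then have "(\<Prod>u<nbranch. w u) \<noteq> 0" by simp
  then have "finite {x. poly (\<Prod>u<nbranch. w u) x = 0}" by (rule poly_roots_finite)
  then obtain \<tau> where "poly (\<Prod>u<nbranch. w u) \<tau> \<noteq> 0"
    using infinite_UNIV_char_0[where ?'a = 'k] by (metis (mono_tags, lifting) UNIV_eq_I mem_Collect_eq)
  then have \<tau>: "poly (w u) \<tau> \<noteq> 0" if "u < nbranch" for u using that by (simp add: poly_prod)
  define L where "L = (\<Sum>j<n. mcst (\<tau> ^ j) * (mcst (p $ i0) * mvar j - mcst (p $ j) * mvar i0))"
  have L: "form_in n 1 L"
    unfolding L_def by (intro form_in_sum form_in_mcst_mult form_in_diff form_in_mvar i0) auto
  have "pull g L = (\<Sum>j<n. cst (\<tau> ^ j) * delta j)"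
    by (simp add: L_def delta_def pull.hom_sum pull.hom_mult pull.hom_minus pull_const pull_mvar)
  then have gm_L: "gm u (pull g L) = (\<Sum>j<n. fps_const (\<tau> ^ j) * gm u (delta j))" for u
    by (simp add: gm.hom_sum gm.hom_mult)
  have "has_order (em u) (gm u (pull g L))" if u: "u < nbranch" for u
  proof -
    have "fps_X ^ em u dvd gm u (pull g L)"
      unfolding gm_L by (intro dvd_sum dvd_mult em_dvd u) simp
    moreover have "fps_nth (gm u (pull g L)) (em u) = poly (w u) \<tau>"
      by (simp add: gm_L w_def fps_sum_nth poly_sum poly_monom mult.commute)
    ultimately show ?thesis using \<tau>[OF u] by (simp add: has_order_def)
  qed
  then show thesis using L that by blast
qed

text \<open>The orders are those of a product of powers of the linear forms of the points above \<open>p\<close>; powers of a linear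
  form with its zero elsewhere bring the degree to a multiple of \<open>d\<close>.\<close>

lemma order_prescribed:
  obtains a where "bihomogeneous ((\<Sum>u<nbranch. w u) * d) a"
    "\<forall>u<nbranch. has_order (w u) (gm u a)"
proof -
  define W where "W = (\<Sum>u<nbranch. w u)"
  obtain c :: 'k where c: "c \<notin> fst ` fibre"
    using ex_new_if_finite[OF infinite_UNIV_char_0 finite_imageI[OF finite_fibre]] by blast
  have "normal_pt c 1" by (simp add: normal_pt_def)
  have lin_c: "has_order 0 (gm u (lin c 1))" if "u < nbranch" for u
  proof -
    have "(c, 1) \<noteq> (fst (pt u), snd (pt u))" using c pt_in_fibre[OF that] by (metis fst_conv image_eqI)
    then show ?thesis
      using eval2_lin_normal[OF \<open>normal_pt c 1\<close> pt_normal[OF that]]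
      by (simp only: has_order_0_iff gm_nth_0) blast
  qed
  define a where "a = (\<Prod>v<nbranch. lin (fst (pt v)) (snd (pt v)) ^ w v) * lin c 1 ^ (W * (d - 1))"
  have "bihomogeneous ((\<Sum>v<nbranch. w v * 1) + W * (d - 1) * 1) a"
    unfolding a_def by (intro form_mult form_prod form_power form_lin)
  moreover have "(\<Sum>v<nbranch. w v * 1) + W * (d - 1) * 1 = W * d"
    using d_pos by (cases d) (simp_all add: W_def)
  ultimately have "bihomogeneous (W * d) a" by simp
  moreover have "has_order (w u) (gm u a)" if u: "u < nbranch" for u
  proof -
    have 1: "has_order (if v = u then w u else 0) (gm u (lin (fst (pt v)) (snd (pt v))) ^ w v)"
      if v: "v < nbranch" for v
    proof (cases "v = u")
      case True
      have "has_order 1 (gm u (lin (fst (pt u)) (snd (pt u))))"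
        unfolding gm_def using germ_lin_order[OF pt_nonzero[OF u] pt_nonzero[OF u]] by (simp add: mult.commute)
      from has_order_power[OF this, of "w u"] show ?thesis using True by simp
    next
      case False
      then have "eval2 (lin (fst (pt v)) (snd (pt v))) (fst (pt u)) (snd (pt u)) \<noteq> 0"
        using eval2_lin_normal[OF pt_normal[OF v] pt_normal[OF u]] pt_eq_iff[OF v u] by (simp add: prod_eq_iff)
      then have "has_order 0 (gm u (lin (fst (pt v)) (snd (pt v))))"
        by (simp add: has_order_0_iff gm_nth_0)
      from has_order_power[OF this, of "w v"] show ?thesis using False by simp
    qed
    have "has_order (\<Sum>v<nbranch. if v = u then w u else 0)
        (\<Prod>v<nbranch. gm u (lin (fst (pt v)) (snd (pt v))) ^ w v)"
      by (rule has_order_prod) (use 1 in auto)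
    moreover have "(\<Sum>v<nbranch. if v = u then w u else 0) = w u" using u by simp
    moreover have "has_order (W * (d - 1) * 0) (gm u (lin c 1) ^ (W * (d - 1)))"
      by (rule has_order_power[OF lin_c[OF u]])
    ultimately have "has_order (w u + W * (d - 1) * 0)
      ((\<Prod>v<nbranch. gm u (lin (fst (pt v)) (snd (pt v))) ^ w v) * gm u (lin c 1) ^ (W * (d - 1)))"
      by (intro has_order_mult) simp_all
    then show ?thesis by (simp add: a_def gm.hom_mult gm.hom_prod gm.hom_power)
  qed
  ultimately show thesis using that unfolding W_def by blast
qed

text \<open>The local ring of the curve satisfies the axioms, with the points above \<open>p\<close> as branches. Attaining prescribed
  orders and dividing both rest on \<open>local_conductor\<close>; the generic element is \<open>generic_line\<close> divided by \<open>T\<^sub>i\<^sub>0\<close>.\<close>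

lemma curve_germ_Loc:
  assumes nb: "0 < nbranch"
  shows "\<exists>N f0 const. curve_germ Loc branch nbranch em N f0 const"
proof -
  obtain N k G where G: "form_in n k G" "eval_form G p \<noteq> 0"
    and cond: "\<And>j a. bihomogeneous (j * d) a \<Longrightarrow> (\<And>u. u < nbranch \<Longrightarrow> fps_X ^ N dvd gm u a) \<Longrightarrow>
      coord g (k + j) (a * pull g G)"
  proof -
    obtain N k G where "form_in n k G" "eval_form G p \<noteq> 0"
      "\<forall>j a. bihomogeneous (j * d) a \<longrightarrow> (\<forall>u<nbranch. fps_X ^ N dvd gm u a) \<longrightarrow>
        coord g (k + j) (a * pull g G)" by (rule local_conductor)
    then show thesis by (intro that[of k G N]) blast+
  qed
  obtain L where L: "form_in n 1 L" "\<forall>u<nbranch. has_order (em u) (gm u (pull g L))"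
    by (rule generic_line)
  define T where "T = (mvar i0 :: 'k mpol)"
  have T: "form_in n 1 T" "eval_form T p \<noteq> 0"
    unfolding T_def using form_in_mvar[OF i0(1)] i0(2) by (simp_all add: eval_form_mvar)
  have adm_L: "adm L T 1" using L T by (simp add: adm_def)
  have adm_c: "adm (mcst c) 1 0" for c
    by (simp add: adm_def form_in_const form_in_one eval_form.hom_one)
  interpret Loc: cring Loc by (rule cring_Loc[OF nb])
  have "curve_germ Loc branch nbranch em N (cls L T) (\<lambda>c. cls (mcst c) 1)"
  proof (intro curve_germ.intro curve_germ_axioms.intro Loc.is_cring)
    show "0 < nbranch" by (rule nb)
    show "branch u \<one>\<^bsub>Loc\<^esub> = 1" if "u < nbranch" for u by (rule branch_one[OF that])
    show "branch u (C \<oplus>\<^bsub>Loc\<^esub> D) = branch u C + branch u D"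
      if "u < nbranch" "C \<in> carrier Loc" "D \<in> carrier Loc" for u C D
      using ring_hom_add[OF branch_hom[OF that(1)] that(2,3)] by (simp add: FPS_simps)
    show "branch u (C \<otimes>\<^bsub>Loc\<^esub> D) = branch u C * branch u D"
      if "u < nbranch" "C \<in> carrier Loc" "D \<in> carrier Loc" for u C D
      by (rule branch_mult[OF that])
    show "C = \<zero>\<^bsub>Loc\<^esub>" if "u < nbranch" "C \<in> carrier Loc" "branch u C = 0" for u C
    proof (rule branch_inj[OF that(1,2) Loc.zero_closed])
      have "branch u \<zero>\<^bsub>Loc\<^esub> = 0"
        using ring_hom_zero[OF branch_hom[OF that(1)] Loc.ring_axioms ring_FPS] by (simp add: FPS_simps)
      then show "branch u C = branch u \<zero>\<^bsub>Loc\<^esub>" using that(3) by simp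
    qed
    show "cls (mcst c) 1 \<in> carrier Loc" for c by (rule cls_closed[OF adm_c])
    show "branch u (cls (mcst c) 1) = fps_const c" if "u < nbranch" for u c
      using branch_cls_mult[OF that adm_c, of c] by (simp add: pull_const)
    show "C \<in> Units Loc" if C: "C \<in> carrier Loc" "u < nbranch" "fps_nth (branch u C) 0 \<noteq> 0" for u C
    proof -
      obtain F H e where FH: "adm F H e" "C = cls F H" by (rule Loc_cases[OF C(1)])
      have "eval_form F p \<noteq> 0" using that(3) cls_nth_0_iff[OF that(2) FH(1)] FH(2) by simp
      then have HF: "adm H F e" using FH(1) by (simp add: adm_def)
      have D: "cls H F \<in> carrier Loc" by (rule cls_closed[OF HF])
      have "branch u C * branch u (cls H F) = 1"
      proof -
        have "branch u C * branch u (cls H F) * (gm u (pull g H) * gm u (pull g F)) =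
            (branch u C * gm u (pull g H)) * (branch u (cls H F) * gm u (pull g F))"
          by (simp only: ac_simps)
        also have "\<dots> = gm u (pull g H) * gm u (pull g F)"
          unfolding FH(2) branch_cls_mult[OF that(2) FH(1)] branch_cls_mult[OF that(2) HF]
          by (rule mult.commute)
        finally show ?thesis
          using gm_pull_denominator[OF that(2) FH(1)] gm_pull_denominator[OF that(2) HF] by simp
      qed
      then have "branch u (C \<otimes>\<^bsub>Loc\<^esub> cls H F) = branch u \<one>\<^bsub>Loc\<^esub>"
        by (simp add: branch_mult[OF that(2,1) D] branch_one[OF that(2)])
      then have "C \<otimes>\<^bsub>Loc\<^esub> cls H F = \<one>\<^bsub>Loc\<^esub>"
        using branch_inj[OF that(2)] that(1) D by blast
      then show ?thesis using that(1) D Loc.m_comm[OF that(1) D] unfolding Units_def by auto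
    qed
    show "0 < em u" if "u < nbranch" for u by (rule em_pos[OF that])
    show "fps_X ^ em v dvd branch v C"
      if C: "C \<in> carrier Loc" "u < nbranch" "v < nbranch" "fps_nth (branch u C) 0 = 0" for u v C
    proof -
      obtain F H e where FH: "adm F H e" "C = cls F H" by (rule Loc_cases[OF C(1)])
      then have "eval_form F p = 0" using that(4) cls_nth_0_iff[OF that(2) FH(1)] by simp
      then have "fps_X ^ em v dvd gm v (pull g F)"
        using vanishing_form_order[OF that(3), of e F] FH(1) by (simp add: adm_def)
      then show ?thesis using cls_dvd_iff[OF that(3) FH(1)] FH(2) by simp
    qed
    show "cls L T \<in> carrier Loc" by (rule cls_closed[OF adm_L])
    show "has_order (em u) (branch u (cls L T))" if "u < nbranch" for u
      using cls_order[OF that adm_L] L(2) that by blast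
    show "\<exists>C\<in>carrier Loc. \<forall>u<nbranch. has_order (w u) (branch u C)"
      if "\<And>u. u < nbranch \<Longrightarrow> N \<le> w u" for w
    proof -
      obtain a where a: "bihomogeneous ((\<Sum>u<nbranch. w u) * d) a"
        "\<forall>u<nbranch. has_order (w u) (gm u a)" by (rule order_prescribed)
      let ?W = "\<Sum>u<nbranch. w u"
      have "fps_X ^ N dvd gm u a" if "u < nbranch" for u
        using a(2) that fps_X_power_dvd_le \<open>\<And>u. u < nbranch \<Longrightarrow> N \<le> w u\<close>[OF that]
        by (auto simp: has_order_def)
      then obtain F where F: "form_in n (k + ?W) F" "pull g F = a * pull g G"
        using cond[OF a(1)] unfolding coord_def dim_g by blast
      have "adm F (G * T ^ ?W) (k + ?W)"
        using F(1) form_in_mult[OF G(1) form_in_power[OF T(1), of ?W]] G(2) T(2)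
        by (simp add: adm_def eval_form.hom_mult eval_form.hom_power)
      moreover have "has_order (w u) (gm u (pull g F))" if "u < nbranch" for u
      proof -
        have "has_order 0 (gm u (pull g G))" using G gm_pull_nth_0_iff[OF that G(1)] by (simp add: has_order_0_iff)
        then have "has_order (w u + 0) (gm u a * gm u (pull g G))" using a(2) that by (intro has_order_mult) blast+
        then show ?thesis by (simp add: F(2) gm.hom_mult)
      qed
      ultimately show ?thesis using cls_closed cls_order by blast
    qed
    show "\<exists>Z\<in>carrier Loc. D = C \<otimes>\<^bsub>Loc\<^esub> Z"
      if C: "C \<in> carrier Loc" and D: "D \<in> carrier Loc" and "C \<noteq> \<zero>\<^bsub>Loc\<^esub>"
        and dv: "\<And>u. u < nbranch \<Longrightarrow> fps_X ^ N * branch u C dvd branch u D" for C D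
    proof -
      obtain F1 G1 e1 where C': "adm F1 G1 e1" "C = cls F1 G1" by (rule Loc_cases[OF C])
      obtain F2 G2 e2 where D': "adm F2 G2 e2" "D = cls F2 G2" by (rule Loc_cases[OF D])
      have forms: "form_in n e1 F1" "form_in n e1 G1" "form_in n e2 F2" "form_in n e2 G2"
        using C' D' by (auto simp: adm_def)
      have "pull g F1 \<noteq> 0"
      proof
        assume "pull g F1 = 0"
        then have "branch 0 C = 0" using branch_cls[OF nb C'(1)] fgerm_eq_0_iff[OF nb C'(1)] C'(2) by simp
        moreover have "branch 0 \<zero>\<^bsub>Loc\<^esub> = 0"
          using ring_hom_zero[OF branch_hom[OF nb] Loc.ring_axioms ring_FPS] by (simp add: FPS_simps)
        ultimately show False using branch_inj[OF nb C Loc.zero_closed] \<open>C \<noteq> \<zero>\<^bsub>Loc\<^esub>\<close> by simp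
      qed
      obtain f0 f1 m0 m1 where sp: "pull g F1 = f0 * f1" "bihomogeneous m0 f0" "bihomogeneous m1 f1"
        "\<forall>u<nbranch. fps_nth (gm u f1) 0 \<noteq> 0"
        "\<forall>a b. normal_pt a b \<longrightarrow> (a, b) \<notin> fibre \<longrightarrow> eval2 f0 a b \<noteq> 0"
        using form_split[OF form_pull[OF forms(1)] \<open>pull g F1 \<noteq> 0\<close>] by blast
      have f01: "f0 \<noteq> 0" "f1 \<noteq> 0" using \<open>pull g F1 \<noteq> 0\<close> sp(1) by auto
      obtain h H where H: "form_in n h H" "eval_form H p \<noteq> 0" "f1 dvd pull g H"
        using form_pull_cover[OF sp(3) f01(2)] sp(4) by blast
      obtain b1 where b1: "pull g H = f1 * b1" using H(3) by (elim dvdE)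
      have dvF: "fps_X ^ N * gm u (pull g F1) dvd gm u (pull g F2)" if "u < nbranch" for u
      proof -
        have "fps_X ^ N * branch u C * gm u (pull g G1) dvd branch u D * gm u (pull g G1)"
          by (rule mult_dvd_mono[OF dv[OF that] dvd_refl])
        then have "fps_X ^ N * gm u (pull g F1) dvd branch u D * gm u (pull g G1)"
          using branch_cls_mult[OF that C'(1)] C'(2) by (simp add: mult.assoc)
        then have "fps_X ^ N * gm u (pull g F1) dvd branch u D * gm u (pull g G1) * gm u (pull g G2)"
          by (rule dvd_mult2)
        then have "fps_X ^ N * gm u (pull g F1) dvd gm u (pull g F2) * gm u (pull g G1)"
          using branch_cls_mult[OF that D'(1)] D'(2) by (simp add: ac_simps)
        moreover have "is_unit (gm u (pull g G1))" using gm_pull_unit[OF that C'(1)] by (simp add: fps_is_unit_iff)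
        ultimately show ?thesis by (simp add: dvd_mult_unit_iff)
      qed
      have "f0 dvd pull g F2"
      proof (rule fibre_part_dvd[OF sp(2) f01(1) sp(5) form_pull[OF forms(3)]])
        fix u assume "u < nbranch"
        from dvF[OF this] show "gm u f0 dvd gm u (pull g F2)"
          unfolding sp(1) gm.hom_mult by (metis dvd_mult_left dvd_mult_right)
      qed
      then obtain a' where a': "pull g F2 = f0 * a'" by (elim dvdE)
      \<comment> \<open>The quotient of the two functions is \<open>a / (G2 H)\<close> on the projective line, with \<open>H\<close> absorbing the zeros of
        \<open>F1\<close> that do not lie above \<open>p\<close>. The conductor turns it into a quotient of forms on the curve.\<close>
      define a where "a = a' * pull g G1 * b1"
      have aF1: "a * pull g F1 = pull g F2 * pull g G1 * pull g H"
        by (simp add: a_def a' b1 sp(1) ac_simps)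
      have "bihomogeneous ((e2 * d + e1 * d + h * d) - e1 * d) a"
      proof (rule form_quotient[OF _ form_pull[OF forms(1)] \<open>pull g F1 \<noteq> 0\<close>])
        show "bihomogeneous (e2 * d + e1 * d + h * d) (a * pull g F1)"
          unfolding aF1 by (intro form_mult form_pull forms H)
      qed
      then have "bihomogeneous ((e2 + h) * d) a" by (simp add: algebra_simps)
      moreover have "fps_X ^ N dvd gm u a" if u: "u < nbranch" for u
      proof -
        have "gm u f0 \<noteq> 0" by (rule gm_nonzero[OF u sp(2) f01(1)])
        moreover have "gm u f0 * (fps_X ^ N * gm u f1) dvd gm u f0 * gm u a'"
          using dvF[OF u] unfolding sp(1) a' gm.hom_mult by (simp add: ac_simps)
        ultimately have "fps_X ^ N * gm u f1 dvd gm u a'" by simp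
        then show ?thesis unfolding a_def gm.hom_mult by (metis dvd_mult2 dvd_mult_left)
      qed
      ultimately have "coord g (k + (e2 + h)) (a * pull g G)" by (rule cond)
      then obtain A where A: "form_in n (k + (e2 + h)) A" "pull g A = a * pull g G"
        unfolding coord_def dim_g by blast
      define B where "B = G * (G2 * H)"
      have AB: "adm A B (k + (e2 + h))"
        using A(1) form_in_mult[OF G(1) form_in_mult[OF forms(4) H(1)]] G(2) H(2) D'(1)
        by (simp add: adm_def B_def eval_form.hom_mult)
      have Z: "cls A B \<in> carrier Loc" by (rule cls_closed[OF AB])
      have "branch 0 D = branch 0 C * branch 0 (cls A B)"
      proof -
        let ?m = "\<lambda>F. gm 0 (pull g F)"
        have c: "branch 0 C * ?m G1 = ?m F1" using branch_cls_mult[OF nb C'(1)] C'(2) by simp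
        have d: "branch 0 D * ?m G2 = ?m F2" using branch_cls_mult[OF nb D'(1)] D'(2) by simp
        have z: "branch 0 (cls A B) * (?m G * (?m G2 * ?m H)) = gm 0 a * ?m G"
          using branch_cls_mult[OF nb AB] by (simp add: A(2) B_def pull.hom_mult gm.hom_mult)
        have aF: "gm 0 a * ?m F1 = ?m F2 * ?m G1 * ?m H"
          using arg_cong[OF aF1, of "gm 0"] by (simp add: gm.hom_mult)
        have "branch 0 C * branch 0 (cls A B) * (?m G1 * (?m G * (?m G2 * ?m H))) =
            (branch 0 C * ?m G1) * (branch 0 (cls A B) * (?m G * (?m G2 * ?m H)))"
          by (simp add: ac_simps)
        also have "\<dots> = (gm 0 a * ?m F1) * ?m G" unfolding c z by (simp add: ac_simps)
        also have "\<dots> = (branch 0 D * ?m G2) * ?m G1 * ?m H * ?m G" unfolding aF d by (simp add: ac_simps)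
        also have "\<dots> = branch 0 D * (?m G1 * (?m G * (?m G2 * ?m H)))" by (simp add: ac_simps)
        finally show ?thesis
          using gm_pull_denominator[OF nb C'(1)] gm_pull_denominator[OF nb AB]
          by (simp add: B_def pull.hom_mult gm.hom_mult)
      qed
      then have "branch 0 D = branch 0 (C \<otimes>\<^bsub>Loc\<^esub> cls A B)" by (simp add: branch_mult[OF nb C Z])
      then have "D = C \<otimes>\<^bsub>Loc\<^esub> cls A B" using branch_inj[OF nb D] C Z by blast
      then show ?thesis using Z by blast
    qed
  qed
  then show ?thesis by blast
qed

theorem local_invariants:
  assumes "0 < nbranch"
  shows "samuel_multiplicity Loc = (\<Sum>u<nbranch. em u)" "branch_number Loc = nbranch"
    "regular_local_ring Loc \<Longrightarrow> u < nbranch \<Longrightarrow> em u = 1"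
proof -
  obtain N f0 const where "curve_germ Loc branch nbranch em N f0 const"
    using curve_germ_Loc[OF assms] by blast
  then interpret curve_germ Loc branch nbranch em N f0 const .
  show "samuel_multiplicity Loc = (\<Sum>u<nbranch. em u)" by (rule samuel_multiplicity_eq)
  show "branch_number Loc = nbranch" by (rule branch_number_eq)
  show "em u = 1" if "regular_local_ring Loc" "u < nbranch" by (rule regular_imp_unramified[OF that])
qed

end

section \<open>Greatest common divisors of ideals and of forms\<close>

lemma ideal_of_multiples:
  "ideal {x. c dvd x} (ring_of_type_algebra :: 'a :: comm_ring_1 ring)"
proof -
  interpret ring "ring_of_type_algebra :: 'a ring" by (rule ring_from_type_algebra)
  have T: "carrier (ring_of_type_algebra :: 'a ring) = UNIV"
    "x \<otimes>\<^bsub>ring_of_type_algebra\<^esub> y = x * y" "x \<oplus>\<^bsub>ring_of_type_algebra\<^esub> y = x + y"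
    "\<zero>\<^bsub>ring_of_type_algebra\<^esub> = (0 :: 'a)" for x y :: 'a
    unfolding ring_of_type_algebra_def by simp_all
  show ?thesis
  proof (rule idealI[OF ring_axioms])
    show "subgroup {x. c dvd x} (add_monoid (ring_of_type_algebra :: 'a ring))"
    proof (rule group.subgroupI[OF a_group])
      show "{x. c dvd x} \<noteq> {}" using dvd_0_right by blast
      fix x assume x: "x \<in> {x. c dvd x}"
      show "inv\<^bsub>add_monoid (ring_of_type_algebra :: 'a ring)\<^esub> x \<in> {x. c dvd x}"
        unfolding a_inv_def[symmetric] a_inv_ring_of_type_algebra using x by simp
    qed (simp_all add: T)
  qed (simp_all add: T)
qed

lemma common_divisor_gen_ideal: "(\<forall>x\<in>gen_ideal S. c dvd x) \<longleftrightarrow> (\<forall>x\<in>S. c dvd x)"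
proof
  interpret ring "ring_of_type_algebra :: 'a ring" by (rule ring_from_type_algebra)
  have "S \<subseteq> gen_ideal S"
    unfolding gen_ideal_def by (rule genideal_self) (simp add: ring_of_type_algebra_def)
  then show "\<forall>x\<in>S. c dvd x" if "\<forall>x\<in>gen_ideal S. c dvd x" using that by blast
  assume "\<forall>x\<in>S. c dvd x"
  then have "gen_ideal S \<subseteq> {x. c dvd x}"
    unfolding gen_ideal_def by (intro genideal_minimal[OF ideal_of_multiples]) auto
  then show "\<forall>x\<in>gen_ideal S. c dvd x" by blast
qed

lemma is_gcd_cong:
  assumes "\<And>c. (\<forall>x\<in>S. c dvd x) \<longleftrightarrow> (\<forall>x\<in>T. c dvd x)"
  shows "is_gcd S h \<longleftrightarrow> is_gcd T h"
  unfolding is_gcd_def by (simp only: assms)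

lemma is_gcd_gen_ideal: "is_gcd (gen_ideal S) h \<longleftrightarrow> is_gcd S h"
  by (rule is_gcd_cong) (rule common_divisor_gen_ideal)

lemma is_gcd_unique: "is_gcd S h \<Longrightarrow> is_gcd S h' \<Longrightarrow> h dvd h'"
  by (simp add: is_gcd_def)

text \<open>A form is the greatest common divisor of a set of forms if at each point of the projective line its order is the
  least order of the set. Common divisors are compared locally, since they are forms themselves.\<close>

lemma is_gcd_formsI:
  fixes T :: "'k :: alg_closed_field poly poly set"
  assumes forms: "\<And>t. t \<in> T \<Longrightarrow> \<exists>m. bihomogeneous m t" and t0: "t0 \<in> T" "t0 \<noteq> 0"
    and h: "bihomogeneous m h" "h \<noteq> 0"
    and order: "\<And>a b. normal_pt a b \<Longrightarrow>
      \<exists>k. has_order k (germ a b h) \<and> (\<forall>t\<in>T. fps_X ^ k dvd germ a b t) \<and> (\<exists>t\<in>T. has_order k (germ a b t))"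
  shows "is_gcd T h"
  unfolding is_gcd_def
proof (intro conjI ballI allI impI)
  fix t assume t: "t \<in> T"
  then obtain m' where "bihomogeneous m' t" using forms by blast
  then show "h dvd t"
  proof (rule form_dvdI[OF h])
    fix a b :: 'k assume "normal_pt a b"
    then show "germ a b h dvd germ a b t" using order[of a b] t has_order_dvd_iff by blast
  qed
next
  fix c assume c: "\<forall>t\<in>T. c dvd t"
  obtain m0 where "bihomogeneous m0 t0" using forms t0 by blast
  then obtain i where i: "bihomogeneous i c" "c \<noteq> 0"
    using form_divisor[of m0 t0 c] t0 c by blast
  show "c dvd h"
  proof (rule form_dvdI[OF i h(1)])
    fix a b :: 'k assume "normal_pt a b"
    then obtain k t where k: "has_order k (germ a b h)" "t \<in> T" "has_order k (germ a b t)"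
      using order by blast
    have "germ a b t dvd germ a b h"
      using k has_order_dvd_iff[OF k(3)] by (simp add: has_order_def)
    moreover obtain c' where "t = c * c'" using c k(2) by (auto elim: dvdE)
    ultimately show "germ a b c dvd germ a b h" by (auto simp: germ.hom_mult elim: dvd_mult_left)
  qed
qed

lemma linear_form_cases:
  fixes l :: "'k :: alg_closed_field poly poly"
  assumes "linear_form l"
  obtains a b k where "normal_pt a b" "k \<noteq> 0" "l = cst k * lin a b"
proof -
  have l: "bihomogeneous 1 l" "l \<noteq> 0" using assms by (auto simp: linear_form_def)
  obtain a b where ab: "normal_pt a b" "eval2 l a b = 0" using form_has_root[OF l(1)] by auto
  obtain f where f: "l = lin a b * f" "bihomogeneous (1 - 1) f"
    by (rule form_root_factor[OF l(1) normal_pt_nonzero[OF ab(1)] ab(2)])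
  obtain k where "f = cst k" using f(2) by (auto elim: form_0_const)
  with f l(2) ab(1) that[of a b k] show thesis by (auto simp: mult.commute)
qed

lemma germ_lin_normal_order:
  fixes a b c e :: "'k :: field"
  assumes "normal_pt a b" "normal_pt c e"
  shows "has_order (if (c, e) = (a, b) then 1 else 0) (germ a b (lin c e))"
proof -
  have "e * a = c * b \<longleftrightarrow> (c, e) = (a, b)"
    using eval2_lin_normal[OF assms(2,1)] by (simp add: eval2_lin)
  then show ?thesis
    using germ_lin_order[OF normal_pt_nonzero[OF assms(1)] normal_pt_nonzero[OF assms(2)]] by simp
qed

lemma associates_cst_lin:
  fixes k k' :: "'k :: field"
  assumes "k \<noteq> 0" "k' \<noteq> 0"
  shows "associates (cst k * lin a b) (cst k' * lin a b)"
proof -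
  have "cst k * h dvd cst k' * h" if "k \<noteq> 0" for k k' :: 'k and h
    using unit_imp_dvd[OF cst_dvd_1[OF that]] by (intro mult_dvd_mono dvd_refl)
  then show ?thesis using assms unfolding associates_def by blast
qed

lemma germ_order_prod_powers:
  fixes l :: "nat \<Rightarrow> 'k :: alg_closed_field poly poly"
  assumes ab: "normal_pt a b"
    and lin: "\<And>u. u < s \<Longrightarrow> normal_pt (fst (r u)) (snd (r u)) \<and> k u \<noteq> 0 \<and>
      l u = cst (k u) * lin (fst (r u)) (snd (r u))"
  shows "has_order (\<Sum>u<s. if r u = (a, b) then e u else 0) (germ a b (\<Prod>u<s. l u ^ e u))"
proof -
  have "has_order (if r u = (a, b) then e u else 0) (germ a b (l u) ^ e u)" if u: "u < s" for u
  proof -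
    have "has_order 0 (fps_const (k u))" using lin[OF u] by (simp add: has_order_0_iff)
    then have "has_order (0 + (if r u = (a, b) then 1 else 0)) (fps_const (k u) * germ a b (lin (fst (r u)) (snd (r u))))"
      using lin[OF u] germ_lin_normal_order[OF ab, of "fst (r u)" "snd (r u)"] by (intro has_order_mult) simp_all
    then have "has_order (if r u = (a, b) then 1 else 0) (germ a b (l u))"
      using lin[OF u] by (simp add: germ.hom_mult)
    from has_order_power[OF this, of "e u"] show ?thesis by (cases "r u = (a, b)") simp_all
  qed
  then show ?thesis
    unfolding germ.hom_prod germ.hom_power by (intro has_order_prod) auto
qed

lemma total_degree_form:
  assumes "bihomogeneous d f" "f \<noteq> 0"
  shows "total_degree f = d"
proof -
  obtain i j where "coeff (coeff f j) i \<noteq> 0" using assms(2) by (metis leading_coeff_0_iff)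
  then have "{i + j | i j. coeff (coeff f j) i \<noteq> 0} = {d}"
    using assms(1) unfolding bihomogeneous_def by blast
  then show ?thesis unfolding total_degree_def by simp
qed

lemma associate_forms_degree:
  fixes f h :: "'k :: alg_closed_field poly poly"
  assumes "bihomogeneous d f" "f \<noteq> 0" "f dvd h" "h dvd f"
  shows "total_degree h = d"
proof -
  obtain i where i: "bihomogeneous i h" "h \<noteq> 0" "i \<le> d" by (rule form_divisor[OF assms(1,2,4)])
  obtain j where j: "bihomogeneous j f" "j \<le> i" by (rule form_divisor[OF i(1,2) assms(3)])
  have "j = d" by (rule form_degree_unique[OF j(1) assms(1,2)])
  then show ?thesis using total_degree_form[OF i(1,2)] i(3) j(2) by simp
qed

section \<open>Minors\<close>

lemma pick_singleton: "pick {j} 0 = j"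
  by (auto intro: Least_equality)

lemma pick_pair:
  assumes "j < k"
  shows "pick {j, k} 0 = j" "pick {j, k} (Suc 0) = k"
proof -
  show 0: "pick {j, k} 0 = j" using assms by (auto intro: Least_equality)
  show "pick {j, k} (Suc 0) = k" unfolding pick.simps(2) 0 using assms by (auto intro: Least_equality)
qed

lemma det_two:
  assumes "A \<in> carrier_mat 2 2"
  shows "det A = A $$ (0, 0) * A $$ (1, 1) - A $$ (0, 1) * A $$ (1, 0)"
proof -
  have m: "mat_delete A 0 0 \<in> carrier_mat 1 1" "mat_delete A 0 1 \<in> carrier_mat 1 1"
    using assms mat_delete_carrier[of A 2 2] by simp_all
  have "det A = (\<Sum>j<2. A $$ (0, j) * cofactor A 0 j)"
    by (rule laplace_expansion_row[OF assms]) simp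
  also have "\<dots> = A $$ (0, 0) * cofactor A 0 0 + A $$ (0, 1) * cofactor A 0 1"
    by (simp add: numeral_2_eq_2)
  also have "cofactor A 0 0 = A $$ (1, 1)"
    using det_single[OF m(1)] assms by (simp add: cofactor_def mat_delete_def)
  also have "cofactor A 0 1 = - A $$ (1, 0)"
    using det_single[OF m(2)] assms by (simp add: cofactor_def mat_delete_def)
  finally show ?thesis by simp
qed

lemma minors_ideal_1_row:
  assumes "dim_row M = 1"
  shows "minors_ideal 1 M = gen_ideal {M $$ (0, j) | j. j < dim_col M}"
proof -
  have sub: "det (submatrix M {0} {j}) = M $$ (0, j)" if "j < dim_col M" for j
  proof -
    have "{i. i < dim_row M \<and> i \<in> {0}} = {0}" "{i. i < dim_col M \<and> i \<in> {j}} = {j}"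
      using assms that by auto
    then have s: "submatrix M {0} {j} \<in> carrier_mat 1 1"
      "submatrix M {0} {j} $$ (0, 0) = M $$ (pick {0} 0, pick {j} 0)"
      by (simp_all add: submatrix_def)
    show ?thesis unfolding det_single[OF s(1)] s(2) pick_singleton ..
  qed
  have "{det (submatrix M I J) | I J. I \<subseteq> {..<dim_row M} \<and> J \<subseteq> {..<dim_col M} \<and> card I = 1 \<and> card J = 1}
      = {M $$ (0, j) | j. j < dim_col M}" (is "?L = ?R")
  proof
    show "?L \<subseteq> ?R"
    proof
      fix x assume "x \<in> ?L"
      then obtain I J where IJ: "x = det (submatrix M I J)" "I \<subseteq> {..<dim_row M}" "J \<subseteq> {..<dim_col M}"
        "card I = 1" "card J = 1" by blast
      obtain i j where "I = {i}" "J = {j}" using IJ(4,5) by (auto simp: card_1_singleton_iff)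
      moreover have "i = 0" "j < dim_col M" using calculation IJ assms by auto
      ultimately show "x \<in> ?R" using IJ(1) sub[of j] by auto
    qed
    show "?R \<subseteq> ?L"
    proof
      fix x assume "x \<in> ?R"
      then obtain j where j: "x = M $$ (0, j)" "j < dim_col M" by blast
      then have "x = det (submatrix M {0} {j})" using sub by simp
      moreover have "{0} \<subseteq> {..<dim_row M}" "{j} \<subseteq> {..<dim_col M}" "card {0 :: nat} = 1" "card {j} = 1"
        using assms j by auto
      ultimately show "x \<in> ?L" by blast
    qed
  qed
  then show ?thesis unfolding minors_ideal_def by simp
qed

lemma minors_ideal_2_rows:
  assumes "dim_row M = 2"
  shows "minors_ideal 2 M = gen_ideal {M $$ (0, j) * M $$ (1, k) - M $$ (0, k) * M $$ (1, j) | j k. j < k \<and> k < dim_col M}"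
proof -
  have sub: "det (submatrix M {0, 1} {j, k}) = M $$ (0, j) * M $$ (1, k) - M $$ (0, k) * M $$ (1, j)"
    if "j < k" "k < dim_col M" for j k
  proof -
    have "{i. i < dim_row M \<and> i \<in> {0, 1}} = {0, 1}" "{i. i < dim_col M \<and> i \<in> {j, k}} = {j, k}"
      using assms that by auto
    moreover have "card {j, k} = 2" using that by simp
    ultimately have s: "submatrix M {0, 1} {j, k} = mat 2 2 (\<lambda>(i, l). M $$ (pick {0, 1} i, pick {j, k} l))"
      by (simp add: submatrix_def numeral_2_eq_2)
    have p: "pick {0, 1} 0 = 0" "pick {0, 1} 1 = 1" "pick {j, k} 0 = j" "pick {j, k} 1 = k"
      using pick_pair[of 0 1] pick_pair[OF that(1)] by (simp_all del: pick.simps)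
    show ?thesis unfolding s by (subst det_two) (simp_all add: p del: pick.simps One_nat_def)
  qed
  have "{det (submatrix M I J) | I J. I \<subseteq> {..<dim_row M} \<and> J \<subseteq> {..<dim_col M} \<and> card I = 2 \<and> card J = 2}
      = {M $$ (0, j) * M $$ (1, k) - M $$ (0, k) * M $$ (1, j) | j k. j < k \<and> k < dim_col M}" (is "?L = ?R")
  proof
    show "?L \<subseteq> ?R"
    proof
      fix x assume "x \<in> ?L"
      then obtain I J where IJ: "x = det (submatrix M I J)" "I \<subseteq> {..<dim_row M}" "J \<subseteq> {..<dim_col M}"
        "card I = 2" "card J = 2" by blast
      have "{..<dim_row M} = {0, 1}" using assms by auto
      then have "I = {0, 1}" using IJ(2,4) by (intro card_subset_eq) auto
      obtain j k where jk: "J = {j, k}" "j < k"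
      proof -
        obtain j k where "J = {j, k}" "j \<noteq> k" using IJ(5) by (auto simp: card_2_iff)
        then show thesis using that[of j k] that[of k j] by (cases "j < k") auto
      qed
      then have "k < dim_col M" using IJ(3) by auto
      then show "x \<in> ?R" using IJ(1) \<open>I = {0, 1}\<close> jk sub[OF jk(2)] by auto
    qed
    show "?R \<subseteq> ?L"
    proof
      fix x assume "x \<in> ?R"
      then obtain j k where jk: "x = M $$ (0, j) * M $$ (1, k) - M $$ (0, k) * M $$ (1, j)" "j < k" "k < dim_col M"
        by blast
      then have "x = det (submatrix M {0, 1} {j, k})" using sub by simp
      moreover have "{0, 1} \<subseteq> {..<dim_row M}" "{j, k} \<subseteq> {..<dim_col M}" "card {0 :: nat, 1} = 2" "card {j, k} = 2"
        using assms jk by auto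
      ultimately show "x \<in> ?L" by blast
    qed
  qed
  then show ?thesis unfolding minors_ideal_def by simp
qed

section \<open>Derivatives\<close>

lemma coeff_deriv_x: "coeff (coeff (deriv_x f) j) i = of_nat (Suc i) * coeff (coeff f j) (Suc i)"
  by (simp add: deriv_x_def coeff_map_poly coeff_pderiv)

lemma coeff_deriv_y: "coeff (coeff (deriv_y f) j) i = of_nat (Suc j) * coeff (coeff f (Suc j)) i"
  by (simp add: deriv_y_def coeff_pderiv of_nat_poly)

lemma euler_formula:
  assumes "bihomogeneous d f"
  shows "varx * deriv_x f + vary * deriv_y f = cst (of_nat d) * f"
proof (rule poly_poly_eqI)
  fix i j
  have x: "coeff (coeff (varx * h) j) i = (if i = 0 then 0 else coeff (coeff h j) (i - 1))" for h :: "'a poly poly" and i j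
    by (simp add: varx_def coeff_pCons split: nat.split)
  have y: "coeff (coeff (vary * h) j) i = (if j = 0 then 0 else coeff (coeff h (j - 1)) i)" for h :: "'a poly poly" and i j
    by (simp add: vary_def coeff_pCons split: nat.split)
  have "coeff (coeff (varx * deriv_x f + vary * deriv_y f) j) i = of_nat (i + j) * coeff (coeff f j) i"
    by (cases i; cases j) (simp_all add: x y coeff_deriv_x coeff_deriv_y algebra_simps)
  also have "\<dots> = of_nat d * coeff (coeff f j) i"
    using assms by (cases "coeff (coeff f j) i = 0") (auto simp: bihomogeneous_def)
  finally show "coeff (coeff (varx * deriv_x f + vary * deriv_y f) j) i = coeff (coeff (cst (of_nat d) * f) j) i"
    by (simp add: cst_def)
qed

lemma germ_deriv:
  "fps_deriv (germ a b f) = fps_const (if b = 0 then 0 else 1) * germ a b (deriv_x f) +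
     fps_const (if b = 0 then 1 else 0) * germ a b (deriv_y f)"
proof -
  let ?a = "fps_const (if b = 0 then 0 else 1)" and ?b = "fps_const (if b = 0 then 1 else 0)"
  have inner: "fps_deriv (germ a b [:p:]) = ?a * germ a b [:pderiv p:]" for p
  proof (induction p)
    case (pCons c p)
    have 1: "[:pCons c p:] = cst c + varx * [:p:]" by (simp add: cst_def varx_def)
    have 2: "[:pderiv (pCons c p):] = [:p:] + varx * [:pderiv p:]" by (simp add: varx_def pderiv_pCons)
    show ?case unfolding 1 2 germ.hom_add germ.hom_mult germ_varx germ_cst
      by (simp add: pCons algebra_simps)
  qed simp
  show ?thesis
  proof (induction f)
    case (pCons p f)
    have 1: "pCons p f = [:p:] + vary * f" by (simp add: vary_def)
    have 2: "deriv_x (pCons p f) = [:pderiv p:] + vary * deriv_x f"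
      by (simp add: deriv_x_def vary_def map_poly_pCons)
    have 3: "deriv_y (pCons p f) = f + vary * deriv_y f"
      by (simp add: deriv_y_def vary_def pderiv_pCons)
    show ?case unfolding 2 3 unfolding 1 germ.hom_add germ.hom_mult germ_vary
      by (simp add: pCons inner algebra_simps)
  qed (simp add: deriv_x_def deriv_y_def)
qed

text \<open>Euler's formula expresses \<open>d f\<close> by the partial derivatives, and the derivative of the germ is the partial
  derivative in the transversal direction. So the \<open>2 \<times> 2\<close> Jacobian minors are the Wronskians of the germs, up to the
  constant \<open>d\<close> and a non-zero determinant.\<close>

lemma germ_wronskian:
  assumes f: "bihomogeneous d f" and h: "bihomogeneous d h"
  shows "fps_const (if b = 0 then a else - b) * germ a b (deriv_x f * deriv_y h - deriv_x h * deriv_y f) =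
    fps_const (of_nat d) * (germ a b f * fps_deriv (germ a b h) - fps_deriv (germ a b f) * germ a b h)"
proof -
  let ?a = "fps_const (if b = 0 then 0 else 1)" and ?b = "fps_const (if b = 0 then 1 else 0)"
  let ?A = "germ a b varx" and ?B = "germ a b vary"
  have E: "fps_const (of_nat d) * germ a b f = ?A * germ a b (deriv_x f) + ?B * germ a b (deriv_y f)"
    if "bihomogeneous d f" for f
    using arg_cong[OF euler_formula[OF that], of "germ a b"] by (simp add: germ.hom_add germ.hom_mult)
  have det: "?A * ?b - ?a * ?B = fps_const (if b = 0 then a else - b)"
    by (cases "b = 0") (simp_all add: germ_varx germ_vary algebra_simps)
  have "fps_const (of_nat d) * (germ a b f * fps_deriv (germ a b h) - fps_deriv (germ a b f) * germ a b h) =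
      (fps_const (of_nat d) * germ a b f) * fps_deriv (germ a b h) - fps_deriv (germ a b f) * (fps_const (of_nat d) * germ a b h)"
    by (simp add: algebra_simps)
  also have "\<dots> = (?A * ?b - ?a * ?B) *
      (germ a b (deriv_x f) * germ a b (deriv_y h) - germ a b (deriv_x h) * germ a b (deriv_y f))"
    unfolding E[OF f] E[OF h] germ_deriv by (simp only: ring_distribs ac_simps) (simp only: algebra_simps)
  also have "\<dots> = fps_const (if b = 0 then a else - b) * germ a b (deriv_x f * deriv_y h - deriv_x h * deriv_y f)"
    unfolding det by (simp add: germ.hom_minus germ.hom_mult)
  finally show ?thesis by simp
qed

lemma fps_deriv_dvd: "fps_X ^ k dvd f \<Longrightarrow> fps_X ^ (k - 1) dvd fps_deriv f" for f :: "'a :: comm_ring_1 fps"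
  by (simp add: fps_X_power_dvd_iff less_diff_conv)

text \<open>Up to constants, \<open>F j\<close> is a multiple of \<open>F i0\<close> plus \<open>D j\<close>. So the Wronskians only involve the \<open>D j\<close> and their
  derivatives, and the leading term of \<open>W (F i0) (D j)\<close> is that of \<open>F i0\<close> times the derivative of \<open>D j\<close>. In
  characteristic zero differentiation lowers a positive order by exactly one.\<close>

lemma wronskian_order:
  fixes F :: "nat \<Rightarrow> 'k :: field_char_0 fps" and q :: "nat \<Rightarrow> 'k" and i0 :: nat
  defines "D \<equiv> \<lambda>j. fps_const (q i0) * F j - fps_const (q j) * F i0"
    and "W \<equiv> \<lambda>f h. f * fps_deriv h - fps_deriv f * h"
  assumes i0: "q i0 \<noteq> 0" "fps_nth (F i0) 0 \<noteq> 0" and e: "0 < e"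
    and D: "\<And>j. j < n \<Longrightarrow> fps_X ^ e dvd D j"
  shows "j < n \<Longrightarrow> k < n \<Longrightarrow> fps_X ^ (e - 1) dvd W (F j) (F k)"
    and "j < n \<Longrightarrow> has_order e (D j) \<Longrightarrow> has_order (e - 1) (W (F i0) (F j))"
proof -
  let ?q = "\<lambda>j. fps_const (q j)"
  have W: "fps_X ^ (e - 1) dvd W f h" if "fps_X ^ e dvd h" for f h :: "'k fps"
  proof -
    have "fps_X ^ (e - 1) dvd h" using that by (rule fps_X_power_dvd_le) simp
    then show ?thesis unfolding W_def using fps_deriv_dvd[OF that] by simp
  qed
  have W': "fps_X ^ (e - 1) dvd W f h" if "fps_X ^ e dvd f" for f h :: "'k fps"
  proof -
    have "W f h = - W h f" by (simp add: W_def)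
    then show ?thesis using W[OF that, of h] by simp
  qed
  have Dj: "?q i0 * F j = D j + ?q j * F i0" for j by (simp add: D_def)
  show "fps_X ^ (e - 1) dvd W (F j) (F k)" if "j < n" "k < n"
  proof -
    have "?q i0 * ?q i0 * W (F j) (F k) = W (?q i0 * F j) (?q i0 * F k)"
      by (simp add: W_def algebra_simps del: fps_const_mult)
    also have "\<dots> = W (D j) (D k + ?q k * F i0) + ?q j * W (F i0) (D k)"
      unfolding Dj by (simp add: W_def algebra_simps del: fps_const_mult)
    finally have "fps_X ^ (e - 1) dvd ?q i0 * ?q i0 * W (F j) (F k)"
      using W'[OF D[OF that(1)]] W[OF D[OF that(2)]] by simp
    moreover have "is_unit (?q i0 * ?q i0)" using i0 by (simp add: fps_is_unit_iff)
    ultimately show ?thesis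
      by (simp only: mult.commute[of _ "W (F j) (F k)"] dvd_mult_unit_iff)
  qed
  show "has_order (e - 1) (W (F i0) (F j))" if j: "j < n" and o: "has_order e (D j)"
  proof -
    have "has_order (e - 1) (fps_deriv (D j))"
      using o e fps_deriv_dvd[of e "D j"] by (simp add: has_order_def)
    moreover have "has_order 0 (F i0)" using i0 by (simp add: has_order_0_iff)
    ultimately have "has_order (0 + (e - 1)) (F i0 * fps_deriv (D j))" by (intro has_order_mult)
    moreover have "fps_nth (fps_deriv (F i0) * D j) (e - 1) = 0"
    proof -
      have "fps_X ^ e dvd fps_deriv (F i0) * D j" using D[OF j] by simp
      then show ?thesis using e by (simp add: fps_X_power_dvd_iff)
    qed
    moreover have "fps_X ^ (e - 1) dvd W (F i0) (D j)" by (rule W[OF D[OF j]])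
    ultimately have "has_order (e - 1) (W (F i0) (D j))"
      by (simp add: has_order_def W_def)
    moreover have "W (F i0) (D j) = W (F i0) (F j) * ?q i0"
      by (simp add: W_def D_def algebra_simps)
    ultimately have "has_order (e - 1) (W (F i0) (F j) * ?q i0)" by simp
    then show ?thesis by (rule has_order_mult_cancel) (use i0 in simp)
  qed
qed

section \<open>Height two means that there is no base point\<close>

text \<open>A non-zero prime strictly inside the multiples of a prime element \<open>l\<close> would contain with any \<open>l * f\<close> also \<open>f\<close>, and so
  would be closed under dividing by \<open>l\<close> indefinitely, which contradicts the degree.\<close>

lemma principal_prime_height:
  fixes a b :: "'k :: field"
  assumes ab: "(a, b) \<noteq> (0, 0)"
  shows "prime_height (ring_of_type_algebra :: 'k poly poly ring) {f. lin a b dvd f} \<le> 1"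
  unfolding prime_height_def
proof (rule SUP_least)
  let ?R = "ring_of_type_algebra :: 'k poly poly ring" and ?Q = "{f. lin a b dvd f}"
  have R: "carrier ?R = UNIV" "x \<otimes>\<^bsub>?R\<^esub> y = x * y" "\<zero>\<^bsub>?R\<^esub> = 0" for x y :: "'k poly poly"
    unfolding ring_of_type_algebra_def by simp_all
  fix l assume "l \<in> {l. \<exists>P. prime_chain ?R l P \<and> P l = ?Q}"
  then obtain P where P: "prime_chain ?R l P" "P l = ?Q" by blast
  have "\<not> 2 \<le> l"
  proof
    assume l: "2 \<le> l"
    define k where "k = l - 2"
    have k: "l = Suc (Suc k)" using l by (simp add: k_def)
    have prime: "primeideal (P i) ?R" if "i \<le> l" for i using P(1) that by (simp add: prime_chain_def)
    have step: "P i \<subset> P (Suc i)" if "i < l" for i using P(1) that by (simp add: prime_chain_def)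
    have chain: "primeideal (P k) ?R" "primeideal (P (Suc k)) ?R" "P k \<subset> P (Suc k)"
      using k by (auto intro!: prime step)
    have "P (Suc k) \<subset> P l" using step[of "Suc k"] by (simp add: k)
    then have chain4: "P (Suc k) \<subset> ?Q" by (simp only: P(2))
    have "0 \<in> P k"
      using additive_subgroup.zero_closed[OF ideal.axioms(1)[OF primeideal.axioms(1)[OF chain(1)]]]
      by (simp only: R)
    then obtain f where f: "f \<in> P (Suc k)" "f \<noteq> 0" using chain(3) by blast
    have "lin a b \<notin> P (Suc k)"
    proof
      assume "lin a b \<in> P (Suc k)"
      then have "?Q \<subseteq> P (Suc k)"
        using ideal.I_r_closed[OF primeideal.axioms(1)[OF chain(2)]] by (auto simp: R elim!: dvdE)
      then show False using chain4 by blast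
    qed
    define size where "size = (\<lambda>f :: 'k poly poly. Polynomial.degree f + Polynomial.degree (lead_coeff f))"
    have "f = 0" if "f \<in> P (Suc k)" for f
      using that
    proof (induction "size f" arbitrary: f rule: less_induct)
      case less
      show ?case
      proof (rule ccontr)
        assume f: "f \<noteq> 0"
        obtain h where h: "f = lin a b * h" using less.prems chain4 by (auto elim: dvdE)
        have "h \<in> P (Suc k)"
          using primeideal.I_prime[OF chain(2), of "lin a b" h] less.prems h \<open>lin a b \<notin> P (Suc k)\<close>
          by (simp add: R)
        moreover have "h \<noteq> 0" using f h by auto
        moreover have "size (lin a b) = 1" using ab by (auto simp: size_def lin_eq)
        moreover have "size (lin a b * h) = size (lin a b) + size h"
        proof -
          have 1: "Polynomial.degree (lin a b * h) = Polynomial.degree (lin a b) + Polynomial.degree h"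
            by (rule degree_mult_eq[OF lin_nonzero[OF ab] \<open>h \<noteq> 0\<close>])
          have 2: "Polynomial.degree (lead_coeff (lin a b * h)) =
              Polynomial.degree (lead_coeff (lin a b)) + Polynomial.degree (lead_coeff h)"
          proof -
            have l: "lead_coeff (lin a b * h) = lead_coeff (lin a b) * lead_coeff h" by (rule lead_coeff_mult)
            have "lead_coeff (lin a b) \<noteq> 0" "lead_coeff h \<noteq> 0"
              using lin_nonzero[OF ab] \<open>h \<noteq> 0\<close> by (simp_all only: leading_coeff_0_iff not_False_eq_True)
            then show ?thesis unfolding l by (rule degree_mult_eq)
          qed
          show ?thesis unfolding size_def using 1 2 by linarith
        qed
        ultimately have "h \<in> P (Suc k)" "h \<noteq> 0" "size h < size f" using h by simp_all
        then show False using less.hyps by blast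
      qed
    qed
    then show False using f by blast
  qed
  then show "enat l \<le> 1" by (simp add: one_enat_def)
qed

lemma principal_primeideal:
  fixes a b :: "'k :: field"
  assumes ab: "(a, b) \<noteq> (0, 0)"
  shows "primeideal {f. lin a b dvd f} (ring_of_type_algebra :: 'k poly poly ring)"
proof (rule primeidealI[OF ideal_of_multiples cring_from_type_algebra])
  have "1 \<notin> {f. lin a b dvd f}" using lin_not_unit[OF ab] by simp
  then show "carrier (ring_of_type_algebra :: 'k poly poly ring) \<noteq> {f. lin a b dvd f}"
    unfolding ring_of_type_algebra_def by auto
qed (use lin_prime[OF ab] in \<open>auto simp: ring_of_type_algebra_def\<close>)

text \<open>A common zero of the \<open>g\<close> would put their ideal into the prime ideal of a linear form, whose height is at most one.
  If \<open>d\<close> were zero, one of the \<open>g\<close> would then be a non-zero constant, and the unit ideal has infinite height.\<close>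

lemma rational_curveI:
  fixes g :: "'k :: {alg_closed_field, field_char_0} poly poly vec"
  assumes g: "g \<in> carrier_vec n" "\<forall>i<n. bihomogeneous d (g $ i)"
    and height: "ideal_height ring_of_type_algebra (gen_ideal {g $ i | i. i < n}) = 2"
  shows "rational_curve g n d"
proof
  let ?R = "ring_of_type_algebra :: 'k poly poly ring" and ?G = "{g $ i | i. i < n}"
  show bpf: "\<exists>i<n. eval2 (g $ i) a b \<noteq> 0" if ab: "(a, b) \<noteq> (0, 0)" for a b
  proof (rule ccontr)
    assume no: "\<not> ?thesis"
    have "\<forall>x\<in>?G. lin a b dvd x" using no form_lin_dvd_iff[OF _ ab] g(2) by blast
    then have "gen_ideal ?G \<subseteq> {f. lin a b dvd f}" using common_divisor_gen_ideal[of ?G] by blast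
    then have "ideal_height ?R (gen_ideal ?G) \<le> prime_height ?R {f. lin a b dvd f}"
      unfolding ideal_height_def using principal_primeideal[OF ab] by (intro INF_lower) simp
    also have "\<dots> \<le> 1" by (rule principal_prime_height[OF ab])
    finally show False unfolding height by (simp add: one_enat_def numeral_eq_enat)
  qed
  show "0 < d"
  proof (rule ccontr)
    assume "\<not> 0 < d"
    obtain i where i: "i < n" "eval2 (g $ i) 1 0 \<noteq> 0" using bpf[of 1 0] by auto
    then obtain c where c: "g $ i = cst c" using g(2) \<open>\<not> 0 < d\<close> form_0_const[of "g $ i"] by auto
    then have "c \<noteq> 0" using i by auto
    have "{Q. primeideal Q ?R \<and> gen_ideal ?G \<subseteq> Q} = {}"
    proof (rule ccontr)
      assume "\<not> ?thesis"
      then obtain Q where Q: "primeideal Q ?R" "gen_ideal ?G \<subseteq> Q" by blast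
      interpret ring ?R by (rule ring_from_type_algebra)
      have G: "?G \<subseteq> gen_ideal ?G"
        unfolding gen_ideal_def by (rule genideal_self) (simp add: ring_of_type_algebra_def)
      have "g $ i \<in> ?G" using i(1) by blast
      then have "cst c \<in> Q" unfolding c by (rule subsetD[OF Q(2) subsetD[OF G]])
      then have "cst c \<otimes>\<^bsub>?R\<^esub> cst (1 / c) \<in> Q"
        by (rule ideal.I_r_closed[OF primeideal.axioms(1)[OF Q(1)]]) (simp add: ring_of_type_algebra_def)
      moreover have "cst c \<otimes>\<^bsub>?R\<^esub> cst (1 / c) = \<one>\<^bsub>?R\<^esub>"
        using \<open>c \<noteq> 0\<close> by (simp add: ring_of_type_algebra_def flip: cst.hom_mult)
      ultimately have "Q = carrier ?R" using ideal.one_imp_carrier[OF primeideal.axioms(1)[OF Q(1)]] by simp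
      then show False using primeideal.I_notcarr[OF Q(1)] by simp
    qed
    then have "ideal_height ?R (gen_ideal ?G) = \<infinity>"
      unfolding ideal_height_def by (simp only: image_empty Inf_empty top_enat_def)
    then show False using height by simp
  qed
  show "dim_vec g = n" using g(1) by simp
  show "bihomogeneous d (g $ i)" if "i < n" for i using g(2) that by simp
qed

section \<open>The points above a point of the curve\<close>

lemma normalize_point:
  fixes a b :: "'k :: field"
  assumes "(a, b) \<noteq> (0, 0)"
  obtains c a' b' where "c \<noteq> 0" "normal_pt a' b'" "a = c * a'" "b = c * b'"
proof (cases "b = 0")
  case True
  then show thesis using assms that[of a 1 0] by (simp add: normal_pt_def)
next
  case False
  then show thesis using that[of b "a / b" 1] by (simp add: normal_pt_def)
qed

lemma (in rational_curve) curve_pointI: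
  assumes "birational_onto_image g" "p \<in> curve g"
  shows "curve_point g n d p"
proof (unfold_locales)
  obtain a b c where p: "(a, b) \<noteq> (0, 0)" "c \<noteq> 0" "p = c \<cdot>\<^sub>v param g a b"
    using assms(2) by (auto simp: curve_def proj_eq_def)
  show "dim_vec p = n" by (simp add: p param_def dim_g)
  obtain i where "i < n" "eval2 (g $ i) a b \<noteq> 0" using base_point_free[OF p(1)] by blast
  then show "\<exists>i<n. p $ i \<noteq> 0" using p by (intro exI[of _ i]) (simp add: param_def dim_g)
qed (rule assms)

definition jminor :: "'k :: field_char_0 poly poly vec \<Rightarrow> nat \<Rightarrow> nat \<Rightarrow> 'k poly poly" where
  "jminor g j k = deriv_x (g $ j) * deriv_y (g $ k) - deriv_x (g $ k) * deriv_y (g $ j)"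

context curve_point
begin

lemma fibre_iff_proj_eq:
  assumes "normal_pt a b"
  shows "(a, b) \<in> fibre \<longleftrightarrow> proj_eq p (param g a b)"
proof -
  have "(\<forall>j<n. eval2 (delta j) a b = 0) \<longleftrightarrow> (\<exists>c. c \<noteq> 0 \<and> param g a b = c \<cdot>\<^sub>v p)"
    using delta_zero_imp[of a b] param_prop_imp_delta_zero[of a b] normal_pt_nonzero[OF assms] by blast
  then show ?thesis using assms by (simp add: fibre_def proj_eq_def)
qed

lemma nbranch_pos:
  assumes "p \<in> curve g"
  shows "0 < nbranch"
proof -
  obtain a b c where p: "(a, b) \<noteq> (0, 0)" "c \<noteq> 0" "p = c \<cdot>\<^sub>v param g a b"
    using assms by (auto simp: curve_def proj_eq_def)
  obtain k a' b' where n: "k \<noteq> 0" "normal_pt a' b'" "a = k * a'" "b = k * b'"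
    by (rule normalize_point[OF p(1)])
  have "param g a b = (1 / c) \<cdot>\<^sub>v p" using p by (simp add: smult_smult_assoc)
  then have "eval2 (delta j) (k * a') (k * b') = 0" if "j < n" for j
    using param_prop_imp_delta_zero[of a b "1 / c" j] that n by simp
  then have "eval2 (delta j) a' b' = 0" if "j < n" for j
    using form_eval2_scale[OF form_delta[OF that], of k a' b'] n(1) that by simp
  then have "(a', b') \<in> fibre" using n(2) by (simp add: fibre_def)
  then show ?thesis using finite_fibre by (auto simp: nbranch_def card_gt_0_iff)
qed

subsection \<open>The Hilbert-Burch matrix\<close>

text \<open>Both sets have the same common divisors. The vector \<open>g\<^sub>j e\<^sub>i\<^sub>0 - g\<^sub>i\<^sub>0 e\<^sub>j\<close> is a syzygy of \<open>g\<close>, hence a combination of the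
  columns of \<open>\<phi>\<close>, and its product with \<open>p\<close> is \<open>delta j\<close>. Conversely, as the columns of \<open>\<phi>\<close> are syzygies, each
  entry of \<open>p\<phi>\<close> times any of the \<open>g\<close> lies in the ideal of the \<open>delta j\<close>; at every point some \<open>g\<^sub>i\<close> is invertible,
  so a common divisor of the \<open>delta j\<close> divides the entry locally and hence globally.\<close>

lemma hilbert_burch_gcd_iff:
  assumes hb: "hilbert_burch_matrix g \<phi>"
  shows "is_gcd (minors_ideal 1 (row_times p \<phi>)) h \<longleftrightarrow> is_gcd (delta ` {..<n}) h"
proof -
  have \<phi>: "\<phi> \<in> carrier_mat n (n - 1)"
    and homog: "\<exists>D. \<forall>i<n. \<forall>j<n - 1. bihomogeneous (D j) (\<phi> $$ (i, j))"
    and exact: "\<And>v. v \<in> carrier_vec n \<Longrightarrow> g \<bullet> v = 0 \<longleftrightarrow> (\<exists>w \<in> carrier_vec (n - 1). v = \<phi> *\<^sub>v w)"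
    using hb unfolding hilbert_burch_matrix_def dim_g Let_def by blast+
  define ph where "ph = map_vec cst p"
  have ph: "ph \<in> carrier_vec n" by (rule carrier_vecI) (simp add: ph_def dim_p)
  have row: "row_times p \<phi> = mat_of_row ph * \<phi>"
    unfolding row_times_def ph_def cst_def[abs_def] ..
  define r where "r = (\<lambda>l. ph \<bullet> col \<phi> l)"
  have entry: "row_times p \<phi> $$ (0, l) = r l" if "l < n - 1" for l
    unfolding row r_def using that \<phi> ph by (subst index_mult_mat) auto
  have dims: "dim_row (row_times p \<phi>) = 1" "dim_col (row_times p \<phi>) = n - 1"
    unfolding row using \<phi> by auto
  have r_sum: "r l = (\<Sum>i<n. cst (p $ i) * \<phi> $$ (i, l))" if "l < n - 1" for l
    unfolding r_def scalar_prod_def using \<phi> that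
    by (simp add: ph_def dim_p lessThan_atLeast0)
  have g_col: "(\<Sum>i<n. g $ i * \<phi> $$ (i, l)) = 0" if l: "l < n - 1" for l
  proof -
    have c: "col \<phi> l \<in> carrier_vec n" using \<phi> by auto
    have "col \<phi> l = \<phi> *\<^sub>v unit_vec (n - 1) l"
      by (rule eq_vecI) (use \<phi> l in \<open>auto simp: mult_mat_vec_def\<close>)
    then have "\<exists>w \<in> carrier_vec (n - 1). col \<phi> l = \<phi> *\<^sub>v w" by (rule bexI) simp
    then have "g \<bullet> col \<phi> l = 0" using exact[OF c] by (rule iffD2[rotated])
    then show ?thesis using \<phi> l by (simp add: scalar_prod_def lessThan_atLeast0)
  qed
  have "(\<forall>x\<in>minors_ideal 1 (row_times p \<phi>). c dvd x) \<longleftrightarrow> (\<forall>x\<in>delta ` {..<n}. c dvd x)" for c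
  proof -
    have "(\<forall>x\<in>minors_ideal 1 (row_times p \<phi>). c dvd x) \<longleftrightarrow> (\<forall>l<n - 1. c dvd r l)"
      unfolding minors_ideal_1_row[OF dims(1)] common_divisor_gen_ideal dims using entry by auto
    also have "\<dots> \<longleftrightarrow> (\<forall>j<n. c dvd delta j)"
    proof
      assume c: "\<forall>l<n - 1. c dvd r l"
      show "\<forall>j<n. c dvd delta j"
      proof (intro allI impI)
        fix j assume j: "j < n"
        define v where "v = g $ j \<cdot>\<^sub>v unit_vec n i0 - g $ i0 \<cdot>\<^sub>v unit_vec n j"
        have v: "v \<in> carrier_vec n" by (simp add: v_def)
        have gv: "x \<bullet> v = g $ j * x $ i0 - g $ i0 * x $ j" if "x \<in> carrier_vec n" for x
          unfolding v_def using that j i0(1)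
          by (simp add: scalar_prod_minus_distrib[of _ n])
        have "g \<in> carrier_vec n" using dim_g by auto
        then have "g \<bullet> v = 0" using gv by (simp add: mult.commute)
        then obtain w where w: "w \<in> carrier_vec (n - 1)" "v = \<phi> *\<^sub>v w" using exact[OF v] by blast
        have "delta j = ph \<bullet> v"
          using gv[OF ph] i0(1) j by (simp add: delta_def ph_def dim_p mult.commute)
        also have "\<dots> = (mat_of_row ph *\<^sub>v (\<phi> *\<^sub>v w)) $ 0" by (simp add: w(2))
        also have "\<dots> = (row_times p \<phi> *\<^sub>v w) $ 0"
          unfolding row using assoc_mult_mat_vec[OF mat_of_row_carrier(1)[OF ph] \<phi> w(1)] by simp
        also have "\<dots> = (\<Sum>l<n - 1. r l * w $ l)"
          using dims w(1) entry by (simp add: mult_mat_vec_def scalar_prod_def lessThan_atLeast0)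
        finally show "c dvd delta j" using c by (auto intro!: dvd_sum)
      qed
    next
      assume c: "\<forall>j<n. c dvd delta j"
      obtain j where j: "j < n" "delta j \<noteq> 0" using delta_nonzero by blast
      obtain m where m: "bihomogeneous m c" "c \<noteq> 0"
        using form_divisor[OF form_delta[OF j(1)] j(2), of c] c j(1) by blast
      show "\<forall>l<n - 1. c dvd r l"
      proof (intro allI impI)
        fix l assume l: "l < n - 1"
        obtain D where D: "\<forall>i<n. \<forall>j<n - 1. bihomogeneous (D j) (\<phi> $$ (i, j))" using homog by blast
        have "bihomogeneous (D l) (r l)"
          unfolding r_sum[OF l] using D l by (intro form_sum form_const_mult) simp
        have "g $ i0 * r l = cst (p $ i0) * (\<Sum>i<n. g $ i * \<phi> $$ (i, l)) - (\<Sum>i<n. delta i * \<phi> $$ (i, l))"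
          unfolding r_sum[OF l] sum_distrib_left sum_subtractf[symmetric]
          by (intro sum.cong) (simp_all add: delta_def algebra_simps)
        then have c0: "c dvd g $ i0 * r l" using c by (auto simp: g_col[OF l] intro!: dvd_sum)
        have ci: "c dvd g $ i * r l" if "i < n" for i
        proof -
          have "cst (p $ i0) * (g $ i * r l) = delta i * r l + cst (p $ i) * (g $ i0 * r l)"
            by (simp add: delta_def algebra_simps)
          then have "c dvd cst (p $ i0) * (g $ i * r l)" using c c0 that by simp
          moreover have "cst (p $ i0) dvd 1" by (rule cst_dvd_1[OF i0(2)])
          ultimately show ?thesis by (simp only: mult.commute[of "cst (p $ i0)"] dvd_mult_unit_iff)
        qed
        show "c dvd r l"
        proof (rule form_dvdI[OF m \<open>bihomogeneous (D l) (r l)\<close>])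
          fix a b :: 'k assume ab: "normal_pt a b"
          obtain i where i: "i < n" "eval2 (g $ i) a b \<noteq> 0"
            using base_point_free[OF normal_pt_nonzero[OF ab]] by blast
          obtain c' where "g $ i * r l = c * c'" using ci[OF i(1)] by (elim dvdE)
          then have "germ a b (g $ i) * germ a b (r l) = germ a b c * germ a b c'" by (simp flip: germ.hom_mult)
          then have "germ a b c dvd germ a b (r l) * germ a b (g $ i)" by (metis dvd_triv_left mult.commute)
          moreover have "is_unit (germ a b (g $ i))" using i(2) by (simp add: fps_is_unit_iff germ_nth_0)
          ultimately show "germ a b c dvd germ a b (r l)" by (simp only: dvd_mult_unit_iff)
        qed
      qed
    qed
    also have "\<dots> \<longleftrightarrow> (\<forall>x\<in>delta ` {..<n}. c dvd x)" by auto
    finally show ?thesis .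
  qed
  then show ?thesis by (rule is_gcd_cong)
qed

text \<open>An explicit greatest common divisor of the \<open>delta j\<close>, and so of the entries of \<open>p\<phi>\<close>.\<close>

definition fibre_product :: "'k poly poly" where
  "fibre_product = (\<Prod>u<nbranch. lin (fst (pt u)) (snd (pt u)) ^ em u)"

lemma fibre_product_order:
  assumes ab: "normal_pt a b"
  shows "has_order (mult_at a b) (germ a b fibre_product)"
proof -
  have "has_order (\<Sum>u<nbranch. if pt u = (a, b) then em u else 0) (germ a b fibre_product)"
    unfolding fibre_product_def
    by (rule germ_order_prod_powers[OF ab, where k = "\<lambda>_. 1"]) (simp add: pt_normal)
  moreover have "(\<Sum>u<nbranch. if pt u = (a, b) then em u else 0) = mult_at a b"
  proof (cases "(a, b) \<in> fibre")
    case True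
    then obtain v where v: "v < nbranch" "(a, b) = pt v" using fibre_pt by blast
    have "(\<Sum>u<nbranch. if pt u = (a, b) then em u else 0) = (\<Sum>u<nbranch. if u = v then em v else 0)"
      using v pt_eq_iff by (intro sum.cong) auto
    also have "\<dots> = em v" using v by simp
    also have "\<dots> = mult_at a b" using v(2)[symmetric] by (simp add: em_def)
    finally show ?thesis .
  next
    case False
    then have "(\<Sum>u<nbranch. if pt u = (a, b) then em u else 0) = 0"
      using pt_in_fibre by (intro sum.neutral ballI) (metis lessThan_iff)
    moreover have "\<not> 0 < mult_at a b"
      using False ab mult_at_pos_iff[OF normal_pt_nonzero[OF ab]] by (auto simp: fibre_def)
    ultimately show ?thesis by simp
  qed
  ultimately show ?thesis by simp
qed

lemma fibre_product_is_gcd: "is_gcd (delta ` {..<n}) fibre_product"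
proof -
  obtain j0 where j0: "j0 < n" "delta j0 \<noteq> 0" using delta_nonzero by blast
  show ?thesis
  proof (rule is_gcd_formsI)
    show "\<exists>m. bihomogeneous m t" if "t \<in> delta ` {..<n}" for t using that form_delta by auto
    show "delta j0 \<in> delta ` {..<n}" "delta j0 \<noteq> 0" using j0 by auto
    show "bihomogeneous (\<Sum>u<nbranch. em u * 1) fibre_product"
      unfolding fibre_product_def by (intro form_prod form_power form_lin)
    show "fibre_product \<noteq> 0" unfolding fibre_product_def using lin_nonzero[OF pt_nonzero] by simp
    fix a b :: 'k assume ab: "normal_pt a b"
    show "\<exists>k. has_order k (germ a b fibre_product) \<and> (\<forall>t\<in>delta ` {..<n}. fps_X ^ k dvd germ a b t) \<and>
        (\<exists>t\<in>delta ` {..<n}. has_order k (germ a b t))"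
      using fibre_product_order[OF ab] mult_at[OF normal_pt_nonzero[OF ab]]
      by (intro exI[of _ "mult_at a b"]) auto
  qed
qed

lemma gcd_order:
  assumes h: "is_gcd (delta ` {..<n}) h" and ab: "normal_pt a b"
  shows "has_order (mult_at a b) (germ a b h)"
proof -
  obtain j where j: "j < n" "has_order (mult_at a b) (germ a b (delta j))"
    using mult_at(2)[OF normal_pt_nonzero[OF ab]] by blast
  have hom_dvd: "germ a b f dvd germ a b f'" if "f dvd f'" for f f'
    using that by (auto simp: germ.hom_mult elim!: dvdE)
  have 1: "germ a b h dvd germ a b (delta j)" using h j(1) by (intro hom_dvd) (simp add: is_gcd_def)
  have 2: "germ a b fibre_product dvd germ a b h"
    by (intro hom_dvd is_gcd_unique[OF fibre_product_is_gcd h])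
  have "germ a b h \<noteq> 0" using 1 has_order_imp_nonzero[OF j(2)] by auto
  then have k: "has_order (subdegree (germ a b h)) (germ a b h)" by (rule has_order_subdegree)
  have "subdegree (germ a b h) = mult_at a b"
    by (rule antisym[OF has_order_dvd[OF k 1 j(2)] has_order_dvd[OF fibre_product_order[OF ab] 2 k]])
  then show ?thesis using k by simp
qed

subsection \<open>The minors of the Jacobian matrix\<close>

text \<open>At a point above \<open>p\<close> the germs of the \<open>g\<close> are proportional to \<open>p\<close> up to order \<open>mult_at a b\<close>, so \<open>wronskian_order\<close>
  applies to them.\<close>

lemma jminor_order:
  assumes "(a, b) \<in> fibre"
  shows "j < n \<Longrightarrow> k < n \<Longrightarrow> fps_X ^ (mult_at a b - 1) dvd germ a b (jminor g j k)"
    and "\<exists>j<n. has_order (mult_at a b - 1) (germ a b (jminor g i0 j))"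
proof -
  have ab: "normal_pt a b" "(a, b) \<noteq> (0, 0)" using assms normal_pt_nonzero by (auto simp: fibre_def)
  have zero: "\<forall>j<n. eval2 (delta j) a b = 0" using assms by (simp add: fibre_def)
  obtain c where c: "c \<noteq> 0" "param g a b = c \<cdot>\<^sub>v p" using delta_zero_imp[OF zero ab(2)] by blast
  have "param g a b $ i0 = (c \<cdot>\<^sub>v p) $ i0" using c(2) by simp
  then have g0: "fps_nth (germ a b (g $ i0)) 0 \<noteq> 0"
    using c(1) i0 by (simp add: germ_nth_0 param_def dim_g dim_p)
  have e: "0 < mult_at a b" using mult_at_pos_iff[OF ab(2)] zero by simp
  have D: "germ a b (delta j) = fps_const (p $ i0) * germ a b (g $ j) - fps_const (p $ j) * germ a b (g $ i0)" for j
    by (simp add: delta_def germ.hom_minus germ.hom_mult)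
  note w = wronskian_order[where q = "\<lambda>j. p $ j" and F = "\<lambda>j. germ a b (g $ j)" and n = n, OF i0(2) g0 e,
    folded D, OF mult_at(1)[OF ab(2)]]
  let ?u = "if b = 0 then a else - b"
  have u: "?u \<noteq> 0" using ab(2) by auto
  have J: "fps_const ?u * germ a b (jminor g j k) = fps_const (of_nat d) *
      (germ a b (g $ j) * fps_deriv (germ a b (g $ k)) - fps_deriv (germ a b (g $ j)) * germ a b (g $ k))"
    if "j < n" "k < n" for j k
    unfolding jminor_def by (rule germ_wronskian[OF g_form[OF that(1)] g_form[OF that(2)]])
  show "fps_X ^ (mult_at a b - 1) dvd germ a b (jminor g j k)" if "j < n" "k < n"
  proof -
    have "fps_X ^ (mult_at a b - 1) dvd germ a b (jminor g j k) * fps_const ?u"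
      unfolding mult.commute[of _ "fps_const ?u"] J[OF that] by (intro dvd_mult w(1)[OF _ that]) simp
    moreover have "is_unit (fps_const ?u)" using u by (simp add: fps_is_unit_iff)
    ultimately show ?thesis by (simp only: dvd_mult_unit_iff)
  qed
  obtain j where j: "j < n" "has_order (mult_at a b) (germ a b (delta j))" using mult_at(2)[OF ab(2)] by blast
  have "has_order 0 (fps_const (of_nat d) :: 'k fps)" using d_pos by (simp add: has_order_0_iff)
  then have "has_order (0 + (mult_at a b - 1)) (fps_const ?u * germ a b (jminor g i0 j))"
    unfolding J[OF i0(1) j(1)] by (intro has_order_mult w(2)[OF _ j]) simp_all
  then have "has_order (mult_at a b - 1) (germ a b (jminor g i0 j) * fps_const ?u)"
    by (simp add: mult.commute)
  then have "has_order (mult_at a b - 1) (germ a b (jminor g i0 j))"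
    by (rule has_order_mult_cancel) (use u in simp)
  then show "\<exists>j<n. has_order (mult_at a b - 1) (germ a b (jminor g i0 j))" using j(1) by blast
qed

end

definition jminors :: "'k :: field_char_0 poly poly vec \<Rightarrow> 'k poly poly set" where
  "jminors g = {jminor g j k | j k. j < k \<and> k < dim_vec g}"

lemma is_gcd_jacobian_iff: "is_gcd (minors_ideal 2 (jacobian_matrix g)) h \<longleftrightarrow> is_gcd (jminors g) h"
proof -
  let ?N = "jacobian_matrix g"
  have dims: "dim_row ?N = 2" "dim_col ?N = dim_vec g" by (simp_all add: jacobian_matrix_def)
  have entries: "?N $$ (0, j) * ?N $$ (1, k) - ?N $$ (0, k) * ?N $$ (1, j) = jminor g j k"
    if "j < k" "k < dim_vec g" for j k
    using that by (simp add: jacobian_matrix_def jminor_def)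
  have "{?N $$ (0, j) * ?N $$ (1, k) - ?N $$ (0, k) * ?N $$ (1, j) | j k. j < k \<and> k < dim_col ?N} = jminors g"
    unfolding jminors_def dims
  proof (intro Collect_cong iff_exI)
    fix x j k
    show "(x = ?N $$ (0, j) * ?N $$ (1, k) - ?N $$ (0, k) * ?N $$ (1, j) \<and> j < k \<and> k < dim_vec g) \<longleftrightarrow>
        (x = jminor g j k \<and> j < k \<and> k < dim_vec g)"
      using entries[of j k] by metis
  qed
  then show ?thesis unfolding minors_ideal_2_rows[OF dims(1)] is_gcd_gen_ideal by simp
qed

lemma (in rational_curve) form_jminors:
  assumes "t \<in> jminors g"
  shows "\<exists>m. bihomogeneous m t"
proof -
  have x: "bihomogeneous (d - 1) (deriv_x f)" and y: "bihomogeneous (d - 1) (deriv_y f)"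
    if "bihomogeneous d f" for f :: "'k poly poly"
    using that unfolding bihomogeneous_def coeff_deriv_x coeff_deriv_y by fastforce+
  obtain j k where "t = jminor g j k" "j < k" "k < n" using assms by (auto simp: jminors_def dim_g)
  then have "bihomogeneous ((d - 1) + (d - 1)) t"
    unfolding jminor_def by (simp only:) (intro form_diff form_mult x y g_form, simp_all)
  then show ?thesis by blast
qed

section \<open>From the points of the curve to the whole curve\<close>

text \<open>What the global argument has to know about a point \<open>p\<close> of the curve: \<open>M a b\<close> is the ramification order at the point
  \<open>(a : b)\<close> if this lies above \<open>p\<close>, and zero otherwise. It controls the multiplicity, the greatest common divisor of the entries
  of \<open>p\<phi>\<close> and that of the Jacobian minors.\<close>

definition local_data :: "'k :: {alg_closed_field, field_char_0} poly poly vec \<Rightarrow> 'k poly poly mat \<Rightarrow>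
    'k vec \<Rightarrow> ('k \<Rightarrow> 'k \<Rightarrow> nat) \<Rightarrow> bool" where
  "local_data g \<phi> p M \<longleftrightarrow>
    (\<forall>a b. normal_pt a b \<longrightarrow> 0 < M a b \<longleftrightarrow> proj_eq p (param g a b)) \<and>
    (\<exists>l e. gcd_factorization \<phi> p (branch_number (curve_local_ring g p)) l e \<and>
       (\<Sum>u<branch_number (curve_local_ring g p). e u) = samuel_multiplicity (curve_local_ring g p)) \<and>
    (\<forall>h a b. is_gcd (minors_ideal 1 (row_times p \<phi>)) h \<longrightarrow> normal_pt a b \<longrightarrow> has_order (M a b) (germ a b h)) \<and>
    (\<forall>a b. normal_pt a b \<longrightarrow> 0 < M a b \<longrightarrow>
       (\<forall>t\<in>jminors g. fps_X ^ (M a b - 1) dvd germ a b t) \<and> (\<exists>t\<in>jminors g. has_order (M a b - 1) (germ a b t))) \<and>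
    (regular_local_ring (curve_local_ring g p) \<longrightarrow> (\<forall>a b. normal_pt a b \<longrightarrow> M a b \<le> 1))"

lemma (in curve_point) local_data_mult_at:
  assumes hb: "hilbert_burch_matrix g \<phi>" and p: "p \<in> curve g"
  shows "local_data g \<phi> p mult_at"
proof -
  have nb: "0 < nbranch" by (rule nbranch_pos[OF p])
  note inv = local_invariants[OF nb]
  have pos_iff: "0 < mult_at a b \<longleftrightarrow> (a, b) \<in> fibre" if "normal_pt a b" for a b
    using mult_at_pos_iff[OF normal_pt_nonzero[OF that]] that by (simp add: fibre_def)
  have 1: "0 < mult_at a b \<longleftrightarrow> proj_eq p (param g a b)" if "normal_pt a b" for a b
    using pos_iff[OF that] fibre_iff_proj_eq[OF that] by simp
  have "gcd_factorization \<phi> p nbranch (\<lambda>u. lin (fst (pt u)) (snd (pt u))) em"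
    unfolding gcd_factorization_def
  proof (intro conjI allI impI)
    fix u assume u: "u < nbranch"
    show "linear_form (lin (fst (pt u)) (snd (pt u)))"
      unfolding linear_form_def using lin_nonzero[OF pt_nonzero[OF u]] form_lin by blast
    show "0 < em u" by (rule em_pos[OF u])
  next
    fix u v assume uv: "u < nbranch" "v < nbranch" "u \<noteq> v"
    have "\<not> lin (fst (pt u)) (snd (pt u)) dvd lin (fst (pt v)) (snd (pt v))"
      using form_lin_dvd_iff[OF form_lin pt_nonzero[OF uv(1)]] uv pt_eq_iff[OF uv(2,1)]
        eval2_lin_normal[OF pt_normal[OF uv(2)] pt_normal[OF uv(1)]] by (auto simp: prod_eq_iff)
    then show "\<not> associates (lin (fst (pt u)) (snd (pt u))) (lin (fst (pt v)) (snd (pt v)))"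
      by (simp add: associates_def)
  next
    show "is_gcd (minors_ideal 1 (row_times p \<phi>)) (\<Prod>u<nbranch. lin (fst (pt u)) (snd (pt u)) ^ em u)"
      using fibre_product_is_gcd hilbert_burch_gcd_iff[OF hb] by (simp add: fibre_product_def)
  qed
  then have 2: "\<exists>l e. gcd_factorization \<phi> p (branch_number (curve_local_ring g p)) l e \<and>
       (\<Sum>u<branch_number (curve_local_ring g p). e u) = samuel_multiplicity (curve_local_ring g p)"
    unfolding inv(1,2) by blast
  have 3: "has_order (mult_at a b) (germ a b h)"
    if "is_gcd (minors_ideal 1 (row_times p \<phi>)) h" "normal_pt a b" for h a b
    using gcd_order[OF _ that(2)] that(1) hilbert_burch_gcd_iff[OF hb] by blast
  have 4: "(\<forall>t\<in>jminors g. fps_X ^ (mult_at a b - 1) dvd germ a b t) \<and>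
      (\<exists>t\<in>jminors g. has_order (mult_at a b - 1) (germ a b t))"
    if "normal_pt a b" "0 < mult_at a b" for a b
  proof -
    have f: "(a, b) \<in> fibre" using pos_iff that by blast
    have "\<forall>t\<in>jminors g. fps_X ^ (mult_at a b - 1) dvd germ a b t"
      using jminor_order(1)[OF f] by (auto simp: jminors_def dim_g)
    moreover obtain j where j: "j < n" "has_order (mult_at a b - 1) (germ a b (jminor g i0 j))"
      using jminor_order(2)[OF f] by blast
    have "\<exists>t\<in>jminors g. has_order (mult_at a b - 1) (germ a b t)"
    proof -
      consider "j = i0" | "i0 < j" | "j < i0" by linarith
      then show ?thesis
      proof cases
        case 1
        then have "germ a b (jminor g i0 j) = 0" by (simp add: jminor_def)
        then show ?thesis using j(2) has_order_imp_nonzero by blast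
      next
        case 2
        then show ?thesis using j by (auto simp: jminors_def dim_g)
      next
        case 3
        have "jminor g i0 j = - jminor g j i0" by (simp add: jminor_def)
        then have "germ a b (jminor g i0 j) = - germ a b (jminor g j i0)" by (simp add: germ.hom_uminus)
        then have "has_order (mult_at a b - 1) (germ a b (jminor g j i0))" using j(2) by (simp add: has_order_def)
        then show ?thesis using 3 i0(1) by (auto simp: jminors_def dim_g)
      qed
    qed
    ultimately show ?thesis by blast
  qed
  have 5: "mult_at a b \<le> 1" if "regular_local_ring (curve_local_ring g p)" "normal_pt a b" for a b
  proof (cases "(a, b) \<in> fibre")
    case True
    then obtain u where u: "u < nbranch" "(a, b) = pt u" using fibre_pt by blast
    then have "mult_at a b = em u" by (simp add: em_def flip: u(2))
    then show ?thesis using inv(3)[OF that(1) u(1)] by simp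
  next
    case False
    then show ?thesis using pos_iff[OF that(2)] by simp
  qed
  show ?thesis
    unfolding local_data_def
  proof (intro conjI allI impI)
    show "\<exists>l e. gcd_factorization \<phi> p (branch_number (curve_local_ring g p)) l e \<and>
       (\<Sum>u<branch_number (curve_local_ring g p). e u) = samuel_multiplicity (curve_local_ring g p)" by (rule 2)
  qed (use 1 3 4 5 in blast)+
qed

text \<open>At most one of the pairwise non-associated factors vanishes at the given point. If none does, \<open>k\<close> is zero and
  so is the truncated difference \<open>k - 1\<close>.\<close>

lemma gcd_factorization_reduced_order:
  fixes l :: "nat \<Rightarrow> 'k :: alg_closed_field poly poly"
  assumes gf: "gcd_factorization \<phi> p s l e" and ab: "normal_pt a b"
    and order: "has_order k (germ a b (\<Prod>u<s. l u ^ e u))"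
  shows "has_order (k - 1) (germ a b (\<Prod>u<s. l u ^ (e u - 1)))"
proof -
  have "\<exists>r k. normal_pt (fst r) (snd r) \<and> k \<noteq> 0 \<and> l u = cst k * lin (fst r) (snd r)" if u: "u < s" for u
  proof -
    have "linear_form (l u)" using gf u by (simp add: gcd_factorization_def)
    then obtain a b k where "normal_pt a b" "k \<noteq> 0" "l u = cst k * lin a b" by (rule linear_form_cases)
    then show ?thesis by (intro exI[of _ "(a, b)"] exI[of _ k]) simp
  qed
  then obtain r c where rc: "\<And>u. u < s \<Longrightarrow> normal_pt (fst (r u)) (snd (r u)) \<and> c u \<noteq> 0 \<and>
      l u = cst (c u) * lin (fst (r u)) (snd (r u))" by metis
  have inj: "u = v" if "u < s" "v < s" "r u = r v" for u v
  proof (rule ccontr)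
    assume "u \<noteq> v"
    then have "\<not> associates (l u) (l v)" using gf that by (simp add: gcd_factorization_def)
    moreover have "associates (l u) (l v)"
      using associates_cst_lin[of "c u" "c v" "fst (r u)" "snd (r u)"] rc[OF that(1)] rc[OF that(2)] that(3) by simp
    ultimately show False by blast
  qed
  have orders: "has_order (\<Sum>u<s. if r u = (a, b) then f u else 0) (germ a b (\<Prod>u<s. l u ^ f u))" for f
    by (rule germ_order_prod_powers[OF ab]) (rule rc)
  have k: "k = (\<Sum>u<s. if r u = (a, b) then e u else 0)"
    by (rule has_order_unique[OF order orders])
  have "(\<Sum>u<s. if r u = (a, b) then e u - 1 else 0) = k - 1"
  proof (cases "\<exists>v<s. r v = (a, b)")
    case True
    then obtain v where v: "v < s" "r v = (a, b)" by blast
    have eq: "(\<Sum>u<s. if r u = (a, b) then f u else 0) = f v" for f :: "nat \<Rightarrow> nat"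
    proof -
      have "(\<Sum>u<s. if r u = (a, b) then f u else 0) = (\<Sum>u<s. if u = v then f v else 0)"
      proof (intro sum.cong refl)
        fix u assume "u \<in> {..<s}"
        then have "r u = (a, b) \<longleftrightarrow> u = v" using inj[of u v] v by (metis lessThan_iff)
        then show "(if r u = (a, b) then f u else 0) = (if u = v then f v else 0)"
          by (simp split: if_split)
      qed
      then show ?thesis using v by simp
    qed
    show ?thesis unfolding k eq ..
  next
    case False
    have eq: "(\<Sum>u<s. if r u = (a, b) then f u else 0) = 0" for f :: "nat \<Rightarrow> nat"
      by (rule sum.neutral) (use False in auto)
    show ?thesis unfolding k eq by simp
  qed
  then show ?thesis using orders[of "\<lambda>u. e u - 1"] by (simp only:)
qed

lemma proj_eq_sym: "proj_eq p q \<Longrightarrow> proj_eq q p"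
proof -
  assume "proj_eq p q"
  then obtain c where "c \<noteq> 0" "q = c \<cdot>\<^sub>v p" unfolding proj_eq_def by blast
  then have "p = (1 / c) \<cdot>\<^sub>v q" "1 / c \<noteq> 0" by (simp_all add: smult_smult_assoc)
  then show "proj_eq q p" unfolding proj_eq_def by blast
qed

lemma proj_eq_trans: "proj_eq p q \<Longrightarrow> proj_eq q r \<Longrightarrow> proj_eq p r"
proof -
  assume "proj_eq p q" "proj_eq q r"
  then obtain c c' where "c \<noteq> 0" "q = c \<cdot>\<^sub>v p" "c' \<noteq> 0" "r = c' \<cdot>\<^sub>v q" unfolding proj_eq_def by blast
  then have "r = (c' * c) \<cdot>\<^sub>v p" "c' * c \<noteq> 0" by (simp_all add: smult_smult_assoc)
  then show "proj_eq p r" unfolding proj_eq_def by blast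
qed

theorem theorem7p4:
  fixes g :: "'k :: {alg_closed_field, field_char_0} poly poly vec"
    and \<phi> :: "'k poly poly mat"
    and d n z :: nat
    and p :: "nat \<Rightarrow> 'k vec"
    and m s :: "nat \<Rightarrow> nat"
  assumes g_dim: "g \<in> carrier_vec n"
    and g_forms: "\<forall>i<n. bihomogeneous d (g $ i)"
    and g_minimal: "minimally_generated g"
    and height_two: "ideal_height ring_of_type_algebra (gen_ideal {g $ i | i. i < n}) = 2"
    and birational: "birational_onto_image g"
    and hilbert_burch: "hilbert_burch_matrix g \<phi>"
    and p_singular: "\<forall>j<z. p j \<in> singular_points g"
    and p_enumerates: "\<forall>q \<in> singular_points g. \<exists>!j. j < z \<and> proj_eq (p j) q"
    and m_def: "\<forall>j<z. m j = samuel_multiplicity (curve_local_ring g (p j))"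
    and s_def: "\<forall>j<z. s j = branch_number (curve_local_ring g (p j))"
  shows "(\<forall>j<z. \<exists>l e. gcd_factorization \<phi> (p j) (s j) l e) \<and>
    (\<forall>(l :: nat \<Rightarrow> nat \<Rightarrow> 'k poly poly) (e :: nat \<Rightarrow> nat \<Rightarrow> nat).
       (\<forall>j<z. gcd_factorization \<phi> (p j) (s j) (l j) (e j)) \<longrightarrow>
       is_gcd (minors_ideal 2 (jacobian_matrix g)) (\<Prod>j<z. \<Prod>u<s j. l j u ^ (e j u - 1))) \<and>
    (\<forall>h. is_gcd (minors_ideal 2 (jacobian_matrix g)) h \<longrightarrow>
       int (total_degree h) = (\<Sum>j<z. int (m j) - int (s j)))"
proof -
  interpret rational_curve g n d by (rule rational_curveI[OF g_dim g_forms height_two])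
  have data: "\<exists>M. local_data g \<phi> q M" if "q \<in> curve g" for q
    using curve_point.local_data_mult_at[OF curve_pointI[OF birational that] hilbert_burch that] by blast
  have "\<exists>M. local_data g \<phi> (p j) M" if "j < z" for j
    using data p_singular that by (simp add: singular_points_def)
  then obtain M where M: "\<And>j. j < z \<Longrightarrow> local_data g \<phi> (p j) (M j)" by metis
  have M_pos: "0 < M j a b \<longleftrightarrow> proj_eq (p j) (param g a b)" if "j < z" "normal_pt a b" for j a b
    using M[OF that(1)] that(2) unfolding local_data_def by blast
  \<comment> \<open>The order of the product in the first claim at the point \<open>(a : b)\<close>. Each point lies above at most one singular
    point, so at most one summand is non-zero; truncated subtraction makes the others vanish.\<close>
  define K where "K = (\<lambda>a b. \<Sum>j<z. M j a b - 1)"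
  have K: "(\<forall>t\<in>jminors g. fps_X ^ K a b dvd germ a b t) \<and> (\<exists>t\<in>jminors g. has_order (K a b) (germ a b t))"
    if ab: "normal_pt a b" for a b
  proof (cases "\<exists>j<z. 0 < M j a b")
    case True
    then obtain j where j: "j < z" "0 < M j a b" by blast
    have "M i a b = 0" if "i < z" "i \<noteq> j" for i
    proof (rule ccontr)
      assume "M i a b \<noteq> 0"
      then have "proj_eq (p i) (param g a b)" using M_pos[OF that(1) ab] by simp
      moreover have "proj_eq (p j) (param g a b)" using M_pos[OF j(1) ab] j(2) by simp
      ultimately have "proj_eq (p i) (p j)" using proj_eq_sym proj_eq_trans by meson
      moreover have "proj_eq (p j) (p j)" unfolding proj_eq_def by (intro exI[of _ 1]) simp
      moreover have "\<exists>!k. k < z \<and> proj_eq (p k) (p j)" using p_enumerates p_singular j(1) by simp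
      ultimately show False using j(1) that by blast
    qed
    then have "K a b = (\<Sum>i<z. if i = j then M j a b - 1 else 0)"
      unfolding K_def by (intro sum.cong) auto
    then have "K a b = M j a b - 1" using j(1) by simp
    then show ?thesis using M[OF j(1)] ab j(2) unfolding local_data_def by simp
  next
    case False
    \<comment> \<open>A point that lies above no singular point lies above a regular one, where the ramification order is one.\<close>
    define q where "q = param g a b"
    have qq: "proj_eq q q" unfolding proj_eq_def by (intro exI[of _ 1]) simp
    have q: "q \<in> curve g" unfolding curve_def q_def
      using normal_pt_nonzero[OF ab] qq[unfolded q_def] by blast
    have "q \<notin> singular_points g"
    proof
      assume "q \<in> singular_points g"
      then obtain j where "j < z" "proj_eq (p j) q" using p_enumerates by blast
      then show False using False M_pos[OF _ ab] by (auto simp: q_def)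
    qed
    then have reg: "regular_local_ring (curve_local_ring g q)" using q by (simp add: singular_points_def)
    obtain Q where Q: "local_data g \<phi> q Q" using data[OF q] by blast
    have pos: "0 < Q a b" using Q ab qq unfolding local_data_def by (simp add: q_def)
    have "(\<forall>t\<in>jminors g. fps_X ^ (Q a b - 1) dvd germ a b t) \<and> (\<exists>t\<in>jminors g. has_order (Q a b - 1) (germ a b t))"
      using Q ab pos unfolding local_data_def by blast
    moreover have "Q a b \<le> 1" using Q reg ab unfolding local_data_def by blast
    moreover have "K a b = 0" using False by (simp add: K_def)
    ultimately show ?thesis using pos by simp
  qed
  obtain t0 where t0: "t0 \<in> jminors g" "t0 \<noteq> 0"
  proof -
    obtain t where "t \<in> jminors g" "has_order (K 0 1) (germ 0 1 t)"
      using K[of 0 1] by (auto simp: normal_pt_def)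
    then show thesis using that[of t] has_order_imp_nonzero by fastforce
  qed
  have product: "is_gcd (jminors g) (\<Prod>j<z. \<Prod>u<s j. l j u ^ (e j u - 1)) \<and>
      bihomogeneous (\<Sum>j<z. \<Sum>u<s j. (e j u - 1)) (\<Prod>j<z. \<Prod>u<s j. l j u ^ (e j u - 1)) \<and>
      (\<Prod>j<z. \<Prod>u<s j. l j u ^ (e j u - 1)) \<noteq> 0"
    if gf: "\<forall>j<z. gcd_factorization \<phi> (p j) (s j) (l j) (e j)"
    for l :: "nat \<Rightarrow> nat \<Rightarrow> 'k poly poly" and e :: "nat \<Rightarrow> nat \<Rightarrow> nat"
  proof -
    let ?H = "\<Prod>j<z. \<Prod>u<s j. l j u ^ (e j u - 1)"
    have l: "linear_form (l j u)" if "j < z" "u < s j" for j u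
      using gf that by (simp add: gcd_factorization_def)
    have form: "bihomogeneous (\<Sum>j<z. \<Sum>u<s j. (e j u - 1) * 1) ?H"
      using l by (intro form_prod form_power) (auto simp: linear_form_def)
    have nz: "?H \<noteq> 0" using l by (auto simp: linear_form_def)
    have "is_gcd (jminors g) ?H"
    proof (rule is_gcd_formsI[OF form_jminors t0 form nz])
      fix a b :: 'k assume ab: "normal_pt a b"
      have "has_order (M j a b - 1) (germ a b (\<Prod>u<s j. l j u ^ (e j u - 1)))" if j: "j < z" for j
      proof (rule gcd_factorization_reduced_order[OF _ ab])
        show "gcd_factorization \<phi> (p j) (s j) (l j) (e j)" using gf j by blast
        then have "is_gcd (minors_ideal 1 (row_times (p j) \<phi>)) (\<Prod>u<s j. l j u ^ e j u)"
          by (simp add: gcd_factorization_def)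
        then show "has_order (M j a b) (germ a b (\<Prod>u<s j. l j u ^ e j u))"
          using M[OF j] ab unfolding local_data_def by blast
      qed
      then have "has_order (K a b) (germ a b ?H)"
        unfolding K_def germ.hom_prod[of a b _ "{..<z}"] by (intro has_order_prod) auto
      then show "\<exists>k. has_order k (germ a b ?H) \<and> (\<forall>t\<in>jminors g. fps_X ^ k dvd germ a b t) \<and>
          (\<exists>t\<in>jminors g. has_order k (germ a b t))"
        using K[OF ab] by blast
    qed
    then show ?thesis using form nz by simp
  qed
  have exists: "\<exists>l e. gcd_factorization \<phi> (p j) (s j) l e \<and> (\<Sum>u<s j. e u) = m j" if "j < z" for j
  proof -
    have "s j = branch_number (curve_local_ring g (p j))" "m j = samuel_multiplicity (curve_local_ring g (p j))"
      using s_def m_def that by blast+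
    then show ?thesis using M[OF that] unfolding local_data_def by simp
  qed
  have degree: "int (total_degree h) = (\<Sum>j<z. int (m j) - int (s j))" if h: "is_gcd (jminors g) h" for h
  proof -
    have "\<forall>j. \<exists>le. j < z \<longrightarrow> gcd_factorization \<phi> (p j) (s j) (fst le) (snd le) \<and> (\<Sum>u<s j. snd le u) = m j"
      using exists by simp
    then obtain le where "\<forall>j. j < z \<longrightarrow>
        gcd_factorization \<phi> (p j) (s j) (fst (le j)) (snd (le j)) \<and> (\<Sum>u<s j. snd (le j) u) = m j"
      by (rule choice[THEN exE])
    moreover define l where "l = (\<lambda>j. fst (le j))"
    moreover define e where "e = (\<lambda>j. snd (le j))"
    ultimately have le: "gcd_factorization \<phi> (p j) (s j) (l j) (e j) \<and> (\<Sum>u<s j. e j u) = m j" if "j < z" for j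
      using that by simp
    then have "\<forall>j<z. gcd_factorization \<phi> (p j) (s j) (l j) (e j)" by blast
    note product = product[OF this]
    note H = product[THEN conjunct1] product[THEN conjunct2, THEN conjunct1] product[THEN conjunct2, THEN conjunct2]
    have "total_degree h = (\<Sum>j<z. \<Sum>u<s j. (e j u - 1))"
      by (rule associate_forms_degree[OF H(2,3) is_gcd_unique[OF H(1) h] is_gcd_unique[OF h H(1)]])
    also have "int \<dots> = (\<Sum>j<z. int (m j) - int (s j))"
      unfolding of_nat_sum
    proof (intro sum.cong refl)
      fix j assume "j \<in> {..<z}"
      then have j: "j < z" by simp
      have "(\<Sum>u<s j. int (e j u - 1)) = (\<Sum>u<s j. int (e j u) - 1)"
        using le[OF j] by (intro sum.cong) (auto simp: gcd_factorization_def of_nat_diff Suc_leI)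
      also have "\<dots> = int (\<Sum>u<s j. e j u) - int (s j)" by (simp add: sum_subtractf)
      finally show "(\<Sum>u<s j. int (e j u - 1)) = int (m j) - int (s j)" using le[OF j] by simp
    qed
    finally show ?thesis .
  qed
  show ?thesis
    unfolding is_gcd_jacobian_iff
  proof (intro conjI allI impI)
    show "\<exists>l e. gcd_factorization \<phi> (p j) (s j) l e" if "j < z" for j using exists[OF that] by blast
    show "is_gcd (jminors g) (\<Prod>j<z. \<Prod>u<s j. l j u ^ (e j u - 1))"
      if "\<forall>j<z. gcd_factorization \<phi> (p j) (s j) (l j) (e j)"
      for l :: "nat \<Rightarrow> nat \<Rightarrow> 'k poly poly" and e :: "nat \<Rightarrow> nat \<Rightarrow> nat"
      using product[OF that] by simp
    show "int (total_degree h) = (\<Sum>j<z. int (m j) - int (s j))" if "is_gcd (jminors g) h" for h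
      by (rule degree[OF that])
  qed
qed

end
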